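(* For $m\ge3$ even, $\mathrm{HH}^0(A)$ has the following decomposition into indecomposable $\mathrm{HH}^1(A)$-modules: $$\mathrm{HH}^0(A)=\langle1\rangle\oplus\langle\varepsilon_0\rangle\oplus\langle f_i^s,\ \varepsilon_i+\varepsilon_{i+1}\mid i\in\mathbb Z/m\mathbb Z,\ 1\le s\le N-1\rangle.$$
   Context: Fix integers $N\ge1$, $m\ge3$ and a field $k$ whose characteristic does not divide $2$, $N$ or $m$. $Q$ is the quiver with vertex set $\mathbb Z/m\mathbb Z$ and arrows $a_i:i\to i+1$, $\bar a_i:i+1\to i$ ($i\in\mathbb Z/m\mathbb Z$); paths are composed from left to right, indices are modulo $m$. $A=kQ/\langle a_ia_{i+1},\ \bar a_{i+1}\bar a_i,\ (a_i\bar a_i)^N-(\bar a_{i-1}a_{i-1})^N\mid i\in\mathbb Z/m\mathbb Z\rangle$. $\mathrm{HH}^0(A)$ is the center of $A$, with $k$-basis $\{1,\varepsilon_i,f_i^s\mid i\in\mathbb Z/m\mathbb Z,\ 1\le s\le N-1\}$, where $\varepsilon_i=(a_i\bar a_i)^N$ and $f_i=a_i\bar a_i+\bar a_ia_i$. $\mathrm{HH}^1(A)$ is the Lie algebra of derivations of $A$ modulo inner derivations (with the commutator bracket); it acts on $\mathrm{HH}^0(A)$ by the Gerstenhaber bracket, i.e. $[f,z]=f(z)$ for a derivation $f$ and a central element $z$. It has $k$-basis the classes of the derivations $\varphi_{1,0}$ ($a_i\mapsto a_i$, $\bar a_i\mapsto0$), $\psi_{1,0}$ ($a_i\mapsto0$,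 $\bar a_i\mapsto-\bar a_i$), and $E_{1,j,s}$ for $j\in\mathbb Z/m\mathbb Z$, $1\le s\le N-1$ ($a_j\mapsto a_j(\bar a_ja_j)^s$, all other arrows $\mapsto0$). $\langle\ldots\rangle$ denotes $k$-linear span.
   Formalization: Indecomposability of the third summand is claimed only for N ≥ 2: for N = 1 there are no f_i^s, HH^1(A) acts on all ε_i by common scalars, and the span of the ε_i+ε_{i+1} has dimension m−1 ≥ 3, so it is decomposable. The rest is proved for all N ≥ 1. *)

theory Defs
  imports
    "HOL-Library.Poly_Mapping"
    "Graph_Theory.Arc_Walk"
    "HOL-Algebra.Algebraic_Closure_Type"
begin

section \<open>Path algebras of quivers and their quotients\<close>

text \<open>
  A quiver is a \<^typ>\<open>('v, 'a) pre_digraph\<close>. A path from \<open>u\<close> to \<open>v\<close> with arrows \<open>p\<close> is the triple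
  \<open>(u, p, v)\<close>; the path of length 0 at \<open>v\<close> is \<open>(v, [], v)\<close>. Paths are composed from left to right.
\<close>

type_synonym ('v, 'a) qpath = "'v \<times> 'a list \<times> 'v"

definition qpaths :: "('v, 'a) pre_digraph \<Rightarrow> ('v, 'a) qpath set" where
  "qpaths G = {(u, p, v). pre_digraph.awalk G u p v}"

fun qpath_comp :: "('v, 'a) qpath \<Rightarrow> ('v, 'a) qpath \<Rightarrow> ('v, 'a) qpath option" where
  "qpath_comp (u, p, v) (v', q, w) = (if v = v' then Some (u, p @ q, w) else None)"

text \<open>
  The product is the bilinear extension of the composition of paths, non-composable paths having
  product 0. The unit is the sum of all paths of length 0 (the quivers used have finitely many
  vertices).
\<close>

definition path_algebra ::
    "('v, 'a) pre_digraph \<Rightarrow> ('k::field, ('v, 'a) qpath \<Rightarrow>\<^sub>0 'k) module" where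
  "path_algebra G =
    \<lparr>carrier = {f. Poly_Mapping.keys f \<subseteq> qpaths G},
     monoid.mult = (\<lambda>f g. \<Sum>x \<in> Poly_Mapping.keys f. \<Sum>y \<in> Poly_Mapping.keys g.
       (case qpath_comp x y of
          None \<Rightarrow> 0
        | Some z \<Rightarrow> Poly_Mapping.single z (Poly_Mapping.lookup f x * Poly_Mapping.lookup g y))),
     one = (\<Sum>v \<in> verts G. Poly_Mapping.single (v, [], v) 1),
     zero = 0,
     add = (+),
     module.smult = (\<lambda>c. Poly_Mapping.map ((*) c))\<rparr>"

definition arrow_elem :: "('v, 'a) pre_digraph \<Rightarrow> 'a \<Rightarrow> ('v, 'a) qpath \<Rightarrow>\<^sub>0 'k::field" where
  "arrow_elem G e = Poly_Mapping.single (tail G e, [e], head G e) 1"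

text \<open>The quotient ring, together with the scalar multiplication \<open>c (I + x) = I + c x\<close>.\<close>

definition quotient_algebra :: "('k, 'b) module \<Rightarrow> 'b set \<Rightarrow> ('k, 'b set) module" where
  "quotient_algebra R I =
    ring.extend (R Quot I) (module.fields (\<lambda>c Y. \<Union>x\<in>Y. I +>\<^bsub>R\<^esub> (c \<odot>\<^bsub>R\<^esub> x)))"


section \<open>Linear algebra inside an algebra over a field\<close>

abbreviation is_subspace :: "('k::field, 'b) module \<Rightarrow> 'b set \<Rightarrow> bool" where
  "is_subspace A V \<equiv> submodule V (ring_of_type_algebra :: 'k ring) A"

definition linear_span :: "('k::field, 'b) module \<Rightarrow> 'b set \<Rightarrow> 'b set" where
  "linear_span A S = \<Inter>{V. is_subspace A V \<and> S \<subseteq> V}"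

text \<open>\<open>V\<close> is the internal direct sum of the members of the list \<open>Us\<close>: the summation map from the
  product of the \<open>Us\<close> is a bijection onto \<open>V\<close>.\<close>

definition is_direct_sum :: "('k, 'b) module \<Rightarrow> 'b set \<Rightarrow> 'b set list \<Rightarrow> bool" where
  "is_direct_sum A V Us \<longleftrightarrow>
     bij_betw (\<lambda>us. foldr (\<lambda>u v. u \<oplus>\<^bsub>A\<^esub> v) us \<zero>\<^bsub>A\<^esub>) (listset Us) V"


section \<open>Hochschild cohomology in degrees 0 and 1\<close>

definition HH0 :: "('k, 'b) module \<Rightarrow> 'b set" where
  "HH0 A = {z \<in> carrier A. \<forall>x \<in> carrier A. z \<otimes>\<^bsub>A\<^esub> x = x \<otimes>\<^bsub>A\<^esub> z}"

definition derivations :: "('k, 'b) module \<Rightarrow> ('b \<Rightarrow> 'b) set" where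
  "derivations A = {d \<in> carrier A \<rightarrow>\<^sub>E carrier A.
     (\<forall>x \<in> carrier A. \<forall>y \<in> carrier A. d (x \<oplus>\<^bsub>A\<^esub> y) = d x \<oplus>\<^bsub>A\<^esub> d y) \<and>
     (\<forall>c. \<forall>x \<in> carrier A. d (c \<odot>\<^bsub>A\<^esub> x) = c \<odot>\<^bsub>A\<^esub> d x) \<and>
     (\<forall>x \<in> carrier A. \<forall>y \<in> carrier A.
        d (x \<otimes>\<^bsub>A\<^esub> y) = d x \<otimes>\<^bsub>A\<^esub> y \<oplus>\<^bsub>A\<^esub> x \<otimes>\<^bsub>A\<^esub> d y)}"

definition inner_derivations :: "('k, 'b) module \<Rightarrow> ('b \<Rightarrow> 'b) set" where
  "inner_derivations A =
     (\<lambda>a. \<lambda>x \<in> carrier A. a \<otimes>\<^bsub>A\<^esub> x \<ominus>\<^bsub>A\<^esub> x \<otimes>\<^bsub>A\<^esub> a) ` carrier A"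

definition HH1 :: "('k, 'b) module \<Rightarrow> ('b \<Rightarrow> 'b) set set" where
  "HH1 A = derivations A //
     {(d, d'). d \<in> derivations A \<and> d' \<in> derivations A \<and>
        (\<lambda>x \<in> carrier A. d x \<ominus>\<^bsub>A\<^esub> d' x) \<in> inner_derivations A}"

text \<open>
  The Gerstenhaber bracket of a class \<open>c\<close> in \<^const>\<open>HH1\<close> with a central element \<open>z\<close>: the common value
  at \<open>z\<close> of all derivations in the class \<open>c\<close> (inner derivations vanish on the centre).
\<close>

definition HH1_act :: "('b \<Rightarrow> 'b) set \<Rightarrow> 'b \<Rightarrow> 'b" where
  "HH1_act c z = the_elem ((\<lambda>d. d z) ` c)"

text \<open>
  Submodules of the Lie module \<^const>\<open>HH0\<close>. Being a submodule, and hence being indecomposable, depends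
  only on the action and not on the bracket of \<^const>\<open>HH1\<close>.
\<close>

definition HH1_submodule :: "('k::field, 'b) module \<Rightarrow> 'b set \<Rightarrow> bool" where
  "HH1_submodule A U \<longleftrightarrow>
     is_subspace A U \<and> U \<subseteq> HH0 A \<and> (\<forall>c \<in> HH1 A. \<forall>z \<in> U. HH1_act c z \<in> U)"

definition HH1_indecomposable :: "('k::field, 'b) module \<Rightarrow> 'b set \<Rightarrow> bool" where
  "HH1_indecomposable A U \<longleftrightarrow>
     HH1_submodule A U \<and> U \<noteq> {\<zero>\<^bsub>A\<^esub>} \<and>
     (\<forall>V W. HH1_submodule A V \<and> HH1_submodule A W \<and> is_direct_sum A U [V, W] \<longrightarrow>
        V = {\<zero>\<^bsub>A\<^esub>} \<or> W = {\<zero>\<^bsub>A\<^esub>})"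


section \<open>The quiver \<open>Q\<close> and the algebra \<open>A\<close>\<close>

text \<open>
  The vertices are the residues \<open>0, \<dots>, m - 1\<close>; \<open>Fwd i\<close> is the arrow from \<open>i\<close> to \<open>i + 1\<close> and \<open>Bwd i\<close>
  the arrow from \<open>i + 1\<close> to \<open>i\<close>.
\<close>

datatype arrow = Fwd int | Bwd int

definition cyc_quiver :: "nat \<Rightarrow> (int, arrow) pre_digraph" where
  "cyc_quiver m =
    \<lparr>verts = {0..<int m},
     arcs = Fwd ` {0..<int m} \<union> Bwd ` {0..<int m},
     tail = (\<lambda>e. case e of Fwd i \<Rightarrow> i | Bwd i \<Rightarrow> (i + 1) mod int m),
     head = (\<lambda>e. case e of Fwd i \<Rightarrow> (i + 1) mod int m | Bwd i \<Rightarrow> i)\<rparr>"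

type_synonym 'k pathalg = "(int, arrow) qpath \<Rightarrow>\<^sub>0 'k"

abbreviation kQ :: "nat \<Rightarrow> ('k::field, 'k pathalg) module" where
  "kQ m \<equiv> path_algebra (cyc_quiver m)"

text \<open>The arrows as elements of the path algebra, with the index \<open>i\<close> read modulo \<open>m\<close>.\<close>

definition aQ :: "nat \<Rightarrow> int \<Rightarrow> 'k::field pathalg" where
  "aQ m i = arrow_elem (cyc_quiver m) (Fwd (i mod int m))"

definition abarQ :: "nat \<Rightarrow> int \<Rightarrow> 'k::field pathalg" where
  "abarQ m i = arrow_elem (cyc_quiver m) (Bwd (i mod int m))"

definition relations :: "nat \<Rightarrow> nat \<Rightarrow> 'k::field pathalg set" where
  "relations N m =
     (\<Union>i. {aQ m i \<otimes>\<^bsub>kQ m\<^esub> aQ m (i + 1),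
           abarQ m (i + 1) \<otimes>\<^bsub>kQ m\<^esub> abarQ m i,
           (aQ m i \<otimes>\<^bsub>kQ m\<^esub> abarQ m i) [^]\<^bsub>kQ m\<^esub> N
             \<ominus>\<^bsub>kQ m\<^esub> (abarQ m (i - 1) \<otimes>\<^bsub>kQ m\<^esub> aQ m (i - 1)) [^]\<^bsub>kQ m\<^esub> N})"

definition rel_ideal :: "nat \<Rightarrow> nat \<Rightarrow> 'k::field pathalg set" where
  "rel_ideal N m = Idl\<^bsub>kQ m\<^esub> (relations N m)"

definition algA :: "nat \<Rightarrow> nat \<Rightarrow> ('k::field, 'k pathalg set) module" where
  "algA N m = quotient_algebra (kQ m) (rel_ideal N m)"

definition aA :: "nat \<Rightarrow> nat \<Rightarrow> int \<Rightarrow> 'k::field pathalg set" where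
  "aA N m i = rel_ideal N m +>\<^bsub>kQ m\<^esub> aQ m i"

definition abarA :: "nat \<Rightarrow> nat \<Rightarrow> int \<Rightarrow> 'k::field pathalg set" where
  "abarA N m i = rel_ideal N m +>\<^bsub>kQ m\<^esub> abarQ m i"

definition eps :: "nat \<Rightarrow> nat \<Rightarrow> int \<Rightarrow> 'k::field pathalg set" where
  "eps N m i = (aA N m i \<otimes>\<^bsub>algA N m\<^esub> abarA N m i) [^]\<^bsub>algA N m\<^esub> N"

definition ff :: "nat \<Rightarrow> nat \<Rightarrow> int \<Rightarrow> 'k::field pathalg set" where
  "ff N m i = aA N m i \<otimes>\<^bsub>algA N m\<^esub> abarA N m i \<oplus>\<^bsub>algA N m\<^esub> abarA N m i \<otimes>\<^bsub>algA N m\<^esub> aA N m i"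

end

theory Submission
  imports Defs
begin

text \<open>
  In \<open>A\<close> the nonzero paths are the alternating words of length at most \<open>2N\<close>, subject only to the
  identification of the two words of length \<open>2N\<close> at each vertex; the product of two such words is
  again such a word or \<open>0\<close>, and length is additive. Comparing coordinates, a derivation \<open>d\<close> sends
  \<open>f\<^sub>i\<close> into the span of the powers of \<open>f\<^sub>i\<close> and \<open>\<epsilon>\<^sub>i\<close> to a multiple of itself, so all three spans are
  submodules. As \<open>f\<^sub>i\<^sup>N = \<epsilon>\<^sub>i + \<epsilon>\<^bsub>i+1\<^esub>\<close>, the third one is spanned by the powers of the \<open>f\<^sub>i\<close>, and
  inside the centre it is cut out by the vanishing of the coefficient of \<open>1\<close> and of the alternating
  sum of the coefficients of the \<open>\<epsilon>\<^sub>i\<close>, which makes sense because \<open>m\<close> is even.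

  For the indecomposability of \<open>U\<^sub>3\<close>, multiply the Euler derivation by \<open>f\<^sub>j\<^sup>s\<close>: the result sends \<open>f\<^sub>j\<^sup>t\<close> to
  \<open>2t f\<^sub>j\<^bsup>s+t\<^esup>\<close> and kills the powers of the other \<open>f\<^sub>i\<close>. If \<open>U\<^sub>3 = V \<oplus> W\<close> and \<open>f\<^sub>j = v\<^sub>j + w\<^sub>j\<close>, these
  derivations show that the linear parts of \<open>v\<^sub>j\<close> and \<open>w\<^sub>j\<close> are multiples of \<open>f\<^sub>j\<close> and that each \<open>f\<^sub>j\<^sup>N\<close>
  lies in \<open>V\<close> or in \<open>W\<close>. The relation that the alternating sum of the \<open>f\<^sub>j\<^sup>N\<close> is \<open>0\<close> is, up to a
  scalar, the only one, so all of them lie in the same summand, say \<open>W\<close>. Then no \<open>v\<^sub>j\<close> has a linear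
  part, and pushing \<open>V\<close> down the filtration by powers gives \<open>V = 0\<close>.
\<close>

section \<open>Algebras with a multiplicative basis\<close>

text \<open>The obstacle is that \<open>A\<close> is a quotient by an ideal given only by
  generators, where it is hard to see that a word is nonzero or that words are independent.
  Therefore an explicit multiplication table on the alternating words is compared with the path
  algebra: the map that adds up the coefficients of all paths in each class respects the table, so
  its kernel is a two-sided ideal containing the relations. Conversely, every path can be reduced
  modulo the relations to a chosen word, so the ideal is the whole kernel. Associativity of the
  table is inherited from the quotient ring. After that every identity in \<open>A\<close> is
  checked on coordinates. The factor 2 in the Euler eigenvalues \<open>2 * t\<close> is where
  characteristic 2 must be excluded: linear parts are recovered by dividing by it. For
  \<open>N = 1\<close> the third summand is spanned by the sums \<open>eps_i + eps_(i+1)\<close>, on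
  which \<open>HH1\<close> acts by scalars, so it does split; this is why its indecomposability is
  claimed for \<open>N \<ge> 2\<close>.\<close>

text \<open>\<open>None\<close> encodes the product 0. The interface speaks of coordinates because
  these can be evaluated on cosets; the basis elements are recovered from them afterwards as
  preimages of indicator functions (\<open>bas\<close>).\<close>

locale multiplicative_basis = ring A for A :: "('k::field, 'b) module" (structure) +
  fixes B :: "'i set"
    and mu :: "'i \<Rightarrow> 'i \<Rightarrow> 'i option"
    and coord :: "'b \<Rightarrow> 'i \<Rightarrow> 'k"
  assumes finite_basis: "finite B"
    and mu_closed: "\<lbrakk>b \<in> B; c \<in> B; mu b c = Some d\<rbrakk> \<Longrightarrow> d \<in> B"
    and coord_inj: "inj_on coord (carrier A)"
    and coord_image: "coord ` carrier A = {F. \<forall>b. b \<notin> B \<longrightarrow> F b = 0}"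
    and coord_add: "\<lbrakk>x \<in> carrier A; y \<in> carrier A\<rbrakk> \<Longrightarrow> coord (x \<oplus> y) b = coord x b + coord y b"
    and smult_closed [intro, simp]: "x \<in> carrier A \<Longrightarrow> t \<odot> x \<in> carrier A"
    and coord_smult: "x \<in> carrier A \<Longrightarrow> coord (t \<odot> x) b = t * coord x b"
    and coord_mult: "\<lbrakk>x \<in> carrier A; y \<in> carrier A\<rbrakk> \<Longrightarrow>
      coord (x \<otimes> y) b = (\<Sum>c\<in>B. \<Sum>d\<in>B. if mu c d = Some b then coord x c * coord y d else 0)"
begin

lemma coord_outside: "x \<in> carrier A \<Longrightarrow> b \<notin> B \<Longrightarrow> coord x b = 0"
  using coord_image by auto

lemma coord_eqI:
  assumes "x \<in> carrier A" "y \<in> carrier A" "\<And>b. b \<in> B \<Longrightarrow> coord x b = coord y b"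
  shows "x = y"
proof -
  have "coord x b = coord y b" for b
    using assms coord_outside by (cases "b \<in> B") auto
  then show ?thesis
    using coord_inj assms(1,2) by (meson ext inj_onD)
qed

lemma coord_zero [simp]: "coord \<zero> b = 0"
  by (metis add.right_neutral add_left_cancel coord_add l_zero zero_closed)

lemma coord_neg: "x \<in> carrier A \<Longrightarrow> coord (\<ominus> x) b = - coord x b"
  using coord_add[of x "\<ominus> x" b] by (simp add: r_neg eq_neg_iff_add_eq_0 add.commute)

lemma coord_diff: "x \<in> carrier A \<Longrightarrow> y \<in> carrier A \<Longrightarrow> coord (x \<ominus> y) b = coord x b - coord y b"
  by (simp add: a_minus_def coord_add coord_neg)

definition elt :: "('i \<Rightarrow> 'k) \<Rightarrow> 'b" where
  "elt F = the_inv_into (carrier A) coord F"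

lemma elt_props:
  assumes "\<And>b. b \<notin> B \<Longrightarrow> F b = 0"
  shows elt_closed: "elt F \<in> carrier A" and coord_elt: "coord (elt F) = F"
proof -
  have F: "F \<in> coord ` carrier A"
    using assms coord_image by auto
  show "elt F \<in> carrier A"
    unfolding elt_def by (rule the_inv_into_into[OF coord_inj F]) simp
  show "coord (elt F) = F"
    unfolding elt_def by (rule f_the_inv_into_f[OF coord_inj F])
qed

definition bas :: "'i \<Rightarrow> 'b" where
  "bas c = elt (\<lambda>b. if b = c then 1 else 0)"

lemma bas_closed [simp]: "c \<in> B \<Longrightarrow> bas c \<in> carrier A"
  unfolding bas_def by (rule elt_closed) auto

lemma coord_bas: "c \<in> B \<Longrightarrow> coord (bas c) b = (if b = c then 1 else 0)"
  unfolding bas_def by (subst coord_elt) auto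

lemma coord_mult_bas:
  assumes "x \<in> carrier A" "c \<in> B"
  shows "coord (x \<otimes> bas c) b = (\<Sum>a\<in>B. if mu a c = Some b then coord x a else 0)"
proof -
  have "coord (x \<otimes> bas c) b
      = (\<Sum>a\<in>B. \<Sum>d\<in>B. if d = c then (if mu a c = Some b then coord x a else 0) else 0)"
    using assms by (auto simp: coord_mult coord_bas intro!: sum.cong)
  then show ?thesis
    using assms finite_basis by simp
qed

lemma coord_bas_mult:
  assumes "x \<in> carrier A" "c \<in> B"
  shows "coord (bas c \<otimes> x) b = (\<Sum>a\<in>B. if mu c a = Some b then coord x a else 0)"
proof -
  have "coord (bas c \<otimes> x) b
      = (\<Sum>d\<in>B. \<Sum>a\<in>B. if d = c then (if mu c a = Some b then coord x a else 0) else 0)"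
    using assms by (auto simp: coord_mult coord_bas intro!: sum.cong)
  also have "\<dots> = (\<Sum>a\<in>B. \<Sum>d\<in>B. if d = c then (if mu c a = Some b then coord x a else 0) else 0)"
    by (rule sum.swap)
  finally show ?thesis
    using assms finite_basis by simp
qed

lemma bas_mult:
  assumes "b \<in> B" "c \<in> B"
  shows "bas b \<otimes> bas c = (case mu b c of None \<Rightarrow> \<zero> | Some d \<Rightarrow> bas d)"
proof (rule coord_eqI)
  show "(case mu b c of None \<Rightarrow> \<zero> | Some d \<Rightarrow> bas d) \<in> carrier A"
    using assms mu_closed[OF assms] by (auto split: option.split)
  fix e
  have "coord (bas b \<otimes> bas c) e = (\<Sum>a\<in>B. if a = b then (if mu b c = Some e then 1 else 0) else 0)"
    unfolding coord_mult_bas[OF bas_closed[OF assms(1)] assms(2)]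
    by (rule sum.cong) (auto simp: coord_bas assms)
  also have "\<dots> = (if mu b c = Some e then 1 else 0)"
    using assms finite_basis by simp
  finally have "coord (bas b \<otimes> bas c) e = (if mu b c = Some e then 1 else 0)" .
  then show "coord (bas b \<otimes> bas c) e = coord (case mu b c of None \<Rightarrow> \<zero> | Some d \<Rightarrow> bas d) e"
    using mu_closed[OF assms] by (auto simp: coord_bas split: option.split)
qed (use assms in auto)

lemma smult_add: "x \<in> carrier A \<Longrightarrow> y \<in> carrier A \<Longrightarrow> t \<odot> (x \<oplus> y) = t \<odot> x \<oplus> t \<odot> y"
  by (rule coord_eqI) (auto simp: coord_add coord_smult algebra_simps)

lemma smult_smult: "x \<in> carrier A \<Longrightarrow> s \<odot> (t \<odot> x) = (s * t) \<odot> x"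
  by (rule coord_eqI) (auto simp: coord_smult)

lemma add_smult: "x \<in> carrier A \<Longrightarrow> (s + t) \<odot> x = s \<odot> x \<oplus> t \<odot> x"
  by (rule coord_eqI) (auto simp: coord_add coord_smult algebra_simps)

lemma zero_smult [simp]: "x \<in> carrier A \<Longrightarrow> 0 \<odot> x = \<zero>"
  by (rule coord_eqI) (auto simp: coord_smult)

lemma smult_zero [simp]: "t \<odot> \<zero> = \<zero>"
  by (rule coord_eqI) (auto simp: coord_smult)

lemma one_smult [simp]: "x \<in> carrier A \<Longrightarrow> 1 \<odot> x = x"
  by (rule coord_eqI) (auto simp: coord_smult)

lemma uminus_smult: "x \<in> carrier A \<Longrightarrow> (-1) \<odot> x = \<ominus> x"
  by (rule coord_eqI) (auto simp: coord_smult coord_neg)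

lemma smult_mult_left: "x \<in> carrier A \<Longrightarrow> y \<in> carrier A \<Longrightarrow> (t \<odot> x) \<otimes> y = t \<odot> (x \<otimes> y)"
  by (rule coord_eqI)
    (auto simp: coord_smult coord_mult sum_distrib_left algebra_simps intro!: sum.cong)

lemma smult_mult_right: "x \<in> carrier A \<Longrightarrow> y \<in> carrier A \<Longrightarrow> x \<otimes> (t \<odot> y) = t \<odot> (x \<otimes> y)"
  by (rule coord_eqI)
    (auto simp: coord_smult coord_mult sum_distrib_left algebra_simps intro!: sum.cong)

section \<open>Subspaces and linear spans\<close>

lemma is_subspace_iff:
  "is_subspace A V \<longleftrightarrow> V \<subseteq> carrier A \<and> \<zero> \<in> V \<and> (\<forall>x\<in>V. \<forall>y\<in>V. x \<oplus> y \<in> V) \<and> (\<forall>t. \<forall>x\<in>V. t \<odot> x \<in> V)"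
  (is "?L \<longleftrightarrow> ?R")
proof
  assume L: ?L
  interpret submodule V "ring_of_type_algebra :: 'k ring" A
    using L .
  show ?R
    using subset one_closed m_closed smult_closed by (auto simp: ring_of_type_algebra_def)
next
  assume R: ?R
  then have "\<ominus> x \<in> V" if "x \<in> V" for x
    using that uminus_smult[of x] by (metis subsetD)
  then show ?L
    using R by unfold_locales (auto simp: a_inv_def[symmetric])
qed

lemma subspaceD:
  assumes "is_subspace A V"
  shows "V \<subseteq> carrier A" "\<zero> \<in> V" "\<lbrakk>x \<in> V; y \<in> V\<rbrakk> \<Longrightarrow> x \<oplus> y \<in> V" "x \<in> V \<Longrightarrow> t \<odot> x \<in> V"
  using assms unfolding is_subspace_iff by blast+

lemma linear_span_subspace:
  assumes "S \<subseteq> carrier A"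
  shows "is_subspace A (linear_span A S)"
  unfolding is_subspace_iff
proof (intro conjI ballI allI)
  have "is_subspace A (carrier A)"
    by (simp add: is_subspace_iff)
  then show "linear_span A S \<subseteq> carrier A"
    using assms unfolding linear_span_def by blast
  show "\<zero> \<in> linear_span A S"
    using subspaceD(2) unfolding linear_span_def by blast
  show "x \<oplus> y \<in> linear_span A S" if "x \<in> linear_span A S" "y \<in> linear_span A S" for x y
    using subspaceD(3) that unfolding linear_span_def by blast
  show "t \<odot> x \<in> linear_span A S" if "x \<in> linear_span A S" for t x
    using subspaceD(4) that unfolding linear_span_def by blast
qed

lemma linear_span_superset: "S \<subseteq> linear_span A S"
  by (auto simp: linear_span_def)

lemma linear_span_minimal: "is_subspace A V \<Longrightarrow> S \<subseteq> V \<Longrightarrow> linear_span A S \<subseteq> V"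
  by (auto simp: linear_span_def)

text \<open>Stands in for finite sums in \<open>A\<close>: a linear combination is expressed as a
  sum of field elements in each coordinate, so no sum over the ring carrier has to be
  manipulated.\<close>

lemma subspace_combination:
  assumes V: "is_subspace A V" and "finite I" and "\<And>i. i \<in> I \<Longrightarrow> g i \<in> V"
    and "x \<in> carrier A" and "\<And>b. b \<in> B \<Longrightarrow> coord x b = (\<Sum>i\<in>I. t i * coord (g i) b)"
  shows "x \<in> V"
  using assms(2-5)
proof (induction I arbitrary: x)
  case empty
  then have "x = \<zero>"
    by (intro coord_eqI) auto
  then show ?case
    using V by (simp add: is_subspace_iff)
next
  case (insert i I)
  have gi: "g i \<in> carrier A" "t i \<odot> g i \<in> V"
    using insert.prems(1)[of i] V by (auto simp: is_subspace_iff)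
  have "x \<ominus> t i \<odot> g i \<in> V"
  proof (rule insert.IH)
    show "coord (x \<ominus> t i \<odot> g i) b = (\<Sum>i\<in>I. t i * coord (g i) b)" if "b \<in> B" for b
      using insert.prems(2,3) insert.hyps that gi by (simp add: coord_diff coord_smult)
  qed (use insert.prems(1,2) gi in simp_all)
  moreover have "x = (x \<ominus> t i \<odot> g i) \<oplus> t i \<odot> g i"
    using gi insert.prems(2) by (intro coord_eqI) (auto simp: coord_add coord_diff)
  ultimately show ?case
    using subspaceD(3)[OF V _ gi(2)] by metis
qed

lemma linear_span_singleton:
  assumes "x \<in> carrier A"
  shows "linear_span A {x} = range (\<lambda>t. t \<odot> x)"
proof
  show "linear_span A {x} \<subseteq> range (\<lambda>t. t \<odot> x)"
  proof (rule linear_span_minimal)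
    have "\<exists>r. s \<odot> x \<oplus> t \<odot> x = r \<odot> x" for s t
      using assms by (metis add_smult)
    moreover have "\<exists>r. s \<odot> (t \<odot> x) = r \<odot> x" for s t
      using assms by (metis smult_smult)
    moreover have "\<exists>r. \<zero> = r \<odot> x"
      using assms zero_smult by metis
    ultimately show "is_subspace A (range (\<lambda>t. t \<odot> x))"
      unfolding is_subspace_iff using assms by (auto intro: rangeI simp: image_iff)
    show "{x} \<subseteq> range (\<lambda>t. t \<odot> x)"
      using assms one_smult by (metis empty_subsetI insert_subset rangeI)
  qed
  show "range (\<lambda>t. t \<odot> x) \<subseteq> linear_span A {x}"
    using assms subspaceD(4)[OF linear_span_subspace[of "{x}"]] linear_span_superset[of "{x}"]
    by auto
qed

section \<open>The centre\<close>

lemma HH0_subspace: "is_subspace A (HH0 A)"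
  unfolding is_subspace_iff HH0_def
  by (auto simp: l_distr r_distr smult_mult_left smult_mult_right)

lemma HH0_closed: "z \<in> HH0 A \<Longrightarrow> z \<in> carrier A"
  by (simp add: HH0_def)

lemma HH0_commute: "z \<in> HH0 A \<Longrightarrow> x \<in> carrier A \<Longrightarrow> z \<otimes> x = x \<otimes> z"
  by (simp add: HH0_def)

lemma HH0_mult:
  assumes y: "y \<in> HH0 A" and z: "z \<in> HH0 A"
  shows "y \<otimes> z \<in> HH0 A"
proof -
  note [simp] = HH0_closed[OF y] HH0_closed[OF z]
  have "y \<otimes> z \<otimes> x = x \<otimes> (y \<otimes> z)" if x: "x \<in> carrier A" for x
  proof -
    have "y \<otimes> z \<otimes> x = y \<otimes> x \<otimes> z"
      using x HH0_commute[OF z x] by (simp add: m_assoc)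
    then show ?thesis
      using x HH0_commute[OF y x] by (simp add: m_assoc)
  qed
  then show ?thesis
    by (simp add: HH0_def)
qed

lemma HH0_one: "\<one> \<in> HH0 A"
  by (simp add: HH0_def)

lemma HH0_pow: "z \<in> HH0 A \<Longrightarrow> z [^] (n::nat) \<in> HH0 A"
  by (induction n) (auto simp: HH0_one HH0_mult)

text \<open>The elements commuting with \<open>z\<close> form a subspace, and the basis spans the
  algebra.\<close>

lemma HH0I:
  assumes "z \<in> carrier A" "\<And>b. b \<in> B \<Longrightarrow> z \<otimes> bas b = bas b \<otimes> z"
  shows "z \<in> HH0 A"
proof -
  let ?V = "{x \<in> carrier A. z \<otimes> x = x \<otimes> z}"
  have V: "is_subspace A ?V"
    using assms(1) by (auto simp: is_subspace_iff l_distr r_distr smult_mult_left smult_mult_right)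
  have "x \<in> ?V" if "x \<in> carrier A" for x
  proof (rule subspace_combination[OF V finite_basis, where g = bas and t = "coord x"])
    show "coord x b = (\<Sum>i\<in>B. coord x i * coord (bas i) b)" if "b \<in> B" for b
    proof -
      have "(\<Sum>i\<in>B. coord x i * coord (bas i) b) = (\<Sum>i\<in>B. if i = b then coord x b else 0)"
        by (auto simp: coord_bas intro!: sum.cong)
      then show ?thesis
        using that finite_basis by simp
    qed
  qed (use assms that in auto)
  then show ?thesis
    using assms by (auto simp: HH0_def)
qed

section \<open>Derivations\<close>

lemma derivation_closed: "d \<in> derivations A \<Longrightarrow> x \<in> carrier A \<Longrightarrow> d x \<in> carrier A"
  by (auto simp: derivations_def)

lemma derivation_add:
  "d \<in> derivations A \<Longrightarrow> x \<in> carrier A \<Longrightarrow> y \<in> carrier A \<Longrightarrow> d (x \<oplus> y) = d x \<oplus> d y"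
  by (auto simp: derivations_def)

lemma derivation_smult: "d \<in> derivations A \<Longrightarrow> x \<in> carrier A \<Longrightarrow> d (t \<odot> x) = t \<odot> d x"
  by (auto simp: derivations_def)

lemma derivation_mult:
  "d \<in> derivations A \<Longrightarrow> x \<in> carrier A \<Longrightarrow> y \<in> carrier A \<Longrightarrow> d (x \<otimes> y) = d x \<otimes> y \<oplus> x \<otimes> d y"
  by (auto simp: derivations_def)

lemma derivation_zero: "d \<in> derivations A \<Longrightarrow> d \<zero> = \<zero>"
  using derivation_smult[of d \<zero> 0] derivation_closed[of d \<zero>] by simp

lemma derivation_one:
  assumes "d \<in> derivations A"
  shows "d \<one> = \<zero>"
proof -
  have "d \<one> = d \<one> \<oplus> d \<one>"
    using derivation_mult[of d \<one> \<one>] assms derivation_closed[of d \<one>] by simp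
  then show ?thesis
    using derivation_closed[of d \<one>] assms by simp
qed

text \<open>Differentiate \<open>z x = x z\<close>; the terms \<open>z d(x)\<close> and
  \<open>d(x) z\<close> agree because \<open>z\<close> is central, and cancel.\<close>

lemma derivation_HH0:
  assumes d: "d \<in> derivations A" and z: "z \<in> HH0 A"
  shows "d z \<in> HH0 A"
proof -
  note closed = derivation_closed[OF d] HH0_closed[OF z]
  have "d z \<otimes> x = x \<otimes> d z" if x: "x \<in> carrier A" for x
  proof -
    have "d (z \<otimes> x) = d (x \<otimes> z)"
      using HH0_commute[OF z x] by simp
    then have "d z \<otimes> x \<oplus> z \<otimes> d x = d x \<otimes> z \<oplus> x \<otimes> d z"
      using d x closed by (simp add: derivation_mult)
    moreover have "z \<otimes> d x = d x \<otimes> z"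
      using HH0_commute[OF z] closed(1)[OF x] .
    ultimately have "d x \<otimes> z \<oplus> d z \<otimes> x = d x \<otimes> z \<oplus> x \<otimes> d z"
      using closed x by (simp add: a_comm)
    then show ?thesis
      using closed x by simp
  qed
  then show ?thesis
    using closed by (simp add: HH0_def)
qed

lemma derivation_pow:
  assumes d: "d \<in> derivations A" and z: "z \<in> HH0 A"
  shows "d (z [^] Suc n) = of_nat (Suc n) \<odot> (z [^] n \<otimes> d z)"
proof (induction n)
  case 0
  then show ?case
    using derivation_closed[OF d HH0_closed[OF z]] HH0_closed[OF z] by simp
next
  case (Suc n)
  note closed = derivation_closed[OF d HH0_closed[OF z]] HH0_closed[OF z]
  have "d (z [^] Suc (Suc n)) = d (z [^] Suc n) \<otimes> z \<oplus> z [^] Suc n \<otimes> d z"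
    using derivation_mult[OF d, of "z [^] Suc n" z] closed by simp
  also have "d (z [^] Suc n) \<otimes> z = of_nat (Suc n) \<odot> (z [^] Suc n \<otimes> d z)"
    using Suc closed HH0_commute[OF z, of "d z"]
    by (simp add: smult_mult_left m_assoc)
  finally show ?case
    using closed add_smult[of "z [^] Suc n \<otimes> d z" "of_nat (Suc n)" 1] by (simp add: add.commute)
qed

text \<open>Derivations form a module over the centre: the Leibniz rule survives because
  \<open>z\<close> can be moved past \<open>x\<close> in \<open>z x d(y)\<close>. This turns the
  single Euler derivation into the family used against a splitting.\<close>

lemma central_mult_derivation:
  assumes d: "d \<in> derivations A" and z: "z \<in> HH0 A"
  shows "(\<lambda>x\<in>carrier A. z \<otimes> d x) \<in> derivations A"
proof -
  note [simp] = HH0_closed[OF z] derivation_closed[OF d]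
  have "z \<otimes> (x \<otimes> d y) = x \<otimes> (z \<otimes> d y)" if "x \<in> carrier A" "y \<in> carrier A" for x y
    using that HH0_commute[OF z, of x] by (simp add: m_assoc[symmetric])
  then show ?thesis
    unfolding derivations_def
    by (auto simp: derivation_add[OF d] derivation_mult[OF d] derivation_smult[OF d]
        r_distr smult_mult_right m_assoc)
qed

definition euler :: "('i \<Rightarrow> nat) \<Rightarrow> 'b \<Rightarrow> 'b" where
  "euler w = (\<lambda>x\<in>carrier A. elt (\<lambda>b. of_nat (w b) * coord x b))"

lemma euler_closed: "x \<in> carrier A \<Longrightarrow> euler w x \<in> carrier A"
  by (auto simp: euler_def coord_outside intro!: elt_closed)

lemma coord_euler: "x \<in> carrier A \<Longrightarrow> coord (euler w x) b = of_nat (w b) * coord x b"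
  by (auto simp: euler_def coord_outside coord_elt)

text \<open>Every term of \<open>coord_mult\<close> that contributes to one coordinate carries the
  same weight, the sum of the weights of its two factors, and this sum is what the Leibniz rule asks
  for.\<close>

lemma euler_derivation:
  assumes w: "\<And>b c d. b \<in> B \<Longrightarrow> c \<in> B \<Longrightarrow> mu b c = Some d \<Longrightarrow> w d = w b + w c"
  shows "euler w \<in> derivations A"
  unfolding derivations_def
proof (intro CollectI conjI ballI allI)
  show "euler w \<in> carrier A \<rightarrow>\<^sub>E carrier A"
    using euler_closed by (auto simp: euler_def)
  fix x y assume xy: "x \<in> carrier A" "y \<in> carrier A"
  show "euler w (x \<oplus> y) = euler w x \<oplus> euler w y"
    using xy by (intro coord_eqI) (auto simp: euler_closed coord_euler coord_add algebra_simps)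
  show "euler w (x \<otimes> y) = euler w x \<otimes> y \<oplus> x \<otimes> euler w y"
    using xy
    by (intro coord_eqI)
      (auto simp: euler_closed coord_euler coord_add coord_mult sum_distrib_left w
        sum.distrib[symmetric] algebra_simps intro!: sum.cong)
next
  fix t x assume x: "x \<in> carrier A"
  show "euler w (t \<odot> x) = t \<odot> euler w x"
    using x by (intro coord_eqI) (auto simp: euler_closed coord_euler coord_smult)
qed

text \<open>\<open>the_elem\<close> is meaningful only on a singleton, so two things are needed: the
  class is nonempty (it contains \<open>d\<close>, the difference being the inner derivation of
  zero), and its members agree at a central \<open>z\<close>.\<close>

lemma HH1_act_class:
  assumes d: "d \<in> derivations A" and z: "z \<in> HH0 A"
    and c: "c = {(d, d'). d \<in> derivations A \<and> d' \<in> derivations A \<and>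
        (\<lambda>x \<in> carrier A. d x \<ominus> d' x) \<in> inner_derivations A} `` {d}"
  shows "HH1_act c z = d z"
proof -
  have "d' z = d z" if "d' \<in> c" for d'
  proof -
    have d': "d' \<in> derivations A" and "(\<lambda>x \<in> carrier A. d x \<ominus> d' x) \<in> inner_derivations A"
      using that c by auto
    then obtain a where a: "a \<in> carrier A"
      and eq: "(\<lambda>x \<in> carrier A. d x \<ominus> d' x) = (\<lambda>x \<in> carrier A. a \<otimes> x \<ominus> x \<otimes> a)"
      unfolding inner_derivations_def by auto
    have "d z \<ominus> d' z = a \<otimes> z \<ominus> z \<otimes> a"
      using fun_cong[OF eq, of z] HH0_closed[OF z] by simp
    also have "\<dots> = \<zero>"
      using HH0_commute[OF z a] HH0_closed[OF z] a by (simp add: a_minus_def r_neg)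
    finally show ?thesis
      using derivation_closed[OF d] derivation_closed[OF d'] HH0_closed[OF z] by simp
  qed
  moreover have "d \<in> c"
  proof -
    have "(\<lambda>x \<in> carrier A. d x \<ominus> d x) = (\<lambda>x \<in> carrier A. \<zero> \<otimes> x \<ominus> x \<otimes> \<zero>)"
      using derivation_closed[OF d] by (auto simp: a_minus_def r_neg restrict_def)
    then have "(\<lambda>x \<in> carrier A. d x \<ominus> d x) \<in> inner_derivations A"
      unfolding inner_derivations_def by blast
    then show ?thesis
      using d c by simp
  qed
  ultimately have "(\<lambda>d. d z) ` c = {d z}"
    by blast
  then show ?thesis
    by (simp add: HH1_act_def)
qed

text \<open>Removes the classes modulo inner derivations: from here on stability is tested against
  derivations themselves.\<close>

lemma HH1_submodule_iff:
  "HH1_submodule A U \<longleftrightarrow>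
     is_subspace A U \<and> U \<subseteq> HH0 A \<and> (\<forall>d\<in>derivations A. \<forall>z\<in>U. d z \<in> U)"
proof -
  have "(\<forall>c \<in> HH1 A. \<forall>z \<in> U. HH1_act c z \<in> U) \<longleftrightarrow> (\<forall>d\<in>derivations A. \<forall>z\<in>U. d z \<in> U)"
    if "U \<subseteq> HH0 A"
    using that HH1_act_class unfolding HH1_def quotient_def by (auto simp: subset_iff)
  then show ?thesis
    by (auto simp: HH1_submodule_def)
qed

section \<open>Internal direct sums and indecomposability\<close>

lemma is_direct_sum_pair:
  assumes "is_direct_sum A U [V, W]" "V \<subseteq> carrier A" "W \<subseteq> carrier A"
  shows is_direct_sum_pair_decompose: "x \<in> U \<Longrightarrow> \<exists>v\<in>V. \<exists>w\<in>W. x = v \<oplus> w"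
    and is_direct_sum_pair_unique:
      "\<lbrakk>v \<in> V; w \<in> W; v' \<in> V; w' \<in> W; v \<oplus> w = v' \<oplus> w'\<rbrakk> \<Longrightarrow> v = v' \<and> w = w'"
    and is_direct_sum_pair_closed: "v \<in> V \<Longrightarrow> w \<in> W \<Longrightarrow> v \<oplus> w \<in> U"
proof -
  let ?f = "\<lambda>us. foldr (\<lambda>u v. u \<oplus> v) us \<zero>"
  have L: "listset [V, W] = {[v, w] | v w. v \<in> V \<and> w \<in> W}"
    by (auto simp: set_Cons_def)
  have bij: "bij_betw ?f (listset [V, W]) U"
    using assms(1) by (simp only: is_direct_sum_def)
  have f: "?f [v, w] = v \<oplus> w" if "w \<in> W" for v w
    using that assms(3) by auto
  have img: "?f ` listset [V, W] = U" and inj: "inj_on ?f (listset [V, W])"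
    using bij by (auto simp only: bij_betw_def)
  show "\<exists>v\<in>V. \<exists>w\<in>W. x = v \<oplus> w" if "x \<in> U"
  proof -
    have "x \<in> ?f ` listset [V, W]"
      using that img by simp
    then show ?thesis
      unfolding L using f by (auto simp del: foldr.simps)
  qed
  show "v = v' \<and> w = w'" if "v \<in> V" "w \<in> W" "v' \<in> V" "w' \<in> W" "v \<oplus> w = v' \<oplus> w'"
    using inj_onD[OF inj, of "[v, w]" "[v', w']"] that f unfolding L by (auto simp del: foldr.simps)
  show "v \<oplus> w \<in> U" if "v \<in> V" "w \<in> W"
  proof -
    have "?f [v, w] \<in> ?f ` listset [V, W]"
      using that L by blast
    then show ?thesis
      using img f that by metis
  qed
qed

text \<open>Allows the two summands to exchange roles, so that each later argument is carried out
  for one of them only.\<close>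

lemma is_direct_sum_commute:
  assumes "is_direct_sum A U [V, W]" "V \<subseteq> carrier A" "W \<subseteq> carrier A"
  shows "is_direct_sum A U [W, V]"
proof -
  have L: "listset [W, V] = {[w, v] | v w. v \<in> V \<and> w \<in> W}"
    by (auto simp: set_Cons_def)
  note D = is_direct_sum_pair[OF assms]
  have f: "foldr (\<lambda>u v. u \<oplus> v) [w, v] \<zero> = v \<oplus> w" if "w \<in> W" "v \<in> V" for v w
    using that assms(2,3) a_comm[of w v] by (auto simp: subset_iff)
  show ?thesis
    unfolding is_direct_sum_def bij_betw_def
  proof
    show "inj_on (\<lambda>us. foldr (\<lambda>u v. u \<oplus> v) us \<zero>) (listset [W, V])"
      unfolding L using f D(2) by (auto simp: inj_on_def simp del: foldr.simps)
    have "(\<lambda>us. foldr (\<lambda>u v. u \<oplus> v) us \<zero>) ` (listset [W, V]) = {v \<oplus> w | v w. v \<in> V \<and> w \<in> W}"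
      unfolding L using f by (force simp del: foldr.simps simp: image_iff)
    also have "\<dots> = U"
      using D(1,3) by fastforce
    finally show "(\<lambda>us. foldr (\<lambda>u v. u \<oplus> v) us \<zero>) ` (listset [W, V]) = U" .
  qed
qed

text \<open>A line has no proper nonzero subspace: a nonzero vector of \<open>V\<close> rescales to
  \<open>x\<close>, so \<open>V\<close> is everything and \<open>W\<close> meets it only in
  zero.\<close>

lemma HH1_indecomposable_singleton:
  assumes x: "x \<in> carrier A" "x \<noteq> \<zero>" and sub: "HH1_submodule A (linear_span A {x})"
  shows "HH1_indecomposable A (linear_span A {x})"
  unfolding HH1_indecomposable_def
proof (intro conjI allI impI)
  let ?U = "linear_span A {x}"
  show "?U \<noteq> {\<zero>}"
    using linear_span_superset[of "{x}"] x by auto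
  fix V W assume VW: "HH1_submodule A V \<and> HH1_submodule A W \<and> is_direct_sum A ?U [V, W]"
  then have V: "is_subspace A V" and W: "is_subspace A W" and D: "is_direct_sum A ?U [V, W]"
    by (auto simp: HH1_submodule_iff)
  note V' = subspaceD[OF V] and W' = subspaceD[OF W]
  note D' = is_direct_sum_pair[OF D V'(1) W'(1)]
  show "V = {\<zero>} \<or> W = {\<zero>}"
  proof (cases "V = {\<zero>}")
    case False
    then obtain v where v: "v \<in> V" "v \<noteq> \<zero>"
      using V'(2) by blast
    have "v \<in> ?U"
      using D'(3)[OF v(1) W'(2)] subsetD[OF V'(1) v(1)] by simp
    then obtain t where t: "v = t \<odot> x"
      using x by (auto simp: linear_span_singleton)
    then have "t \<noteq> 0"
      using v x by auto
    then have "(1 / t) \<odot> v = x"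
      using t x by (simp add: smult_smult)
    then have "x \<in> V"
      using V'(4)[OF v(1), of "1 / t"] by simp
    then have "?U \<subseteq> V"
      using V by (intro linear_span_minimal) auto
    have "w = \<zero>" if "w \<in> W" for w
    proof -
      have w: "w \<in> carrier A"
        using that W'(1) by blast
      have "w \<in> ?U"
        using D'(3)[OF V'(2) that] w by simp
      then have "w \<in> V"
        using \<open>?U \<subseteq> V\<close> by blast
      \<comment> \<open>Since \<open>w\<close> lies in both summands it has two decompositions, one
        with each component zero; uniqueness identifies them.\<close>
      have "w \<oplus> \<zero> = \<zero> \<oplus> w"
        using w by simp
      then show ?thesis
        using D'(2)[OF \<open>w \<in> V\<close> W'(2) V'(2) that] by blast
    qed
    then show ?thesis
      using W'(2) by blast
  qed simp
qed (rule sub)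

end


section \<open>The basis of alternating paths\<close>

text \<open>
  The triple \<open>(u, d, l)\<close> stands for the alternating path of length \<open>l\<close> which starts at \<open>u\<close> with a
  forward arrow if \<open>d\<close> and with a backward arrow otherwise. For \<open>l = 0\<close> and \<open>l = 2N\<close> both values of
  \<open>d\<close> give the same element of \<open>A\<close>, and \<open>zz_canon\<close> chooses \<open>d = True\<close>.
\<close>

definition zz_end :: "nat \<Rightarrow> int \<times> bool \<times> nat \<Rightarrow> int" where
  "zz_end m = (\<lambda>(u, d, l). if even l then u else if d then (u + 1) mod int m else (u - 1) mod int m)"

definition zz_canon :: "nat \<Rightarrow> int \<times> bool \<times> nat \<Rightarrow> int \<times> bool \<times> nat" where
  "zz_canon N = (\<lambda>(u, d, l). (u, d \<or> l = 0 \<or> l = 2 * N, l))"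

definition zz_basis :: "nat \<Rightarrow> nat \<Rightarrow> (int \<times> bool \<times> nat) set" where
  "zz_basis N m = {(u, d, l). 0 \<le> u \<and> u < int m \<and> l \<le> 2 * N \<and> (l = 0 \<or> l = 2 * N \<longrightarrow> d)}"

text \<open>The last arrow of \<open>(u, d, l)\<close> is forward iff \<open>d = odd l\<close>, so
  the next one must be forward iff \<open>d = even l\<close>; this is the condition on
  \<open>e\<close>. Words of length 0 act as local units and impose only the matching of vertices. A
  word of length \<open>2 * N\<close> times a word of positive length is too long, so its
  conventional direction never influences a product.\<close>

definition zz_mult ::
    "nat \<Rightarrow> nat \<Rightarrow> int \<times> bool \<times> nat \<Rightarrow> int \<times> bool \<times> nat \<Rightarrow> (int \<times> bool \<times> nat) option" where
  "zz_mult N m = (\<lambda>(u, d, l) (v, e, k).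
     if v = zz_end m (u, d, l) \<and> (l = 0 \<or> k = 0 \<or> l + k \<le> 2 * N \<and> e = (d = even l))
     then Some (zz_canon N (u, if l = 0 then e else d, l + k)) else None)"

lemma zz_canon_simp [simp]: "zz_canon N (u, d, l) = (u, d \<or> l = 0 \<or> l = 2 * N, l)"
  by (simp add: zz_canon_def)

lemma zz_basis_iff [simp]:
  "(u, d, l) \<in> zz_basis N m \<longleftrightarrow> 0 \<le> u \<and> u < int m \<and> l \<le> 2 * N \<and> (l = 0 \<or> l = 2 * N \<longrightarrow> d)"
  by (simp add: zz_basis_def)

lemma zz_mult_Some_iff:
  "zz_mult N m (u, d, l) (v, e, k) = Some (w, g, n) \<longleftrightarrow>
     v = zz_end m (u, d, l) \<and> (l = 0 \<or> k = 0 \<or> l + k \<le> 2 * N \<and> e = (d = even l)) \<and>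
     w = u \<and> n = l + k \<and> g = ((if l = 0 then e else d) \<or> n = 0 \<or> n = 2 * N)"
  unfolding zz_mult_def by auto

lemma finite_zz_basis: "finite (zz_basis N m)"
proof (rule finite_subset)
  show "zz_basis N m \<subseteq> {0..<int m} \<times> UNIV \<times> {..2 * N}"
    by (auto simp: zz_basis_def)
qed simp

definition alt_sign :: "int \<Rightarrow> 'a::comm_ring_1" where
  "alt_sign u = (if even u then 1 else -1)"

lemma alt_sign_square [simp]: "alt_sign u * alt_sign u = (1::'a::comm_ring_1)"
  by (simp add: alt_sign_def)

text \<open>Everything the representation-theoretic part uses about \<open>A\<close>; the concrete
  quotient is shown to be an instance in \<open>algA_zigzag\<close>. The unit is the sum of the
  vertices, whence \<open>coord_one\<close>.\<close>

locale zigzag = multiplicative_basis A "zz_basis N m" "zz_mult N m" coord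
  for A :: "('k::field, 'b) module" (structure) and N m :: nat
    and coord :: "'b \<Rightarrow> int \<times> bool \<times> nat \<Rightarrow> 'k" +
  assumes N: "N \<ge> 1" and m: "m \<ge> 3" and even_m: "even m" and two: "(2::'k) \<noteq> 0"
    and coord_one: "coord \<one> (u, d, l) = (if 0 \<le> u \<and> u < int m \<and> d \<and> l = 0 then 1 else 0)"
begin

abbreviation B where "B \<equiv> zz_basis N m"
abbreviation Vt where "Vt \<equiv> {0..<int m}"
definition nx where "nx u = (u + 1) mod int m"
definition pv where "pv u = (u - 1) mod int m"

lemma nx_cases: "u \<in> Vt \<Longrightarrow> nx u = (if u = int m - 1 then 0 else u + 1)"
  unfolding nx_def by auto

lemma pv_cases: "u \<in> Vt \<Longrightarrow> pv u = (if u = 0 then int m - 1 else u - 1)"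
  unfolding pv_def by (auto simp: zmod_minus1)

lemma vt_simps [simp]:
  assumes "u \<in> Vt"
  shows "nx u \<in> Vt" "pv u \<in> Vt" "nx (pv u) = u" "pv (nx u) = u" "nx u \<noteq> u" "pv u \<noteq> u" "u \<noteq> nx u"
    "u \<noteq> pv u" "0 \<le> nx u" "nx u < int m" "0 \<le> pv u" "pv u < int m"
proof -
  show nx: "nx u \<in> Vt" and pv: "pv u \<in> Vt"
    using assms m by (auto simp: nx_def pv_def)
  then show "0 \<le> nx u" "nx u < int m" "0 \<le> pv u" "pv u < int m"
    by auto
  show "nx (pv u) = u" "pv (nx u) = u"
    using nx pv assms by (auto simp: nx_cases pv_cases split: if_splits)
  show "nx u \<noteq> u" "pv u \<noteq> u" "u \<noteq> nx u" "u \<noteq> pv u"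
    using assms m by (auto simp: nx_cases pv_cases split: if_splits)
qed

lemma nx_eq_iff: "u \<in> Vt \<Longrightarrow> w \<in> Vt \<Longrightarrow> nx u = w \<longleftrightarrow> u = pv w"
  using vt_simps(3,4) by metis

lemma zz_end_simp: "zz_end m (u, d, l) = (if even l then u else if d then nx u else pv u)"
  by (simp add: zz_end_def nx_def pv_def)

text \<open>The step from vertex 0 back to \<open>int m - 1\<close> is where the parity of
  \<open>m\<close> is used: signs alternate consistently around the cycle.\<close>

lemma alt_sign_pv: "u \<in> Vt \<Longrightarrow> alt_sign (pv u) = - alt_sign u"
  using even_m by (auto simp: alt_sign_def pv_cases)

lemma alt_sign_nx: "u \<in> Vt \<Longrightarrow> alt_sign (nx u) = - alt_sign u"
  using even_m by (auto simp: alt_sign_def nx_cases)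

lemma vt_induct:
  assumes u: "u \<in> Vt" and "R 0" and "\<And>u. u \<in> Vt \<Longrightarrow> R u \<Longrightarrow> R (nx u)"
  shows "R u"
proof -
  have "int k < int m \<Longrightarrow> R (int k)" for k
  proof (induction k)
    case (Suc k)
    then show ?case
      using assms(3)[of "int k"] nx_cases[of "int k"] by (auto simp: add.commute)
  qed (use assms in simp)
  from this[of "nat u"] show ?thesis
    using u by simp
qed

section \<open>Coordinates of products and of central elements\<close>

text \<open>When at most one word \<open>c\<close> gives \<open>c q = b\<close>, the sum in
  \<open>coord_mult_bas\<close> collapses to one term. The flag \<open>Q\<close> says whether such a
  word exists; if not, \<open>c0\<close> is a dummy.\<close>

lemma coord_mult_bas_unique:
  assumes "x \<in> carrier A" "q \<in> B" "c0 \<in> B" "\<And>c. c \<in> B \<Longrightarrow> zz_mult N m c q = Some b \<longleftrightarrow> Q \<and> c = c0"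
  shows "coord (x \<otimes> bas q) b = (if Q then coord x c0 else 0)"
proof -
  have "coord (x \<otimes> bas q) b = (\<Sum>a\<in>B. if a = c0 then (if Q then coord x c0 else 0) else 0)"
    unfolding coord_mult_bas[OF assms(1,2)] using assms(4) by (intro sum.cong) auto
  then show ?thesis
    using assms(3) finite_zz_basis by simp
qed

lemma coord_bas_mult_unique:
  assumes "x \<in> carrier A" "q \<in> B" "c0 \<in> B" "\<And>c. c \<in> B \<Longrightarrow> zz_mult N m q c = Some b \<longleftrightarrow> Q \<and> c = c0"
  shows "coord (bas q \<otimes> x) b = (if Q then coord x c0 else 0)"
proof -
  have "coord (bas q \<otimes> x) b = (\<Sum>a\<in>B. if a = c0 then (if Q then coord x c0 else 0) else 0)"
    unfolding coord_bas_mult[OF assms(1,2)] using assms(4) by (intro sum.cong) auto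
  then show ?thesis
    using assms(3) finite_zz_basis by simp
qed

text \<open>A word of odd length ends at a neighbour of its start, and neighbours differ since
  \<open>m \<ge> 3\<close>. So the vertex \<open>u\<close> preserves the word from the left and
  kills it from the right.\<close>

lemma HH0_coord_odd:
  assumes z: "z \<in> HH0 A" and "odd l"
  shows "coord z (u, d, l) = 0"
proof (cases "(u, d, l) \<in> B")
  case True
  then have u: "u \<in> Vt"
    by simp
  have e: "(u, True, 0) \<in> B"
    using u by simp
  have "coord (z \<otimes> bas (u, True, 0)) (u, d, l) = (if False then coord z (u, d, l) else 0)"
    by (rule coord_mult_bas_unique[OF HH0_closed[OF z] e True])
      (use u assms(2) in \<open>auto simp: zz_mult_Some_iff zz_end_simp\<close>)
  moreover have "coord (bas (u, True, 0) \<otimes> z) (u, d, l) = (if True then coord z (u, d, l) else 0)"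
    by (rule coord_bas_mult_unique[OF HH0_closed[OF z] e True])
      (use True assms(2) in \<open>auto simp: zz_mult_Some_iff zz_end_simp\<close>)
  ultimately show ?thesis
    using HH0_commute[OF z bas_closed[OF e]] by simp
qed (use coord_outside HH0_closed z in blast)

text \<open>Compare the coefficient of the word of length \<open>2 * s + 1\<close> starting with
  \<open>a_u\<close> in \<open>z a_u\<close> and in \<open>a_u z\<close>. The direction
  \<open>s = 0\<close> is the canonical one: backward for \<open>s > 0\<close>, and
  \<open>True\<close> for the trivial path.\<close>

lemma HH0_coord_even:
  assumes z: "z \<in> HH0 A" and u: "u \<in> Vt" and s: "s < N"
  shows "coord z (nx u, s = 0, 2 * s) = coord z (u, True, 2 * s)"
proof -
  have e: "(u, True, 1) \<in> B" "(u, True, 2 * s) \<in> B" "(nx u, s = 0, 2 * s) \<in> B"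
    using u s by auto
  have "coord (z \<otimes> bas (u, True, 1)) (u, True, 2 * s + 1) = (if True then coord z (u, True, 2 * s) else 0)"
    by (rule coord_mult_bas_unique[OF HH0_closed[OF z] e(1,2)])
      (use u s in \<open>auto simp: zz_mult_Some_iff zz_end_simp\<close>)
  moreover have "coord (bas (u, True, 1) \<otimes> z) (u, True, 2 * s + 1) = (if True then coord z (nx u, s = 0, 2 * s) else 0)"
    by (rule coord_bas_mult_unique[OF HH0_closed[OF z] e(1,3)])
      (use u s in \<open>auto simp: zz_mult_Some_iff zz_end_simp\<close>)
  ultimately show ?thesis
    using HH0_commute[OF z bas_closed[OF e(1)]] by simp
qed

lemma HH0_coord_vertex:
  assumes z: "z \<in> HH0 A" and u: "u \<in> Vt"
  shows "coord z (u, True, 0) = coord z (0, True, 0)"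
  by (rule vt_induct[OF u]) (use HH0_coord_even[OF z, of _ 0] N in auto)

lemma HH0_coord_False:
  assumes z: "z \<in> HH0 A" and u: "u \<in> Vt" and s: "0 < s" "s < N"
  shows "coord z (u, False, 2 * s) = coord z (pv u, True, 2 * s)"
  using HH0_coord_even[OF z, of "pv u" s] u s by simp

section \<open>The central elements \<open>f_i\<close> and \<open>eps_i\<close>\<close>

text \<open>For \<open>N = 1\<close> the words of length 2 already have the maximal length
  \<open>2 * N\<close>, which is why \<open>zz_canon\<close> has to be applied.\<close>

definition fel :: "int \<Rightarrow> 'b" where
  "fel i = bas (zz_canon N (i, True, 2)) \<oplus> bas (zz_canon N (nx i, False, 2))"

definition epsel :: "int \<Rightarrow> 'b" where
  "epsel i = bas (i, True, 2 * N)"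

lemma zz_canon_basis: "i \<in> Vt \<Longrightarrow> l \<le> 2 * N \<Longrightarrow> zz_canon N (i, d, l) \<in> B"
  by auto

lemma fel_closed [simp]: "i \<in> Vt \<Longrightarrow> fel i \<in> carrier A"
  using N unfolding fel_def by (intro a_closed bas_closed zz_canon_basis) auto

lemma epsel_closed [simp]: "i \<in> Vt \<Longrightarrow> epsel i \<in> carrier A"
  unfolding epsel_def by (intro bas_closed) auto

lemma bas_mult_Some: "b \<in> B \<Longrightarrow> c \<in> B \<Longrightarrow> zz_mult N m b c = Some d \<Longrightarrow> bas b \<otimes> bas c = bas d"
  by (simp add: bas_mult)

lemma bas_mult_None: "b \<in> B \<Longrightarrow> c \<in> B \<Longrightarrow> zz_mult N m b c = None \<Longrightarrow> bas b \<otimes> bas c = \<zero>"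
  by (simp add: bas_mult)

text \<open>An alternating word of length strictly between 0 and \<open>2 * N\<close> runs back and
  forth along one pair \<open>a_j\<close>, \<open>abar_j\<close>. Multiplication by
  \<open>f_i\<close> from either side lengthens it by two if \<open>j = i\<close> and the result is
  not too long, and otherwise kills it. A vertex picks out the part of \<open>f_i\<close> at that
  vertex, again from either side.\<close>

lemma fel_HH0: 
  assumes i: "i \<in> Vt"
  shows "fel i \<in> HH0 A"
proof (rule HH0I)
  fix b assume b: "b \<in> B"
  obtain u d l where bu: "b = (u, d, l)"
    by (cases b)
  let ?P = "zz_canon N (i, True, 2)" and ?Q = "zz_canon N (nx i, False, 2)"
  have P: "?P \<in> B" "?Q \<in> B"
    using N i by auto
  have u: "u \<in> Vt" "d \<or> 0 < l \<and> l < 2 * N"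
    using b bu by auto
  have nx: "nx u = nx i \<longleftrightarrow> u = i" "pv u = i \<longleftrightarrow> u = nx i"
      "nx i = nx u \<longleftrightarrow> u = i" "i = pv u \<longleftrightarrow> u = nx i"
    using u i vt_simps(3,4) by metis+
  have eqs:
    "zz_mult N m ?P b = (if u = i \<and> (l = 0 \<or> d \<and> l + 2 \<le> 2 * N) then Some (zz_canon N (i, True, l + 2)) else None)"
    "zz_mult N m ?Q b = (if u = nx i \<and> (l = 0 \<or> \<not> d \<and> l + 2 \<le> 2 * N) then Some (zz_canon N (nx i, False, l + 2)) else None)"
    "zz_mult N m b ?P = (if l = 0 \<and> u = i \<or> l \<noteq> 0 \<and> l + 2 \<le> 2 * N \<and> d = even l \<and> u = (if d then i else nx i)
       then Some (zz_canon N (u, d, l + 2)) else None)"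
    "zz_mult N m b ?Q = (if l = 0 \<and> u = nx i \<or> l \<noteq> 0 \<and> l + 2 \<le> 2 * N \<and> d \<noteq> even l \<and> u = (if d then i else nx i)
       then Some (zz_canon N (u, d \<and> l \<noteq> 0, l + 2)) else None)"
    using u(2) N unfolding bu zz_mult_def zz_canon_simp prod.case zz_end_simp
    apply -
    subgoal by (cases "l = 0"; cases d; cases "even l"; simp add: nx; linarith?)
    subgoal by (cases "l = 0"; cases d; cases "even l"; simp add: nx; linarith?)
    subgoal by (cases "l = 0"; cases d; cases "even l"; simp add: nx; linarith?)
    subgoal by (cases "l = 0"; cases d; cases "even l"; simp add: nx; linarith?)
    done
  have C: "(case zz_mult N m x y of None \<Rightarrow> \<zero> | Some c \<Rightarrow> bas c) \<in> carrier A" if "x \<in> B" "y \<in> B" for x y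
    using that by (simp flip: bas_mult)
  have i': "nx i \<noteq> i"
    using i by simp
  let ?o = "\<lambda>o'. case o' of None \<Rightarrow> \<zero> | Some c \<Rightarrow> bas c"
  have "?o (zz_mult N m ?P b) \<oplus> ?o (zz_mult N m ?Q b) = ?o (zz_mult N m b ?P) \<oplus> ?o (zz_mult N m b ?Q)"
  proof (cases "l = 0")
    case True
    then have d
      using u(2) by simp
    then show ?thesis
      using True i' C[OF P(1) b] C[OF P(2) b] unfolding eqs
      by (cases "u = i"; cases "u = nx i") (simp_all del: zz_canon_simp)
  next
    case False
    \<comment> \<open>The first two cases are words along the pair of index \<open>i\<close> that
      can still be lengthened; in the last two, a word that is too long or belongs to another pair,
      all four products vanish.\<close>
    consider "u = i" "d" "l + 2 \<le> 2 * N" | "u = nx i" "\<not> d" "l + 2 \<le> 2 * N" | "\<not> l + 2 \<le> 2 * N"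
      | "u \<noteq> (if d then i else nx i)"
      by (cases d) auto
    then show ?thesis
    proof cases
      case 1
      then show ?thesis
        using i' False C[OF P(1) b] unfolding eqs by (cases "even l") (simp_all del: zz_canon_simp)
    next
      case 2
      then show ?thesis
        using i' False C[OF P(2) b] unfolding eqs by (cases "even l") (simp_all del: zz_canon_simp)
    next
      case 3
      then show ?thesis
        unfolding eqs using False by simp
    next
      case 4
      then show ?thesis
        unfolding eqs using False by (cases d) simp_all
    qed
  qed
  then show "fel i \<otimes> bas b = bas b \<otimes> fel i"
    unfolding fel_def l_distr[OF P[THEN bas_closed] bas_closed[OF b]] r_distr[OF P[THEN bas_closed] bas_closed[OF b]]
      bas_mult[OF P(1) b] bas_mult[OF P(2) b] bas_mult[OF b P(1)] bas_mult[OF b P(2)] .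
qed (use i in simp)

text \<open>A word of maximal length survives only multiplication by its own vertex, from both
  sides.\<close>

lemma epsel_HH0: 
  assumes i: "i \<in> Vt"
  shows "epsel i \<in> HH0 A"
proof (rule HH0I)
  fix b assume b: "b \<in> B"
  obtain u d l where bu: "b = (u, d, l)"
    by (cases b)
  have P: "(i, True, 2 * N) \<in> B"
    using i by auto
  show "epsel i \<otimes> bas b = bas b \<otimes> epsel i"
    unfolding epsel_def bas_mult[OF P b] bas_mult[OF b P]
    using b i N by (auto simp: bu zz_mult_def zz_end_simp split: option.split)
qed (use i in simp)

text \<open>The two words in \<open>f_i\<close> start at different vertices and are closed, so the
  mixed products vanish and each word is raised to its own power. At \<open>s = N\<close>
  canonicalisation makes both of them words of the form \<open>epsel\<close>.\<close>

lemma fel_pow: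
  assumes i: "i \<in> Vt" and "1 \<le> s" "s \<le> N"
  shows "fel i [^] s = bas (zz_canon N (i, True, 2 * s)) \<oplus> bas (zz_canon N (nx i, False, 2 * s))"
  using assms(2,3)
proof (induction s rule: nat_induct_at_least)
  case base
  then show ?case
    using i by (simp add: fel_def)
next
  case (Suc s)
  have B: "zz_canon N (i, True, 2 * s) \<in> B" "zz_canon N (nx i, False, 2 * s) \<in> B"
    "zz_canon N (i, True, 2) \<in> B" "zz_canon N (nx i, False, 2) \<in> B"
    "zz_canon N (i, True, 2 * Suc s) \<in> B" "zz_canon N (nx i, False, 2 * Suc s) \<in> B"
    using Suc i by auto
  note [simp] = B[THEN bas_closed]
  have 1: "bas (zz_canon N (i, True, 2 * s)) \<otimes> bas (zz_canon N (i, True, 2)) = bas (zz_canon N (i, True, 2 * Suc s))"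
    "bas (zz_canon N (nx i, False, 2 * s)) \<otimes> bas (zz_canon N (nx i, False, 2)) = bas (zz_canon N (nx i, False, 2 * Suc s))"
    using B Suc.prems Suc.hyps by (auto intro!: bas_mult_Some simp: zz_mult_def zz_end_simp)
  have 2: "bas (zz_canon N (i, True, 2 * s)) \<otimes> bas (zz_canon N (nx i, False, 2)) = \<zero>"
    "bas (zz_canon N (nx i, False, 2 * s)) \<otimes> bas (zz_canon N (i, True, 2)) = \<zero>"
    using B i Suc.prems Suc.hyps by (auto intro!: bas_mult_None simp: zz_mult_def zz_end_simp)
  have "fel i [^] Suc s = (bas (zz_canon N (i, True, 2 * s)) \<oplus> bas (zz_canon N (nx i, False, 2 * s))) \<otimes> fel i"
    using Suc by simp
  also have "\<dots> = bas (zz_canon N (i, True, 2 * Suc s)) \<oplus> bas (zz_canon N (nx i, False, 2 * Suc s))"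
    unfolding fel_def using B[THEN bas_closed] by (simp add: l_distr r_distr 1 2 del: zz_canon_simp)
  finally show ?case .
qed

lemma fel_pow_N: "i \<in> Vt \<Longrightarrow> fel i [^] N = epsel i \<oplus> epsel (nx i)"
  using fel_pow[of i N] N by (simp add: epsel_def)

text \<open>Both indicators are tests of the pair \<open>(i, s)\<close> against a fixed pair, the
  form in which a sum over all \<open>i\<close> and \<open>s\<close> is evaluated by
  \<open>sum.delta\<close>. They cannot hold together because
  \<open>pv u \<noteq> u\<close>.\<close>

lemma coord_fel_pow:
  assumes "i \<in> Vt" "1 \<le> s" "s \<le> N"
  shows "coord (fel i [^] s) (u, d, l)
    = (if (i, s) = (u, l div 2) \<and> even l \<and> (d \<or> l = 0) \<and> u \<in> Vt then 1 else 0)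
    + (if (i, s) = (pv u, l div 2) \<and> even l \<and> u \<in> Vt \<and> d = (l = 2 * N) then 1 else 0)"
proof -
  have B: "zz_canon N (i, True, 2 * s) \<in> B" "zz_canon N (nx i, False, 2 * s) \<in> B"
    using assms by auto
  have "nx i = u \<longleftrightarrow> i = pv u \<and> u \<in> Vt"
    using assms(1) vt_simps(1)[OF assms(1)] nx_eq_iff[of i u] by auto
  then show ?thesis
    unfolding fel_pow[OF assms] coord_add[OF B[THEN bas_closed]] coord_bas[OF B(1)] coord_bas[OF B(2)]
    using assms by auto
qed

text \<open>Words along different pairs may meet at a vertex, but then the second one starts in the
  direction in which the first one ended, which is a relation.\<close>

lemma fel_mult_fel:
  assumes "i \<in> Vt" "j \<in> Vt" "i \<noteq> j"
  shows "fel i \<otimes> fel j = \<zero>"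
proof -
  have B: "zz_canon N (i, True, 2) \<in> B" "zz_canon N (nx i, False, 2) \<in> B"
    "zz_canon N (j, True, 2) \<in> B" "zz_canon N (nx j, False, 2) \<in> B"
    using assms N by auto
  have "nx i \<noteq> nx j"
    using assms vt_simps(4) by metis
  then have 2: "bas (zz_canon N (i, True, 2)) \<otimes> bas (zz_canon N (j, True, 2)) = \<zero>"
    "bas (zz_canon N (i, True, 2)) \<otimes> bas (zz_canon N (nx j, False, 2)) = \<zero>"
    "bas (zz_canon N (nx i, False, 2)) \<otimes> bas (zz_canon N (j, True, 2)) = \<zero>"
    "bas (zz_canon N (nx i, False, 2)) \<otimes> bas (zz_canon N (nx j, False, 2)) = \<zero>"
    using B assms by (auto intro!: bas_mult_None simp: zz_mult_def zz_end_simp)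
  show ?thesis
    unfolding fel_def using B[THEN bas_closed] by (simp add: l_distr r_distr 2 del: zz_canon_simp)
qed

lemma fel_pow_zero:
  assumes i: "i \<in> Vt" and "s > N"
  shows "fel i [^] s = \<zero>"
proof -
  have B: "zz_canon N (i, True, 2) \<in> B" "zz_canon N (nx i, False, 2) \<in> B"
    "(i, True, 2 * N) \<in> B" "(nx i, True, 2 * N) \<in> B"
    using i N by auto
  have 2: "bas (i, True, 2 * N) \<otimes> bas (zz_canon N (i, True, 2)) = \<zero>"
    "bas (i, True, 2 * N) \<otimes> bas (zz_canon N (nx i, False, 2)) = \<zero>"
    "bas (nx i, True, 2 * N) \<otimes> bas (zz_canon N (i, True, 2)) = \<zero>"
    "bas (nx i, True, 2 * N) \<otimes> bas (zz_canon N (nx i, False, 2)) = \<zero>"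
    using B N by (auto intro!: bas_mult_None simp: zz_mult_def zz_end_simp)
  have "(epsel i \<oplus> epsel (nx i)) \<otimes> fel i = \<zero>"
    unfolding epsel_def fel_def
    using B[THEN bas_closed] by (simp add: l_distr r_distr 2 del: zz_canon_simp)
  then have "fel i [^] (Suc N) = \<zero>"
    using fel_pow_N[OF i] by simp
  moreover have "fel i [^] s = fel i [^] (Suc N) \<otimes> fel i [^] (s - Suc N)"
    using assms by (subst nat_pow_mult) auto
  ultimately show ?thesis
    using i by simp
qed

lemma fel_pow_mult_fel_pow:
  fixes s t :: nat
  assumes "i \<in> Vt" "j \<in> Vt" "i \<noteq> j" "1 \<le> s" "1 \<le> t"
  shows "fel i [^] s \<otimes> fel j [^] t = \<zero>"
proof -
  obtain s' t' where st: "s = Suc s'" "t = Suc t'"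
    using assms(4,5) by (metis Suc_le_D One_nat_def)
  have "fel j [^] Suc t' = fel j \<otimes> fel j [^] t'"
    by (rule nat_pow_Suc2[OF fel_closed[OF assms(2)]])
  then have "fel i [^] s \<otimes> fel j [^] t = fel i [^] s' \<otimes> (fel i \<otimes> fel j) \<otimes> fel j [^] t'"
    using assms st by (simp add: m_assoc)
  then show ?thesis
    using assms by (simp add: fel_mult_fel)
qed

text \<open>\<open>eps\<close> is defined as a power of \<open>a_i abar_i\<close>, the forward half
  of \<open>f_i\<close>; with \<open>s = N\<close> this identifies it with
  \<open>epsel\<close>.\<close>

lemma bas_loop_pow:
  assumes i: "i \<in> Vt" and "1 \<le> s" "s \<le> N"
  shows "bas (zz_canon N (i, True, 2)) [^] s = bas (zz_canon N (i, True, 2 * s))"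
  using assms(2,3)
proof (induction s rule: nat_induct_at_least)
  case base
  have "zz_canon N (i, True, 2) \<in> B"
    using i N by auto
  then show ?case
    by simp
next
  case (Suc s)
  have "zz_canon N (i, True, 2 * s) \<in> B" "zz_canon N (i, True, 2) \<in> B"
    using Suc i by auto
  then have "bas (zz_canon N (i, True, 2 * s)) \<otimes> bas (zz_canon N (i, True, 2)) = bas (zz_canon N (i, True, 2 * Suc s))"
    using Suc by (intro bas_mult_Some) (auto simp: zz_mult_def zz_end_simp)
  then show ?case
    using Suc by simp
qed

section \<open>The filtration by powers and the alternating functional\<close>

text \<open>\<open>fspan 1\<close> is the third summand, and the filtration reaches zero at
  \<open>fspan (Suc N)\<close>.\<close>

definition fspan :: "nat \<Rightarrow> 'b set" where
  "fspan r = linear_span A {fel i [^] s | i s. i \<in> Vt \<and> r \<le> s \<and> s \<le> N}"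

text \<open>The functional that splits off \<open>eps_0\<close>: it vanishes on all
  \<open>f_i^s\<close> with \<open>s \<ge> 1\<close>, the two signs cancelling for
  \<open>s = N\<close>, and is 1 on \<open>eps_0\<close>.\<close>

definition alt :: "'b \<Rightarrow> 'k" where
  "alt x = (\<Sum>u\<in>Vt. alt_sign u * coord x (u, True, 2 * N))"

lemma alt_add: "x \<in> carrier A \<Longrightarrow> y \<in> carrier A \<Longrightarrow> alt (x \<oplus> y) = alt x + alt y"
  by (simp add: alt_def coord_add algebra_simps sum.distrib)

lemma alt_smult: "x \<in> carrier A \<Longrightarrow> alt (t \<odot> x) = t * alt x"
  by (simp add: alt_def coord_smult sum_distrib_left algebra_simps)

lemma alt_zero [simp]: "alt \<zero> = 0"
  by (simp add: alt_def)

lemma alt_one [simp]: "alt \<one> = 0"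
  using N by (simp add: alt_def coord_one)

lemma coord_epsel: "i \<in> Vt \<Longrightarrow> coord (epsel i) b = (if b = (i, True, 2 * N) then 1 else 0)"
  unfolding epsel_def by (subst coord_bas) auto

lemma alt_epsel: 
  assumes "i \<in> Vt"
  shows "alt (epsel i) = alt_sign i"
proof -
  have "alt (epsel i) = (\<Sum>u\<in>Vt. if u = i then alt_sign i else 0)"
    unfolding alt_def using assms by (intro sum.cong) (auto simp: coord_epsel)
  then show ?thesis
    using assms by simp
qed

lemma alt_fel_pow:
  assumes i: "i \<in> Vt" and s: "1 \<le> s" "s \<le> N"
  shows "alt (fel i [^] s) = 0"
proof (cases "s = N")
  case True
  then show ?thesis
    using i fel_pow_N[OF i] by (simp add: alt_add alt_epsel alt_sign_nx)
next
  case False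
  then show ?thesis
    using assms N unfolding alt_def by (intro sum.neutral) (auto simp: coord_fel_pow)
qed

lemma fspan_gens_closed: "{fel i [^] s | i s. i \<in> Vt \<and> r \<le> s \<and> s \<le> N} \<subseteq> carrier A"
  by auto

lemma fspan_subspace: "is_subspace A (fspan r)"
  unfolding fspan_def by (rule linear_span_subspace[OF fspan_gens_closed])

text \<open>No upper bound on \<open>s\<close> is imposed, because powers beyond \<open>N\<close>
  are zero; products of powers then need no case distinction.\<close>

lemma fspan_gen: 
  assumes "i \<in> Vt" "r \<le> s"
  shows "fel i [^] s \<in> fspan r"
proof (cases "s \<le> N")
  case True
  then show ?thesis
    unfolding fspan_def using assms linear_span_superset[of "{fel i [^] s | i s. i \<in> Vt \<and> r \<le> s \<and> s \<le> N}"]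
    by blast
next
  case False
  then show ?thesis
    using assms subspaceD(2)[OF fspan_subspace] by (simp add: fel_pow_zero)
qed

lemma fspan_minimal:
  assumes "is_subspace A V" "\<And>i s. i \<in> Vt \<Longrightarrow> r \<le> s \<Longrightarrow> s \<le> N \<Longrightarrow> fel i [^] s \<in> V"
  shows "fspan r \<subseteq> V"
  unfolding fspan_def by (rule linear_span_minimal[OF assms(1)]) (use assms(2) in blast)

lemma fspan_antimono: "r \<le> r' \<Longrightarrow> fspan r' \<subseteq> fspan r"
  by (rule fspan_minimal[OF fspan_subspace]) (rule fspan_gen, auto)

lemma fspan_closed: "x \<in> fspan r \<Longrightarrow> x \<in> carrier A"
  using subspaceD(1)[OF fspan_subspace] by blast

lemma fspan_top: "fspan (Suc N) = {\<zero>}"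
proof -
  have "is_subspace A {\<zero>}"
    by (simp add: is_subspace_iff)
  then have "fspan (Suc N) \<subseteq> {\<zero>}"
    by (rule fspan_minimal) auto
  then show ?thesis
    using subspaceD(2)[OF fspan_subspace] by blast
qed

text \<open>Solves the cyclic system \<open>y_u + y_(u-1) = x_u\<close>, which is singular for even
  \<open>m\<close>. Multiplying by the sign turns it into a telescoping system, so signed partial
  sums are a solution as soon as they close up.\<close>

lemma alternating_partial_sums:
  fixes x :: "int \<Rightarrow> 'k"
  assumes "(\<Sum>u\<in>Vt. alt_sign u * x u) = 0"
  obtains y where "\<And>u. u \<in> Vt \<Longrightarrow> y u + y (pv u) = x u"
proof
  let ?y = "\<lambda>u. alt_sign u * (\<Sum>k\<in>{0..u}. alt_sign k * x k)"
  fix u assume u: "u \<in> Vt"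
  show "?y u + ?y (pv u) = x u"
  proof (cases "u = 0")
    case True
    then have "pv u = int m - 1"
      using u by (simp add: pv_cases)
    moreover have "{0..int m - 1} = Vt"
      by auto
    \<comment> \<open>The closing condition: at the last vertex the partial sum is the full
      alternating sum, zero by assumption.\<close>
    ultimately have "?y (pv u) = 0"
      using assms by simp
    moreover have "?y u = x u"
      using True by (simp add: alt_sign_def)
    ultimately show ?thesis
      by simp
  next
    case False
    then have pv: "pv u = u - 1"
      using u by (simp add: pv_cases)
    have "{0..u} = insert u {0..u - 1}"
      using u by auto
    then have "?y u = alt_sign u * alt_sign u * x u + alt_sign u * (\<Sum>k\<in>{0..u - 1}. alt_sign k * x k)"
      by (simp add: algebra_simps del: alt_sign_square)
    moreover have "?y (pv u) = - (alt_sign u * (\<Sum>k\<in>{0..u - 1}. alt_sign k * x k))"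
      unfolding alt_sign_pv[OF u] by (simp add: pv)
    ultimately show ?thesis
      by simp
  qed
qed

text \<open>Below the maximal length each word receives one coefficient; at length
  \<open>2 * N\<close> both tests hold, as \<open>eps_u\<close> occurs in \<open>f_u^N\<close> and
  in the power of the preceding \<open>f\<close>.\<close>

lemma sum_coord_fel_pow:
  assumes "(u, d, l) \<in> B" "1 \<le> r" "r \<le> N"
  shows "(\<Sum>p\<in>Vt \<times> {r..N}. t (fst p) (snd p) * coord (fel (fst p) [^] snd p) (u, d, l))
    = (if even l \<and> r \<le> l div 2 \<and> d then t u (l div 2) else 0)
    + (if even l \<and> r \<le> l div 2 \<and> d = (l = 2 * N) then t (pv u) (l div 2) else 0)"
proof -
  have u: "u \<in> Vt"
    using assms(1) by simp
  have "l \<le> 2 * N"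
    using assms(1) by simp
  then have l: "l div 2 \<le> N"
    by presburger
  have "(\<Sum>p\<in>Vt \<times> {r..N}. t (fst p) (snd p) * coord (fel (fst p) [^] snd p) (u, d, l))
    = (\<Sum>p\<in>Vt \<times> {r..N}. (if p = (u, l div 2) then (if even l \<and> d then t u (l div 2) else 0) else 0)
       + (if p = (pv u, l div 2) then (if even l \<and> d = (l = 2 * N) then t (pv u) (l div 2) else 0) else 0))"
  proof (rule sum.cong[OF refl])
    fix p assume p: "p \<in> Vt \<times> {r..N}"
    obtain i s where p_eq: "p = (i, s)"
      by (cases p)
    have i: "i \<in> Vt" "1 \<le> s" "s \<le> N"
      using p assms p_eq by auto
    show "t (fst p) (snd p) * coord (fel (fst p) [^] snd p) (u, d, l)
      = (if p = (u, l div 2) then (if even l \<and> d then t u (l div 2) else 0) else 0)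
       + (if p = (pv u, l div 2) then (if even l \<and> d = (l = 2 * N) then t (pv u) (l div 2) else 0) else 0)"
      unfolding p_eq fst_conv snd_conv coord_fel_pow[OF i]
      using i u assms(1) by (cases "even l") (auto simp: algebra_simps)
  qed
  also have "\<dots> = (if r \<le> l div 2 then (if even l \<and> d then t u (l div 2) else 0) else 0)
    + (if r \<le> l div 2 then (if even l \<and> d = (l = 2 * N) then t (pv u) (l div 2) else 0) else 0)"
    unfolding sum.distrib using u l by (subst (1 2) sum.delta) auto
  finally show ?thesis
    by (simp only: if_if_eq_conj conj_ac)
qed

lemma fspanI:
  assumes z: "z \<in> HH0 A" and r: "1 \<le> r" "r \<le> N"
    and "coord z (0, True, 0) = 0" "alt z = 0"
    and low: "\<And>u s. u \<in> Vt \<Longrightarrow> s < r \<Longrightarrow> s < N \<Longrightarrow> coord z (u, True, 2 * s) = 0"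
  shows "z \<in> fspan r"
proof -
  obtain y where y: "\<And>u. u \<in> Vt \<Longrightarrow> y u + y (pv u) = coord z (u, True, 2 * N)"
    using alternating_partial_sums[of "\<lambda>u. coord z (u, True, 2 * N)"] assms(5) unfolding alt_def by blast
  \<comment> \<open>Coefficients of lower powers are read off from \<open>z\<close>; those of the
    \<open>N\<close>-th powers must solve the cyclic system, solvable because
    \<open>alt z = 0\<close>.\<close>
  let ?t = "\<lambda>u s. if s < N then coord z (u, True, 2 * s) else y u"
  show ?thesis
  proof (rule subspace_combination[OF fspan_subspace, where I = "Vt \<times> {r..N}"
        and g = "\<lambda>p. fel (fst p) [^] snd p" and t = "\<lambda>p. ?t (fst p) (snd p)"])
    fix b assume b: "b \<in> B"
    obtain u d l where bu: "b = (u, d, l)"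
      by (cases b)
    note b' = b[unfolded bu]
    have u: "u \<in> Vt"
      using b' by simp
    show "coord z b = (\<Sum>p\<in>Vt \<times> {r..N}. ?t (fst p) (snd p) * coord (fel (fst p) [^] snd p) b)"
      unfolding bu sum_coord_fel_pow[OF b' r, of ?t]
    proof (cases "even l")
      case True
      then obtain s where l: "l = 2 * s"
        by (elim evenE)
      consider "s = N" | "s < N" "d" | "s < N" "\<not> d" "s > 0"
        using b' l by force
      then show "coord z (u, d, l) = (if even l \<and> r \<le> l div 2 \<and> d then ?t u (l div 2) else 0)
          + (if even l \<and> r \<le> l div 2 \<and> d = (l = 2 * N) then ?t (pv u) (l div 2) else 0)"
      proof cases
        case 1
        then show ?thesis
          using b' l r y[OF u] by simp
      next
        case 2
        then show ?thesis
          using l low[OF u, of s] by simp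
      next
        case 3
        then show ?thesis
          using l low[OF vt_simps(2)[OF u], of s] HH0_coord_False[OF z u, of s] by simp
      qed
    qed (simp add: HH0_coord_odd[OF z])
  qed (use HH0_closed[OF z] r in \<open>auto intro: fspan_gen\<close>)
qed

lemma fspan_props:
  assumes x: "x \<in> fspan r" and r: "1 \<le> r"
  shows "x \<in> HH0 A" and "u \<in> Vt \<Longrightarrow> coord x (u, True, 0) = 0" and "alt x = 0"
proof -
  let ?V = "{x \<in> HH0 A. alt x = 0 \<and> (\<forall>u\<in>Vt. coord x (u, True, 0) = 0)}"
  have "is_subspace A ?V"
    unfolding is_subspace_iff using subspaceD[OF HH0_subspace] HH0_closed
    by (auto simp: alt_add alt_smult coord_add coord_smult)
  then have "fspan r \<subseteq> ?V"
  proof (rule fspan_minimal)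
    fix i s assume "i \<in> Vt" "r \<le> s" "s \<le> N"
    then show "fel i [^] s \<in> ?V"
      using r N by (auto simp: alt_fel_pow coord_fel_pow fel_HH0 intro!: HH0_pow)
  qed
  then show "x \<in> HH0 A" "u \<in> Vt \<Longrightarrow> coord x (u, True, 0) = 0" "alt x = 0"
    using x by auto
qed

text \<open>\<open>fspanI\<close> with \<open>r = 1\<close>; centrality spreads the one condition at
  vertex 0 to every vertex.\<close>

lemma fspan_one_eq: "fspan 1 = {z \<in> HH0 A. coord z (0, True, 0) = 0 \<and> alt z = 0}"
proof
  show "fspan 1 \<subseteq> {z \<in> HH0 A. coord z (0, True, 0) = 0 \<and> alt z = 0}"
    using fspan_props[of _ 1] m by auto
  show "{z \<in> HH0 A. coord z (0, True, 0) = 0 \<and> alt z = 0} \<subseteq> fspan 1"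
  proof
    fix z assume z: "z \<in> {z \<in> HH0 A. coord z (0, True, 0) = 0 \<and> alt z = 0}"
    then show "z \<in> fspan 1"
      by (intro fspanI) (use N HH0_coord_vertex[of z] in auto)
  qed
qed


section \<open>Derivations and the centre\<close>

text \<open>Expanding \<open>d\<close> on \<open>a abar + abar a\<close> gives four products, each
  with one of these two arrows as a factor. By centrality of the result only even words matter, and
  the arrow factor confines these to the pair of index \<open>i\<close>. The coefficients
  \<open>c s\<close> are read off at the vertex \<open>i\<close>.\<close>

lemma derivation_fel:
  assumes d: "d \<in> derivations A" and i: "i \<in> Vt"
  obtains c where "\<And>b. b \<in> B \<Longrightarrow> coord (d (fel i)) b = (\<Sum>s\<in>{1..N}. c s * coord (fel i [^] s) b)"
proof
  let ?a = "(i, True, 1)" and ?a' = "(nx i, False, 1)"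
  have B: "?a \<in> B" "?a' \<in> B"
    using i N by auto
  have prod: "bas ?a \<otimes> bas ?a' = bas (zz_canon N (i, True, 2))"
    "bas ?a' \<otimes> bas ?a = bas (zz_canon N (nx i, False, 2))"
    using N i B by (auto intro!: bas_mult_Some simp: zz_mult_def zz_end_simp numeral_2_eq_2)
  let ?X = "d (bas ?a)" and ?Y = "d (bas ?a')"
  let ?Z = "d (fel i)"
  note cl = bas_closed[OF B(1)] bas_closed[OF B(2)]
  note dcl = derivation_closed[OF d cl(1)] derivation_closed[OF d cl(2)]
  have Z: "?Z = (?X \<otimes> bas ?a' \<oplus> bas ?a \<otimes> ?Y) \<oplus> (?Y \<otimes> bas ?a \<oplus> bas ?a' \<otimes> ?X)"
    unfolding fel_def prod[symmetric] using cl by (simp add: derivation_add[OF d] derivation_mult[OF d])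
  have coord_Z: "coord ?Z b = coord (?X \<otimes> bas ?a') b + coord (bas ?a \<otimes> ?Y) b
      + (coord (?Y \<otimes> bas ?a) b + coord (bas ?a' \<otimes> ?X) b)" for b
    unfolding Z using cl dcl by (simp add: coord_add)
  have Zc: "?Z \<in> HH0 A"
    by (rule derivation_HH0[OF d fel_HH0[OF i]])
  \<comment> \<open>Each of the four products contains an arrow, so no trivial path can
    occur.\<close>
  have Z0: "coord ?Z (u, True, 0) = 0" if "u \<in> Vt" for u
  proof -
    have nz: "zz_mult N m x ?a \<noteq> Some (u, True, 0)" "zz_mult N m x ?a' \<noteq> Some (u, True, 0)"
      "zz_mult N m ?a x \<noteq> Some (u, True, 0)" "zz_mult N m ?a' x \<noteq> Some (u, True, 0)" for x
      by (cases x; simp add: zz_mult_Some_iff)+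
    show ?thesis
      unfolding coord_Z coord_mult_bas[OF dcl(1) B(2)] coord_mult_bas[OF dcl(2) B(1)]
        coord_bas_mult[OF dcl(1) B(2)] coord_bas_mult[OF dcl(2) B(1)]
      by (simp only: nz if_False sum.neutral_const add_0)
  qed
  \<comment> \<open>For \<open>s = N\<close> the words at \<open>i\<close> and at
    \<open>nx i\<close> both receive the same scalar. Hence the top part is a multiple of
    \<open>f_i^N\<close>, not an arbitrary combination of \<open>eps_i\<close> and
    \<open>eps_(i+1)\<close>.\<close>
  have Zs: "coord ?Z (u, True, 2 * s)
      = (if u = i then coord ?X (i, True, 2 * s - 1) + coord ?Y (nx i, False, 2 * s - 1) else 0)
      + (if u = nx i \<and> s = N then coord ?X (i, True, 2 * s - 1) + coord ?Y (nx i, False, 2 * s - 1) else 0)"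
    if u: "u \<in> Vt" and s: "1 \<le> s" "s \<le> N" for u s
  proof -
    have C: "(i, True, 2 * s - 1) \<in> B" "(nx i, False, 2 * s - 1) \<in> B"
      using i s by auto
    have nx: "nx u = nx i \<longleftrightarrow> u = i" "pv u = i \<longleftrightarrow> u = nx i"
      "nx i = nx u \<longleftrightarrow> u = i" "i = pv u \<longleftrightarrow> u = nx i"
      using u i vt_simps(3,4) by metis+
    obtain s' where s': "s = Suc s'"
      using s by (cases s) auto
    have "coord (?X \<otimes> bas ?a') (u, True, 2 * s) = (if u = i then coord ?X (i, True, 2 * s - 1) else 0)"
      by (rule coord_mult_bas_unique[OF dcl(1) B(2) C(1)])
        (use s nx in \<open>auto simp: s' zz_mult_Some_iff zz_end_simp\<close>)
    moreover have "coord (bas ?a \<otimes> ?Y) (u, True, 2 * s) = (if u = i then coord ?Y (nx i, False, 2 * s - 1) else 0)"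
      by (rule coord_bas_mult_unique[OF dcl(2) B(1) C(2)])
        (use s nx in \<open>auto simp: s' zz_mult_Some_iff zz_end_simp\<close>)
    moreover have "coord (?Y \<otimes> bas ?a) (u, True, 2 * s) = (if u = nx i \<and> s = N then coord ?Y (nx i, False, 2 * s - 1) else 0)"
      by (rule coord_mult_bas_unique[OF dcl(2) B(1) C(2)])
        (use s nx in \<open>auto simp: s' zz_mult_Some_iff zz_end_simp\<close>)
    moreover have "coord (bas ?a' \<otimes> ?X) (u, True, 2 * s) = (if u = nx i \<and> s = N then coord ?X (i, True, 2 * s - 1) else 0)"
      by (rule coord_bas_mult_unique[OF dcl(1) B(2) C(1)])
        (use s nx i in \<open>auto simp: s' zz_mult_Some_iff zz_end_simp\<close>)
    ultimately show ?thesis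
      unfolding coord_Z by simp
  qed
  fix b assume b: "b \<in> B"
  obtain u e l where bu: "b = (u, e, l)"
    by (cases b)
  have u: "u \<in> Vt" "l \<le> 2 * N" "e \<or> 0 < l \<and> l < 2 * N"
    using b bu by auto
  have "coord (fel i [^] s) b = 0" if "s \<in> {1..N}" "s \<noteq> l div 2" for s
    using that by (auto simp: bu coord_fel_pow[OF i])
  then have "(\<Sum>s\<in>{1..N}. coord ?Z (i, True, 2 * s) * coord (fel i [^] s) b)
      = (\<Sum>s\<in>{1..N}. if s = l div 2 then coord ?Z (i, True, 2 * s) * coord (fel i [^] s) b else 0)"
    by (intro sum.cong) auto
  also have "\<dots> = (if l div 2 \<in> {1..N} then coord ?Z (i, True, 2 * (l div 2)) * coord (fel i [^] (l div 2)) b else 0)"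
    by (simp only: sum.delta finite_atLeastAtMost)
  also have "\<dots> = coord ?Z b"
  proof (cases "even l")
    case False
    then show ?thesis
      using HH0_coord_odd[OF Zc] coord_fel_pow[OF i, of "l div 2"] by (simp add: bu)
  next
    case True
    then obtain s where l: "l = 2 * s"
      by (elim evenE)
    consider "s = 0" e | "s > 0" "s < N" e | "s > 0" "s < N" "\<not> e" | "s = N" "s > 0" e
      using u(2,3) l N by (cases "s = 0"; cases "s = N"; cases e) auto
    then show ?thesis
    proof cases
      case 1
      then show ?thesis
        using Z0[OF u(1)] by (simp add: bu l)
    next
      case 2
      then show ?thesis
        using Zs[OF u(1), of s] Zs[OF i, of s] i u(1) coord_fel_pow[OF i, of s] by (simp add: bu l)
    next
      case 3
      then show ?thesis
        using HH0_coord_False[OF Zc u(1), of s] Zs[OF vt_simps(2)[OF u(1)], of s] Zs[OF i, of s] i u(1)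
          coord_fel_pow[OF i, of s] by (simp add: bu l)
    next
      case 4
      have "i = pv u \<longleftrightarrow> u = nx i"
        using u i vt_simps(3,4) by metis
      then show ?thesis
        using 4 Zs[OF u(1), of s] Zs[OF i, of s] i u(1) coord_fel_pow[OF i, of s] by (simp add: bu l)
    qed
  qed
  finally show "coord ?Z b = (\<Sum>s\<in>{1..N}. coord ?Z (i, True, 2 * s) * coord (fel i [^] s) b)"
    by simp
qed

text \<open>Write \<open>eps_i = a_i w\<close> with \<open>w\<close> of length
  \<open>2 * N - 1\<close>. In \<open>d(a_i) w + a_i d(w)\<close> the first term has only words of
  length at least \<open>2 * N - 1\<close>, the second only words starting with \<open>a_i\<close>;
  centrality removes what remains besides \<open>eps_i\<close>.\<close>

lemma derivation_epsel:
  assumes d: "d \<in> derivations A" and i: "i \<in> Vt"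
  obtains t where "d (epsel i) = t \<odot> epsel i"
proof
  let ?a = "(i, True, 1)" and ?w = "(nx i, False, 2 * N - 1)"
  let ?Z = "d (epsel i)"
  have B: "?a \<in> B" "?w \<in> B"
    using i N by auto
  have prod: "bas ?a \<otimes> bas ?w = epsel i"
    unfolding epsel_def using N i B by (auto intro!: bas_mult_Some simp: zz_mult_def zz_end_simp)
  let ?X = "d (bas ?a)" and ?Y = "d (bas ?w)"
  note cl = bas_closed[OF B(1)] bas_closed[OF B(2)]
  note dcl = derivation_closed[OF d cl(1)] derivation_closed[OF d cl(2)]
  have coord_Z: "coord ?Z b = coord (?X \<otimes> bas ?w) b + coord (bas ?a \<otimes> ?Y) b" for b
    unfolding prod[symmetric] using cl dcl by (simp add: derivation_mult[OF d] coord_add)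
  have Zc: "?Z \<in> HH0 A"
    by (rule derivation_HH0[OF d epsel_HH0[OF i]])
  have vanish: "coord ?Z (u, e, l) = 0"
    if u: "u \<in> Vt" and b: "even l" "l = 0 \<or> l < 2 * N \<and> \<not> e \<or> l = 2 * N \<and> u \<noteq> i" for u e l
  proof -
    have nz: "zz_mult N m x ?w \<noteq> Some (u, e, l)" "zz_mult N m ?a x \<noteq> Some (u, e, l)" if x: "x \<in> B" for x
    proof -
      obtain v e' k where x': "x = (v, e', k)"
        by (cases x)
      have v: "v \<in> Vt"
        using x x' by simp
      have "nx v = nx i \<Longrightarrow> v = i"
        using v i vt_simps(4) by metis
      moreover have "2 * N - 1 + k = 2 * N \<longleftrightarrow> k = 1" "k + (2 * N - 1) = 2 * N \<longleftrightarrow> k = 1"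
        using N by auto
      moreover have "l < 2 * N \<Longrightarrow> k + (2 * N - 1) = l \<Longrightarrow> k = 0 \<and> odd l"
        using N by auto
      ultimately show "zz_mult N m x ?w \<noteq> Some (u, e, l)" "zz_mult N m ?a x \<noteq> Some (u, e, l)"
        using b N i by (auto simp: x' zz_mult_Some_iff zz_end_simp)
    qed
    show ?thesis
      unfolding coord_Z coord_mult_bas[OF dcl(1) B(2)] coord_bas_mult[OF dcl(2) B(1)]
      using nz by (simp add: sum.neutral)
  qed
  show "?Z = coord ?Z (i, True, 2 * N) \<odot> epsel i"
  proof (rule coord_eqI)
    fix b assume b: "b \<in> B"
    obtain u e l where bu: "b = (u, e, l)"
      by (cases b)
    have u: "u \<in> Vt" "l \<le> 2 * N" "l = 2 * N \<Longrightarrow> e"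
      using b bu by auto
    have "coord ?Z b = 0" if ne: "b \<noteq> (i, True, 2 * N)"
    proof (cases "odd l \<or> l = 0 \<or> l < 2 * N \<and> \<not> e \<or> l = 2 * N \<and> u \<noteq> i")
      case True
      then show ?thesis
        using HH0_coord_odd[OF Zc] vanish[OF u(1), of l e] bu by blast
    next
      case False
      then have "even l"
        by blast
      then obtain s where l: "l = 2 * s"
        by (elim evenE)
      have s: "0 < s" "s < N" e
        using False u ne bu l by auto
      \<comment> \<open>Forward words are not excluded by the factorisation, but centrality equates
        their coefficients with those of backward words at the next vertex.\<close>
      have "coord ?Z (u, True, 2 * s) = coord ?Z (nx u, False, 2 * s)"
        using HH0_coord_False[OF Zc vt_simps(1)[OF u(1)] s(1,2)] u(1) by simp
      also have "\<dots> = 0"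
        using vanish[OF vt_simps(1)[OF u(1)], of "2 * s" False] s by simp
      finally show ?thesis
        using bu l s by simp
    qed
    then show "coord ?Z b = coord (coord ?Z (i, True, 2 * N) \<odot> epsel i) b"
      using i by (auto simp: coord_smult coord_epsel)
  qed (use HH0_closed[OF Zc] i in auto)
qed

text \<open>By the power rule \<open>d(f_i^s)\<close> is a multiple of
  \<open>f_i^(s-1) d(f_i)\<close>, and \<open>d(f_i)\<close> is a combination of positive powers of
  \<open>f_i\<close>.\<close>

lemma derivation_fspan_one:
  assumes d: "d \<in> derivations A" and z: "z \<in> fspan 1"
  shows "d z \<in> fspan 1"
proof -
  note S = subspaceD[OF fspan_subspace[of 1]]
  have "is_subspace A {x \<in> carrier A. d x \<in> fspan 1}"
    unfolding is_subspace_iff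
    using S(2-4) by (auto simp: derivation_add[OF d] derivation_smult[OF d] derivation_zero[OF d])
  then have "fspan 1 \<subseteq> {x \<in> carrier A. d x \<in> fspan 1}"
  proof (rule fspan_minimal)
    fix i s assume i: "i \<in> Vt" and s: "1 \<le> s" "s \<le> N"
    obtain n where n: "s = Suc n"
      using s by (cases s) auto
    obtain c where c: "\<And>b. b \<in> B \<Longrightarrow> coord (d (fel i)) b = (\<Sum>s\<in>{1..N}. c s * coord (fel i [^] s) b)"
      using derivation_fel[OF d i] by blast
    have V: "is_subspace A {x \<in> carrier A. fel i [^] n \<otimes> x \<in> fspan 1}"
      unfolding is_subspace_iff using S(2-4) i by (auto simp: r_distr smult_mult_right)
    have "d (fel i) \<in> {x \<in> carrier A. fel i [^] n \<otimes> x \<in> fspan 1}"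
    proof (rule subspace_combination[OF V _ _ _ c])
      fix t assume "t \<in> {1..N}"
      then show "fel i [^] t \<in> {x \<in> carrier A. fel i [^] n \<otimes> x \<in> fspan 1}"
        using i fspan_gen[OF i, of 1 "n + t"] by (simp add: nat_pow_mult)
    qed (use derivation_closed[OF d] i in auto)
    then have "d (fel i [^] s) \<in> fspan 1"
      unfolding n derivation_pow[OF d fel_HH0[OF i]] by (intro S(4)) simp
    then show "fel i [^] s \<in> {x \<in> carrier A. d x \<in> fspan 1}"
      using i by simp
  qed
  then show ?thesis
    using z by auto
qed

lemma HH1_submodule_fspan_one: "HH1_submodule A (fspan 1)"
  unfolding HH1_submodule_iff
  using fspan_subspace fspan_props(1) derivation_fspan_one by blast

lemma HH1_submodule_one: "HH1_submodule A (linear_span A {\<one>})"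
  unfolding HH1_submodule_iff
proof (intro conjI ballI)
  show S: "is_subspace A (linear_span A {\<one>})"
    by (rule linear_span_subspace) simp
  show "linear_span A {\<one>} \<subseteq> HH0 A"
    by (rule linear_span_minimal[OF HH0_subspace]) (simp add: HH0_one)
  fix d z assume d: "d \<in> derivations A" and "z \<in> linear_span A {\<one>}"
  then obtain t where "z = t \<odot> \<one>"
    by (auto simp: linear_span_singleton)
  then have "d z = \<zero>"
    using d by (simp add: derivation_smult derivation_one)
  then show "d z \<in> linear_span A {\<one>}"
    using subspaceD(2)[OF S] by simp
qed

lemma HH1_submodule_epsel:
  assumes i: "i \<in> Vt"
  shows "HH1_submodule A (linear_span A {epsel i})"
  unfolding HH1_submodule_iff
proof (intro conjI ballI)
  show S: "is_subspace A (linear_span A {epsel i})"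
    by (rule linear_span_subspace) (use i in simp)
  show "linear_span A {epsel i} \<subseteq> HH0 A"
    by (rule linear_span_minimal[OF HH0_subspace]) (use i epsel_HH0 in simp)
  fix d z assume d: "d \<in> derivations A" and "z \<in> linear_span A {epsel i}"
  then obtain t where z: "z = t \<odot> epsel i"
    using i by (auto simp: linear_span_singleton)
  obtain t' where "d (epsel i) = t' \<odot> epsel i"
    using derivation_epsel[OF d i] .
  then have "d z = (t * t') \<odot> epsel i"
    using d i z by (simp add: derivation_smult smult_smult)
  then show "d z \<in> linear_span A {epsel i}"
    using i by (auto simp: linear_span_singleton)
qed

text \<open>The coefficient at vertex 0 and the functional \<open>alt\<close> recover the first two
  components of a sum, which gives injectivity; subtracting these components from a central element
  leaves a member of \<open>fspan 1\<close>.\<close>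

lemma HH0_direct_sum:
  "is_direct_sum A (HH0 A) [linear_span A {\<one>}, linear_span A {epsel 0}, fspan 1]"
proof -
  let ?f = "\<lambda>us. foldr (\<lambda>u v. u \<oplus> v) us \<zero>"
  let ?Us = "[linear_span A {\<one>}, linear_span A {epsel 0}, fspan 1]"
  have 0: "0 \<in> Vt"
    using m by simp
  note [simp] = epsel_closed[OF 0] fspan_closed
  have L: "listset ?Us = {[s \<odot> \<one>, t \<odot> epsel 0, x] | s t x. x \<in> fspan 1}"
    by (auto simp: set_Cons_def linear_span_singleton)
  have f: "?f [s \<odot> \<one>, t \<odot> epsel 0, x] = s \<odot> \<one> \<oplus> (t \<odot> epsel 0 \<oplus> x)" if "x \<in> fspan 1" for s t x
    using that by simp
  have c0: "coord (s \<odot> \<one> \<oplus> (t \<odot> epsel 0 \<oplus> x)) (0, True, 0) = s" if "x \<in> fspan 1" for s t x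
    using that fspan_props(2)[OF that _ 0] N m
    by (simp add: coord_add coord_smult coord_one coord_epsel[OF 0])
  have alt: "alt (s \<odot> \<one> \<oplus> (t \<odot> epsel 0 \<oplus> x)) = t" if "x \<in> fspan 1" for s t x
    using that fspan_props(3)[OF that] by (simp add: alt_add alt_smult alt_epsel[OF 0] alt_sign_def)
  have inj: "inj_on ?f (listset ?Us)"
  proof (rule inj_onI)
    fix p q assume pq: "p \<in> listset ?Us" "q \<in> listset ?Us" "?f p = ?f q"
    obtain s t x where p: "p = [s \<odot> \<one>, t \<odot> epsel 0, x]" and x: "x \<in> fspan 1"
      using pq(1) unfolding L by blast
    obtain s' t' x' where q: "q = [s' \<odot> \<one>, t' \<odot> epsel 0, x']" and x': "x' \<in> fspan 1"
      using pq(2) unfolding L by blast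
    have eq: "s \<odot> \<one> \<oplus> (t \<odot> epsel 0 \<oplus> x) = s' \<odot> \<one> \<oplus> (t' \<odot> epsel 0 \<oplus> x')"
      using pq(3) unfolding p q f[OF x] f[OF x'] .
    have "s = s'" "t = t'"
      using arg_cong[OF eq, of "\<lambda>x. coord x (0, True, 0)"] arg_cong[OF eq, of alt]
      unfolding c0[OF x] c0[OF x'] alt[OF x] alt[OF x'] by auto
    then show "p = q"
      using eq x x' unfolding p q by simp
  qed
  have "?f ` listset ?Us = HH0 A"
  proof
    show "?f ` listset ?Us \<subseteq> HH0 A"
    proof
      fix z assume "z \<in> ?f ` listset ?Us"
      then obtain s t x where z: "z = ?f [s \<odot> \<one>, t \<odot> epsel 0, x]" and x: "x \<in> fspan 1"
        unfolding L by blast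
      show "z \<in> HH0 A"
        unfolding z f[OF x]
        using subspaceD(3,4)[OF HH0_subspace] HH0_one epsel_HH0[OF 0] fspan_props(1)[OF x] by blast
    qed
    show "HH0 A \<subseteq> ?f ` listset ?Us"
    proof
      fix z assume z: "z \<in> HH0 A"
      let ?s = "coord z (0, True, 0)" and ?t = "alt z"
      note zc [simp] = HH0_closed[OF z]
      let ?x = "z \<oplus> ((- ?s) \<odot> \<one> \<oplus> (- ?t) \<odot> epsel 0)"
      have "?x \<in> HH0 A"
        by (intro subspaceD(3,4)[OF HH0_subspace] HH0_one epsel_HH0[OF 0] z)
      moreover have "coord ?x (0, True, 0) = 0"
        using N m by (simp add: coord_add coord_smult coord_one coord_epsel[OF 0])
      moreover have "alt ?x = 0"
        by (simp add: alt_add alt_smult alt_epsel[OF 0] alt_sign_def)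
      ultimately have x: "?x \<in> fspan 1"
        unfolding fspan_one_eq by simp
      have "z = ?s \<odot> \<one> \<oplus> (?t \<odot> epsel 0 \<oplus> ?x)"
        by (rule coord_eqI) (auto simp: coord_add coord_smult)
      then have "z = ?f [?s \<odot> \<one>, ?t \<odot> epsel 0, ?x]"
        unfolding f[OF x] .
      then show "z \<in> ?f ` listset ?Us"
        unfolding L using x by blast
    qed
  qed
  then show ?thesis
    unfolding is_direct_sum_def bij_betw_def using inj by blast
qed


section \<open>Indecomposability of the third summand\<close>

text \<open>
  The central multiple \<open>f\<^sub>j\<^sup>s\<close> of the derivation \<open>\<phi>\<^bsub>1,0\<^esub> - \<psi>\<^bsub>1,0\<^esub>\<close>. On the centre it acts as
  \<open>2 E\<^bsub>1,j,s\<^esub>\<close>, but there are no relations to check.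
\<close>

definition raise :: "int \<Rightarrow> nat \<Rightarrow> 'b \<Rightarrow> 'b" where
  "raise j s = (\<lambda>x\<in>carrier A. fel j [^] s \<otimes> euler (\<lambda>(u, d, l). l) x)"

lemma euler_length_derivation: "euler (\<lambda>(u, d, l). l) \<in> derivations A"
  by (rule euler_derivation) (auto simp: zz_mult_Some_iff split: prod.splits)

lemma raise_derivation: "j \<in> Vt \<Longrightarrow> raise j s \<in> derivations A"
  unfolding raise_def by (intro central_mult_derivation euler_length_derivation HH0_pow fel_HH0)

text \<open>\<open>f_i^s\<close> is homogeneous of length \<open>2 * s\<close>.\<close>

lemma euler_fel_pow:
  assumes "i \<in> Vt" "1 \<le> s" "s \<le> N"
  shows "euler (\<lambda>(u, d, l). l) (fel i [^] s) = of_nat (2 * s) \<odot> fel i [^] s"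
proof (rule coord_eqI)
  fix b assume "b \<in> B"
  obtain u d l where b: "b = (u, d, l)"
    by (cases b)
  have "coord (fel i [^] s) b = 0 \<or> l = 2 * s"
    unfolding b coord_fel_pow[OF assms] by auto
  then show "coord (euler (\<lambda>(u, d, l). l) (fel i [^] s)) b = coord (of_nat (2 * s) \<odot> fel i [^] s) b"
    using assms by (auto simp: b coord_euler coord_smult)
qed (use assms in \<open>auto intro: euler_closed\<close>)

lemma raise_fel_pow:
  assumes "i \<in> Vt" "j \<in> Vt" "1 \<le> t" "t \<le> N" "1 \<le> s"
  shows "raise j s (fel i [^] t) = (if i = j then of_nat (2 * t) \<odot> fel j [^] (s + t) else \<zero>)"
  using assms fel_pow_mult_fel_pow[of j i s t]
  by (auto simp: raise_def euler_fel_pow smult_mult_right nat_pow_mult)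

lemma raise_fspan:
  assumes j: "j \<in> Vt" and s: "1 \<le> s" and r: "1 \<le> r" and x: "x \<in> fspan r"
  shows "raise j s x \<in> fspan (r + s)"
proof -
  note d = raise_derivation[OF j, of s]
  note S = subspaceD[OF fspan_subspace[of "r + s"]]
  have "is_subspace A {x \<in> carrier A. raise j s x \<in> fspan (r + s)}"
    unfolding is_subspace_iff
    using S(2-4) by (auto simp: derivation_add[OF d] derivation_smult[OF d] derivation_zero[OF d])
  then have "fspan r \<subseteq> {x \<in> carrier A. raise j s x \<in> fspan (r + s)}"
  proof (rule fspan_minimal)
    fix i t assume "i \<in> Vt" "r \<le> t" "t \<le> N"
    then show "fel i [^] t \<in> {x \<in> carrier A. raise j s x \<in> fspan (r + s)}"
      using j s r S(2,4) fspan_gen[OF j, of "r + s" "s + t"] by (auto simp: raise_fel_pow)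
  qed
  then show ?thesis
    using x by auto
qed

text \<open>The coefficient of \<open>f_i\<close> in an element of \<open>fspan 1\<close>, provided
  \<open>N \<ge> 2\<close>; for \<open>N = 1\<close> the word in question has maximal length and
  lies in two of the \<open>f_j\<close>.\<close>

definition lin :: "int \<Rightarrow> 'b \<Rightarrow> 'k" where
  "lin i x = coord x (i, True, 2)"

lemma lin_fel_pow:
  assumes "N \<ge> 2" "i \<in> Vt" "j \<in> Vt" "1 \<le> s" "s \<le> N"
  shows "lin j (fel i [^] s) = (if i = j \<and> s = 1 then 1 else 0)"
  using assms by (auto simp: lin_def coord_fel_pow)

text \<open>Multiplication by \<open>f_j^(N-1)\<close> pushes every power except the first beyond
  \<open>N\<close>, so only the linear part is left. This transports linear parts to the top
  power.\<close>

lemma raise_top: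
  assumes "N \<ge> 2" and j: "j \<in> Vt" and x: "x \<in> fspan 1"
  shows "raise j (N - 1) x = (2 * lin j x) \<odot> fel j [^] N"
proof -
  note d = raise_derivation[OF j, of "N - 1"]
  let ?V = "{x \<in> carrier A. raise j (N - 1) x = (2 * lin j x) \<odot> fel j [^] N}"
  have "is_subspace A ?V"
    unfolding is_subspace_iff
    using j by (auto simp: derivation_add[OF d] derivation_smult[OF d] derivation_zero[OF d]
        lin_def coord_add coord_smult add_smult[symmetric] smult_smult algebra_simps
        simp del: One_nat_def)
  then have "fspan 1 \<subseteq> ?V"
  proof (rule fspan_minimal)
    fix i s assume i: "i \<in> Vt" and s: "1 \<le> s" "s \<le> N"
    have "raise j (N - 1) (fel i [^] s) = (if i = j \<and> s = 1 then 2 \<odot> fel j [^] N else \<zero>)"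
      using raise_fel_pow[OF i j s, of "N - 1"] s assms(1) j fel_pow_zero[OF j, of "N - 1 + s"] by auto
    moreover have "lin j (fel i [^] s) = (if i = j \<and> s = 1 then 1 else 0)"
      using lin_fel_pow[OF assms(1) i j s] .
    ultimately show "fel i [^] s \<in> ?V"
      using i j by auto
  qed
  then show ?thesis
    using x by auto
qed

text \<open>The coefficient at vertex \<open>j\<close> sees only the half of \<open>f_j\<close>
  starting there. This stays true for \<open>N = 2\<close>, when the word of length 4 is the one
  shared with the neighbouring pair.\<close>

lemma coord_raise_one:
  assumes "N \<ge> 2" and j: "j \<in> Vt" and x: "x \<in> carrier A"
  shows "coord (raise j 1 x) (j, True, 4) = 2 * lin j x"
proof -
  have B: "(j, True, 2) \<in> B" "(nx j, False, 2) \<in> B"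
    using assms by auto
  have f: "fel j = bas (j, True, 2) \<oplus> bas (nx j, False, 2)"
    unfolding fel_def using assms(1) by simp
  let ?y = "euler (\<lambda>(u, d, l). l) x"
  have y: "?y \<in> carrier A"
    using x by (rule euler_closed)
  have "coord (bas (j, True, 2) \<otimes> ?y) (j, True, 4) = (if True then coord ?y (j, True, 2) else 0)"
    by (rule coord_bas_mult_unique[OF y B(1) B(1)]) (use assms in \<open>auto simp: zz_mult_Some_iff zz_end_simp\<close>)
  moreover have "coord (bas (nx j, False, 2) \<otimes> ?y) (j, True, 4) = (if False then coord ?y (j, True, 2) else 0)"
    by (rule coord_bas_mult_unique[OF y B(2) B(1)]) (use j in \<open>auto simp: zz_mult_Some_iff zz_end_simp\<close>)
  ultimately have "coord (fel j \<otimes> ?y) (j, True, 4) = coord ?y (j, True, 2)"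
    unfolding f using B[THEN bas_closed] y by (simp add: l_distr coord_add)
  then show ?thesis
    using j x by (simp add: raise_def lin_def coord_euler)
qed

lemma fspan_two:
  assumes "N \<ge> 2" and x: "x \<in> fspan 1" and "\<And>i. i \<in> Vt \<Longrightarrow> lin i x = 0"
  shows "x \<in> fspan 2"
proof (rule fspanI)
  fix u s assume "u \<in> Vt" "s < 2" "s < N"
  then show "coord x (u, True, 2 * s) = 0"
    using fspan_props(2)[OF x] assms(3)[of u] by (cases s) (auto simp: lin_def numeral_2_eq_2)
qed (use assms fspan_props[OF x] m in auto)

lemma alternating_relation:
  assumes b: "(u, d, l) \<in> B"
  shows "(\<Sum>j\<in>Vt. alt_sign j * coord (fel j [^] N) (u, d, l)) = (0::'k)"
proof -
  have "(\<Sum>j\<in>Vt. alt_sign j * coord (fel j [^] N) (u, d, l))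
    = (\<Sum>j\<in>Vt. (if j = u then if l = 2 * N then alt_sign u else 0 else 0)
      + (if j = pv u then if l = 2 * N then alt_sign (pv u) else 0 else 0))"
    using b N by (intro sum.cong) (auto simp: coord_fel_pow)
  also have "\<dots> = (if l = 2 * N then alt_sign u + alt_sign (pv u) else 0)"
    unfolding sum.distrib using b by (subst (1 2) sum.delta) auto
  finally show ?thesis
    using b by (simp add: alt_sign_pv)
qed

end

section \<open>A hypothetical splitting of the third summand\<close>

text \<open>The assumptions are symmetric under exchanging \<open>V\<close>, \<open>v\<close> with
  \<open>W\<close>, \<open>w\<close>; a second interpretation therefore yields each result for the
  other summand.\<close>

locale fspan_splitting = zigzag +
  fixes V W and v w
  assumes N2: "N \<ge> 2"
    and V: "HH1_submodule A V" and W: "HH1_submodule A W" and VW: "is_direct_sum A (fspan 1) [V, W]"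
    and v: "\<And>j. j \<in> {0..<int m} \<Longrightarrow> v j \<in> V" and w: "\<And>j. j \<in> {0..<int m} \<Longrightarrow> w j \<in> W"
    and vw: "\<And>j. j \<in> {0..<int m} \<Longrightarrow> fel j = v j \<oplus>\<^bsub>A\<^esub> w j"
begin

lemma subs: "is_subspace A V" "is_subspace A W"
  using V W by (auto simp: HH1_submodule_iff)

lemmas VD = subspaceD[OF subs(1)] and WD = subspaceD[OF subs(2)]
lemmas decomp = is_direct_sum_pair[OF VW VD(1) WD(1)]

lemma in_fspan: "x \<in> V \<Longrightarrow> x \<in> fspan 1" "x \<in> W \<Longrightarrow> x \<in> fspan 1"
proof -
  show "x \<in> fspan 1" if "x \<in> V"
    using decomp(3)[OF that WD(2)] subsetD[OF VD(1) that] by simp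
  show "x \<in> fspan 1" if "x \<in> W"
    using decomp(3)[OF VD(2) that] subsetD[OF WD(1) that] by simp
qed

lemma V_W_disjoint: "x \<in> V \<Longrightarrow> x \<in> W \<Longrightarrow> x = \<zero>\<^bsub>A\<^esub>"
proof -
  assume x: "x \<in> V" "x \<in> W"
  have "x \<oplus>\<^bsub>A\<^esub> \<zero>\<^bsub>A\<^esub> = \<zero>\<^bsub>A\<^esub> \<oplus>\<^bsub>A\<^esub> x"
    using subsetD[OF VD(1) x(1)] by simp
  then show ?thesis
    using decomp(2)[OF x(1) WD(2) VD(2) x(2)] by blast
qed

lemma raise_V: "j \<in> {0..<int m} \<Longrightarrow> x \<in> V \<Longrightarrow> raise j s x \<in> V"
  and raise_W: "j \<in> {0..<int m} \<Longrightarrow> x \<in> W \<Longrightarrow> raise j s x \<in> W"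
  using V W raise_derivation[of j s] unfolding HH1_submodule_iff by blast+

lemma vw_closed: "j \<in> {0..<int m} \<Longrightarrow> v j \<in> carrier A" "j \<in> {0..<int m} \<Longrightarrow> w j \<in> carrier A"
  using v w VD(1) WD(1) by blast+

text \<open>\<open>raise i 1\<close> kills \<open>f_j\<close>, hence by uniqueness of decomposition
  also its component \<open>v j\<close>; but twice the coefficient in question is a coordinate of
  the image of \<open>v j\<close>.\<close>

lemma lin_other:
  assumes i: "i \<in> {0..<int m}" and j: "j \<in> {0..<int m}" and "i \<noteq> j"
  shows "lin i (v j) = 0"
proof -
  have "raise i 1 (fel j) = \<zero>\<^bsub>A\<^esub>"
    using raise_fel_pow[OF j i, of 1 1] N j \<open>i \<noteq> j\<close> by simp
  moreover have "raise i 1 (fel j) = raise i 1 (v j) \<oplus>\<^bsub>A\<^esub> raise i 1 (w j)"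
    unfolding vw[OF j] by (rule derivation_add[OF raise_derivation[OF i] vw_closed[OF j]])
  ultimately have "raise i 1 (v j) \<oplus>\<^bsub>A\<^esub> raise i 1 (w j) = \<zero>\<^bsub>A\<^esub> \<oplus>\<^bsub>A\<^esub> \<zero>\<^bsub>A\<^esub>"
    by (metis l_zero zero_closed)
  then have "raise i 1 (v j) = \<zero>\<^bsub>A\<^esub>"
    using decomp(2)[OF raise_V[OF i v[OF j]] raise_W[OF i w[OF j]] VD(2) WD(2)] by blast
  then show ?thesis
    using coord_raise_one[OF N2 i vw_closed(1)[OF j]] two by simp
qed

lemma lin_sum: "j \<in> {0..<int m} \<Longrightarrow> lin j (v j) + lin j (w j) = 1"
  using lin_fel_pow[OF N2, of j j 1] N vw[of j] vw_closed[of j]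
  by (simp add: lin_def coord_add[symmetric])

text \<open>Apply \<open>raise_top\<close> to \<open>v j\<close> and divide by the nonzero
  scalar.\<close>

lemma socle_V:
  assumes j: "j \<in> {0..<int m}" and "lin j (v j) \<noteq> 0"
  shows "fel j [^]\<^bsub>A\<^esub> N \<in> V"
proof -
  have "(2 * lin j (v j)) \<odot>\<^bsub>A\<^esub> fel j [^]\<^bsub>A\<^esub> N \<in> V"
    using raise_V[OF j v[OF j], of "N - 1"] raise_top[OF N2 j in_fspan(1)[OF v[OF j]]] by simp
  then have "(1 / (2 * lin j (v j))) \<odot>\<^bsub>A\<^esub> ((2 * lin j (v j)) \<odot>\<^bsub>A\<^esub> fel j [^]\<^bsub>A\<^esub> N) \<in> V"
    by (rule VD(4))
  then show ?thesis
    using assms two by (simp add: smult_smult)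
qed

text \<open>Without linear parts all \<open>v j\<close> lie in \<open>fspan 2\<close>. Raising the
  decompositions of the \<open>f_j\<close> then shows that \<open>V\<close>-components sit one
  filtration step deeper than expected, so \<open>V\<close> descends through the whole filtration to
  zero.\<close>

lemma V_trivial:
  assumes lin0: "\<And>j. j \<in> {0..<int m} \<Longrightarrow> lin j (v j) = 0"
  shows "V = {\<zero>\<^bsub>A\<^esub>}"
proof -
  have v2: "v j \<in> fspan 2" if j: "j \<in> {0..<int m}" for j
    by (rule fspan_two[OF N2 in_fspan(1)[OF v[OF j]]]) (use lin0[OF j] lin_other j in metis)
  have step: "V \<subseteq> fspan (Suc r)" if r: "1 \<le> r" "r \<le> N" and IH: "V \<subseteq> fspan r" for r
  proof -
    \<comment> \<open>The elements whose \<open>V\<close>-component lies one step deeper. If this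
      contains \<open>fspan r\<close>, then an element of \<open>V\<close>, being its own
      \<open>V\<close>-component, lies in \<open>fspan (Suc r)\<close>.\<close>
    let ?G = "{x \<in> carrier A. \<exists>a\<in>V \<inter> fspan (Suc r). \<exists>b\<in>W. x = a \<oplus>\<^bsub>A\<^esub> b}"
    note S = subspaceD[OF fspan_subspace[of "Suc r"]]
    have "is_subspace A ?G"
      unfolding is_subspace_iff
    proof (intro conjI ballI allI)
      show "\<zero>\<^bsub>A\<^esub> \<in> ?G"
        using VD(2) WD(2) S(2) by force
    next
      fix x y assume "x \<in> ?G" "y \<in> ?G"
      then obtain a b a' b' where ab: "a \<in> V" "a \<in> fspan (Suc r)" "b \<in> W" "x = a \<oplus>\<^bsub>A\<^esub> b"
        "a' \<in> V" "a' \<in> fspan (Suc r)" "b' \<in> W" "y = a' \<oplus>\<^bsub>A\<^esub> b'"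
        by blast
      then have cl: "a \<in> carrier A" "b \<in> carrier A" "a' \<in> carrier A" "b' \<in> carrier A"
        using VD(1) WD(1) by blast+
      have "x \<oplus>\<^bsub>A\<^esub> y = (a \<oplus>\<^bsub>A\<^esub> a') \<oplus>\<^bsub>A\<^esub> (b \<oplus>\<^bsub>A\<^esub> b')"
        using cl ab by (simp add: a_ac)
      moreover have "a \<oplus>\<^bsub>A\<^esub> a' \<in> V \<inter> fspan (Suc r)" "b \<oplus>\<^bsub>A\<^esub> b' \<in> W"
        using ab VD(3) WD(3) S(3) by blast+
      moreover have "x \<oplus>\<^bsub>A\<^esub> y \<in> carrier A"
        using ab cl by simp
      ultimately show "x \<oplus>\<^bsub>A\<^esub> y \<in> ?G"
        by blast
    next
      fix t x assume "x \<in> ?G"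
      then obtain a b where ab: "a \<in> V" "a \<in> fspan (Suc r)" "b \<in> W" "x = a \<oplus>\<^bsub>A\<^esub> b"
        by blast
      then have cl: "a \<in> carrier A" "b \<in> carrier A"
        using VD(1) WD(1) by blast+
      have "t \<odot>\<^bsub>A\<^esub> x = t \<odot>\<^bsub>A\<^esub> a \<oplus>\<^bsub>A\<^esub> t \<odot>\<^bsub>A\<^esub> b"
        using cl ab by (simp add: smult_add)
      moreover have "t \<odot>\<^bsub>A\<^esub> a \<in> V \<inter> fspan (Suc r)" "t \<odot>\<^bsub>A\<^esub> b \<in> W"
        using ab VD(4) WD(4) S(4) by blast+
      moreover have "t \<odot>\<^bsub>A\<^esub> x \<in> carrier A"
        using ab cl by simp
      ultimately show "t \<odot>\<^bsub>A\<^esub> x \<in> ?G"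
        by blast
    qed auto
    then have "fspan r \<subseteq> ?G"
    proof (rule fspan_minimal)
      fix j s assume j: "j \<in> {0..<int m}" and s: "r \<le> s" "s \<le> N"
      show "fel j [^]\<^bsub>A\<^esub> s \<in> ?G"
      proof (cases "s = 1")
        case True
        then have "v j \<in> V \<inter> fspan (Suc r)"
          using v2[OF j] v[OF j] r s by (simp add: numeral_2_eq_2)
        moreover have "fel j [^]\<^bsub>A\<^esub> s = fel j"
          using True j by simp
        ultimately show ?thesis
          using w[OF j] vw[OF j] fel_closed[OF j] by auto
      next
        case False
        then have s1: "1 \<le> s - 1"
          using s r by simp
        let ?a = "(1 / 2) \<odot>\<^bsub>A\<^esub> raise j (s - 1) (v j)" and ?b = "(1 / 2) \<odot>\<^bsub>A\<^esub> raise j (s - 1) (w j)"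
        note d = raise_derivation[OF j, of "s - 1"]
        have "raise j (s - 1) (fel j) = 2 \<odot>\<^bsub>A\<^esub> fel j [^]\<^bsub>A\<^esub> s"
          using raise_fel_pow[OF j j, of 1 "s - 1"] s1 N j s by simp
        moreover have "raise j (s - 1) (fel j) = raise j (s - 1) (v j) \<oplus>\<^bsub>A\<^esub> raise j (s - 1) (w j)"
          unfolding vw[OF j] by (rule derivation_add[OF d vw_closed[OF j]])
        ultimately have "2 \<odot>\<^bsub>A\<^esub> fel j [^]\<^bsub>A\<^esub> s = raise j (s - 1) (v j) \<oplus>\<^bsub>A\<^esub> raise j (s - 1) (w j)"
          by metis
        then have "(1 / 2) \<odot>\<^bsub>A\<^esub> (2 \<odot>\<^bsub>A\<^esub> fel j [^]\<^bsub>A\<^esub> s) = ?a \<oplus>\<^bsub>A\<^esub> ?b"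
          using smult_add derivation_closed[OF d] vw_closed[OF j] by metis
        then have eq: "fel j [^]\<^bsub>A\<^esub> s = ?a \<oplus>\<^bsub>A\<^esub> ?b"
          using two j by (simp add: smult_smult)
        have ab: "?a \<in> V" "?b \<in> W"
          using VD(4)[OF raise_V[OF j v[OF j]]] WD(4)[OF raise_W[OF j w[OF j]]] by auto
        \<comment> \<open>\<open>v j\<close> starts at level 2 rather than 1, so raising by
          \<open>s - 1\<close> reaches level \<open>s + 1\<close>, which is at least
          \<open>Suc r\<close>.\<close>
        have "raise j (s - 1) (v j) \<in> fspan (2 + (s - 1))"
          by (rule raise_fspan[OF j s1 _ v2[OF j]]) simp
        moreover have "Suc r \<le> 2 + (s - 1)"
          using s s1 by linarith
        ultimately have "?a \<in> fspan (Suc r)"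
          using fspan_antimono S(4) by blast
        moreover have "fel j [^]\<^bsub>A\<^esub> s \<in> carrier A"
          using j by simp
        ultimately show ?thesis
          using eq ab by blast
      qed
    qed
    show ?thesis
    proof
      fix x assume x: "x \<in> V"
      then obtain a b where ab: "a \<in> V" "a \<in> fspan (Suc r)" "b \<in> W" "x = a \<oplus>\<^bsub>A\<^esub> b"
        using IH \<open>fspan r \<subseteq> ?G\<close> by blast
      have "x \<oplus>\<^bsub>A\<^esub> \<zero>\<^bsub>A\<^esub> = a \<oplus>\<^bsub>A\<^esub> b"
        using ab subsetD[OF VD(1) x] by simp
      then have "x = a"
        using decomp(2)[OF x WD(2) ab(1,3)] by blast
      then show "x \<in> fspan (Suc r)"
        using ab(2) by simp
    qed
  qed
  have "V \<subseteq> fspan (Suc r)" if "r \<le> N" for r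
    using that
  proof (induction r)
    case 0
    then show ?case
      using in_fspan by auto
  next
    case (Suc r)
    then show ?case
      using step[of "Suc r"] by simp
  qed
  then show ?thesis
    using fspan_top VD(2) by blast
qed

end

context zigzag
begin

lemma fspan_splitting_swap:
  assumes "fspan_splitting A N m coord V W v w"
  shows "fspan_splitting A N m coord W V w v"
proof -
  interpret fspan_splitting A N m coord V W v w
    using assms .
  show ?thesis
  proof unfold_locales
    show "is_direct_sum A (fspan 1) [W, V]"
      using is_direct_sum_commute[OF VW VD(1) WD(1)] .
    show "fel j = w j \<oplus> v j" if "j \<in> {0..<int m}" for j
      using vw[OF that] vw_closed[OF that] a_comm by simp
  qed (use N2 V W v w in auto)
qed

text \<open>\<open>?S\<close> collects the indices for which \<open>f_j^N\<close> is shown to lie in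
  \<open>V\<close>; for the others it lies in \<open>W\<close>. The alternating relation forces
  \<open>?S\<close> to be invariant under \<open>nx\<close>, hence empty or everything, and
  \<open>V_trivial\<close> for the appropriate summand finishes.\<close>

lemma HH1_indecomposable_fspan_one:
  assumes N2: "N \<ge> 2"
  shows "HH1_indecomposable A (fspan 1)"
  unfolding HH1_indecomposable_def
proof (intro conjI allI impI)
  show "HH1_submodule A (fspan 1)"
    by (rule HH1_submodule_fspan_one)
  have 0: "0 \<in> Vt"
    using m by simp
  show "fspan 1 \<noteq> {\<zero>}"
    using fspan_gen[OF 0, of 1 1] lin_fel_pow[OF N2 0 0, of 1] N by (force simp: lin_def)
  fix V W assume VW: "HH1_submodule A V \<and> HH1_submodule A W \<and> is_direct_sum A (fspan 1) [V, W]"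
  then have "is_subspace A V" "is_subspace A W"
    by (auto simp: HH1_submodule_iff)
  note cl = this[THEN subspaceD(1)]
  have "\<forall>j\<in>Vt. \<exists>a b. a \<in> V \<and> b \<in> W \<and> fel j = a \<oplus> b"
  proof
    fix j assume j: "j \<in> Vt"
    have "fel j \<in> fspan 1"
      using fspan_gen[OF j, of 1 1] j by simp
    then show "\<exists>a b. a \<in> V \<and> b \<in> W \<and> fel j = a \<oplus> b"
      using is_direct_sum_pair_decompose[OF _ cl] VW by blast
  qed
  then obtain v w where vw: "\<And>j. j \<in> Vt \<Longrightarrow> v j \<in> V \<and> w j \<in> W \<and> fel j = v j \<oplus> w j"
    by metis
  interpret fspan_splitting A N m coord V W v w
    by unfold_locales (use VW vw N2 in auto)
  interpret swap: fspan_splitting A N m coord W V w v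
    using fspan_splitting_swap fspan_splitting_axioms .
  let ?S = "{j \<in> Vt. lin j (v j) \<noteq> 0}"
  have W_socle: "fel j [^] N \<in> W" if "j \<in> Vt - ?S" for j
    using swap.socle_V[of j] lin_sum[of j] that by auto
  \<comment> \<open>Both linear parts cannot be nonzero, since the nonzero element
    \<open>f_j^N\<close> would lie in both summands; both cannot vanish, since they add up to
    1.\<close>
  have S_dichotomy: "j \<in> ?S \<longleftrightarrow> lin j (w j) = 0" if j: "j \<in> Vt" for j
  proof
    assume "j \<in> ?S"
    then have "fel j [^] N \<in> V"
      using socle_V[OF j] by simp
    moreover have "fel j [^] N \<noteq> \<zero>"
      using coord_fel_pow[OF j, of N j True "2 * N"] N j by force
    ultimately have "fel j [^] N \<notin> W"
      using V_W_disjoint by blast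
    then show "lin j (w j) = 0"
      using swap.socle_V[OF j] by blast
  next
    assume "lin j (w j) = 0"
    then show "j \<in> ?S"
      using lin_sum[OF j] j by simp
  qed
  \<comment> \<open>The part of the alternating relation supported on \<open>?S\<close>. It lies in
    \<open>V\<close>, and as the negative of the complementary part also in \<open>W\<close>, so it
    vanishes.\<close>
  define p where "p b = (\<Sum>j\<in>?S. alt_sign j * coord (fel j [^] N) b)" for b
  have p0: "p b = 0" if "b \<notin> B" for b
    unfolding p_def using coord_outside[OF _ that] by (intro sum.neutral) auto
  note p = elt_closed[of p, OF p0] coord_elt[of p, OF p0]
  have coord_p: "coord (elt p) b = (\<Sum>j\<in>?S. alt_sign j * coord (fel j [^] N) b)" for b
    using fun_cong[OF p(2), of b] p_def[of b] by (rule trans)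
  have fin: "finite ?S" "finite (Vt - ?S)"
    by (rule finite_subset[of _ Vt]; auto)+
  have "elt p \<in> V"
  proof (rule subspace_combination[OF subs(1) fin(1) _ p(1)])
    show "coord (elt p) b = (\<Sum>j\<in>?S. alt_sign j * coord (fel j [^] N) b)" for b
      by (rule coord_p)
  qed (use socle_V in blast)
  moreover have "elt p \<in> W"
  proof (rule subspace_combination[OF subs(2) fin(2) _ p(1)])
    fix b assume b: "b \<in> B"
    have "(\<Sum>j\<in>Vt. alt_sign j * coord (fel j [^] N) b) = 0"
      using alternating_relation b by (cases b) simp
    moreover have "Vt = ?S \<union> (Vt - ?S)"
      by auto
    ultimately have "p b + (\<Sum>j\<in>Vt - ?S. alt_sign j * coord (fel j [^] N) b) = 0"
      unfolding p_def
      using sum.union_disjoint[OF fin, of "\<lambda>j. alt_sign j * coord (fel j [^] N) b"] by auto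
    then show "coord (elt p) b = (\<Sum>j\<in>Vt - ?S. (- alt_sign j) * coord (fel j [^] N) b)"
      unfolding coord_p p_def by (simp add: sum_negf eq_neg_iff_add_eq_0)
  qed (use W_socle in blast)
  ultimately have "elt p = \<zero>"
    using V_W_disjoint by blast
  then have p_zero: "p b = 0" for b
    using p(2) coord_zero by metis
  \<comment> \<open>Only \<open>f_u^N\<close> and \<open>f_(nx u)^N\<close> involve
    \<open>eps_(nx u)\<close>, with opposite signs in the relation; the coefficient vanishes only if
    both indices are in \<open>?S\<close> or neither is.\<close>
  have S_nx: "nx u \<in> ?S \<longleftrightarrow> u \<in> ?S" if u: "u \<in> Vt" for u
  proof -
    have "p (nx u, True, 2 * N) = (\<Sum>j\<in>?S. (if j = nx u then alt_sign (nx u) else 0) + (if j = u then alt_sign u else 0))"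
      unfolding p_def using N u by (intro sum.cong) (auto simp: coord_fel_pow)
    also have "\<dots> = (if nx u \<in> ?S then alt_sign (nx u) else 0) + (if u \<in> ?S then alt_sign u else 0)"
      unfolding sum.distrib using fin(1) by (subst (1 2) sum.delta) auto
    also have "\<dots> = alt_sign u * ((if u \<in> ?S then 1 else 0) - (if nx u \<in> ?S then 1 else 0))"
      unfolding alt_sign_nx[OF u] by simp
    finally have "alt_sign u * ((if u \<in> ?S then 1 else 0) - (if nx u \<in> ?S then 1 else 0)) = (0::'k)"
      using p_zero by metis
    then show ?thesis
      by (auto simp: alt_sign_def split: if_splits)
  qed
  have all: "u \<in> ?S \<longleftrightarrow> 0 \<in> ?S" if "u \<in> Vt" for u
    using that by (rule vt_induct) (use S_nx in blast)+
  show "V = {\<zero>} \<or> W = {\<zero>}"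
  proof (cases "0 \<in> ?S")
    case True
    then show ?thesis
      using swap.V_trivial S_dichotomy all by blast
  next
    case False
    then show ?thesis
      using V_trivial all by blast
  qed
qed

end


section \<open>Path algebras\<close>

definition comp_single ::
    "('v, 'a) qpath \<Rightarrow> ('v, 'a) qpath \<Rightarrow> 'k::field \<Rightarrow> (('v, 'a) qpath \<Rightarrow>\<^sub>0 'k)" where
  "comp_single x y c = (case qpath_comp x y of None \<Rightarrow> 0 | Some z \<Rightarrow> Poly_Mapping.single z c)"

lemma comp_single_zero [simp]: "comp_single x y 0 = 0"
  by (auto simp: comp_single_def split: option.split)

lemma comp_single_add: "comp_single x y (c + d) = comp_single x y c + comp_single x y d"
  by (auto simp: comp_single_def single_add split: option.split)

lemma path_algebra_simps [simp]:
  "carrier (path_algebra G) = {f. Poly_Mapping.keys f \<subseteq> qpaths G}"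
  "zero (path_algebra G) = 0"
  "add (path_algebra G) = (+)"
  "one (path_algebra G) = (\<Sum>v \<in> verts G. Poly_Mapping.single (v, [], v) 1)"
  "module.smult (path_algebra G) = (\<lambda>c. Poly_Mapping.map ((*) c))"
  by (simp_all add: path_algebra_def)

lemma path_algebra_mult:
  "f \<otimes>\<^bsub>path_algebra G\<^esub> g = (\<Sum>x \<in> Poly_Mapping.keys f. \<Sum>y \<in> Poly_Mapping.keys g.
     comp_single x y (Poly_Mapping.lookup f x * Poly_Mapping.lookup g y))"
  by (simp add: path_algebra_def comp_single_def)

text \<open>The support of a sum can shrink by cancellation; summing over common finite supersets
  makes distributivity a termwise identity.\<close>

lemma path_algebra_mult_superset:
  assumes "finite S" "finite T" "Poly_Mapping.keys f \<subseteq> S" "Poly_Mapping.keys g \<subseteq> T"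
  shows "f \<otimes>\<^bsub>path_algebra G\<^esub> g =
    (\<Sum>x \<in> S. \<Sum>y \<in> T. comp_single x y (Poly_Mapping.lookup f x * Poly_Mapping.lookup g y))"
  unfolding path_algebra_mult
proof (rule sum.mono_neutral_cong_left[OF assms(1,3)])
  show "\<forall>x\<in>S - Poly_Mapping.keys f.
      (\<Sum>y \<in> T. comp_single x y (Poly_Mapping.lookup f x * Poly_Mapping.lookup g y)) = 0"
    by (auto simp: in_keys_iff)
  show "(\<Sum>y \<in> Poly_Mapping.keys g. comp_single x y (Poly_Mapping.lookup f x * Poly_Mapping.lookup g y))
      = (\<Sum>y \<in> T. comp_single x y (Poly_Mapping.lookup f x * Poly_Mapping.lookup g y))" for x
    by (rule sum.mono_neutral_left[OF assms(2,4)]) (auto simp: in_keys_iff)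
qed

lemma path_algebra_mult_single:
  "Poly_Mapping.single x a \<otimes>\<^bsub>path_algebra G\<^esub> Poly_Mapping.single y b = comp_single x y (a * b)"
  by (subst path_algebra_mult_superset[of "{x}" "{y}"]) (auto simp: lookup_single)

lemma path_algebra_l_distr:
  "(f + f') \<otimes>\<^bsub>path_algebra G\<^esub> g = f \<otimes>\<^bsub>path_algebra G\<^esub> g + f' \<otimes>\<^bsub>path_algebra G\<^esub> g"
proof -
  let ?S = "Poly_Mapping.keys f \<union> Poly_Mapping.keys f'" and ?T = "Poly_Mapping.keys g"
  have "Poly_Mapping.keys (f + f') \<subseteq> ?S"
    by (rule keys_add)
  then show ?thesis
    by (subst (1 2 3) path_algebra_mult_superset[of ?S ?T])
      (auto simp: lookup_add distrib_right comp_single_add sum.distrib)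
qed

lemma path_algebra_r_distr:
  "g \<otimes>\<^bsub>path_algebra G\<^esub> (f + f') = g \<otimes>\<^bsub>path_algebra G\<^esub> f + g \<otimes>\<^bsub>path_algebra G\<^esub> f'"
proof -
  let ?S = "Poly_Mapping.keys f \<union> Poly_Mapping.keys f'" and ?T = "Poly_Mapping.keys g"
  have "Poly_Mapping.keys (f + f') \<subseteq> ?S"
    by (rule keys_add)
  then show ?thesis
    by (subst (1 2 3) path_algebra_mult_superset[of ?T ?S])
      (auto simp: lookup_add distrib_left comp_single_add sum.distrib)
qed

lemma path_algebra_mult_zero [simp]:
  "0 \<otimes>\<^bsub>path_algebra G\<^esub> g = 0" "g \<otimes>\<^bsub>path_algebra G\<^esub> 0 = 0"
  by (simp_all add: path_algebra_mult)

lemma poly_mapping_sum_single: "f = (\<Sum>x \<in> Poly_Mapping.keys f. Poly_Mapping.single x (Poly_Mapping.lookup f x))"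
proof (rule poly_mapping_eqI)
  fix z
  have "(\<Sum>x \<in> Poly_Mapping.keys f. if x = z then Poly_Mapping.lookup f z else 0) = Poly_Mapping.lookup f z"
    by (simp add: in_keys_iff)
  moreover have "Poly_Mapping.lookup (\<Sum>x \<in> Poly_Mapping.keys f. Poly_Mapping.single x (Poly_Mapping.lookup f x)) z
      = (\<Sum>x \<in> Poly_Mapping.keys f. if x = z then Poly_Mapping.lookup f z else 0)"
    unfolding lookup_sum by (rule sum.cong) (auto simp: lookup_single)
  ultimately show "Poly_Mapping.lookup f z
      = Poly_Mapping.lookup (\<Sum>x \<in> Poly_Mapping.keys f. Poly_Mapping.single x (Poly_Mapping.lookup f x)) z"
    by simp
qed

text \<open>Reduces identities to monomials. Only monomials in the support of \<open>f\<close> are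
  asked for, which matters for the unit laws: they hold on actual paths of the quiver, not on
  arbitrary triples.\<close>

lemma additive_eqI:
  fixes L R :: "('i \<Rightarrow>\<^sub>0 'k::field) \<Rightarrow> ('j \<Rightarrow>\<^sub>0 'k)"
  assumes add: "\<And>f g. L (f + g) = L f + L g" "\<And>f g. R (f + g) = R f + R g"
    and single: "\<And>x c. x \<in> Poly_Mapping.keys f \<Longrightarrow> L (Poly_Mapping.single x c) = R (Poly_Mapping.single x c)"
  shows "L f = R f"
proof -
  have zero: "L 0 = 0" "R 0 = 0"
    using add(1)[of 0 0] add(2)[of 0 0] by simp_all
  have "L (\<Sum>x\<in>S. Poly_Mapping.single x (c x)) = R (\<Sum>x\<in>S. Poly_Mapping.single x (c x))"
    if "S \<subseteq> Poly_Mapping.keys f" for S c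
    using finite_subset[OF that finite_keys] that
    by (induction S rule: finite_induct) (auto simp: zero add single)
  from this[OF order.refl, of "Poly_Mapping.lookup f"] show ?thesis
    by (simp flip: poly_mapping_sum_single)
qed

lemma path_algebra_assoc:
  fixes f g h :: "('v, 'a) qpath \<Rightarrow>\<^sub>0 'k::field"
  shows "f \<otimes>\<^bsub>path_algebra G\<^esub> g \<otimes>\<^bsub>path_algebra G\<^esub> h = f \<otimes>\<^bsub>path_algebra G\<^esub> (g \<otimes>\<^bsub>path_algebra G\<^esub> h)"
proof (rule additive_eqI[where f = f])
  fix x :: "('v, 'a) qpath" and a :: 'k
  let ?x = "Poly_Mapping.single x a"
  show "?x \<otimes>\<^bsub>path_algebra G\<^esub> g \<otimes>\<^bsub>path_algebra G\<^esub> h = ?x \<otimes>\<^bsub>path_algebra G\<^esub> (g \<otimes>\<^bsub>path_algebra G\<^esub> h)"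
  proof (rule additive_eqI[where f = g])
    fix y :: "('v, 'a) qpath" and b :: 'k
    let ?y = "Poly_Mapping.single y b"
    show "?x \<otimes>\<^bsub>path_algebra G\<^esub> ?y \<otimes>\<^bsub>path_algebra G\<^esub> h = ?x \<otimes>\<^bsub>path_algebra G\<^esub> (?y \<otimes>\<^bsub>path_algebra G\<^esub> h)"
    proof (rule additive_eqI[where f = h])
      fix z :: "('v, 'a) qpath" and c :: 'k
      let ?z = "Poly_Mapping.single z c"
      obtain u p v u' p' v' u'' p'' v'' where xyz: "x = (u, p, v)" "y = (u', p', v')" "z = (u'', p'', v'')"
        by (metis surj_pair)
      show "?x \<otimes>\<^bsub>path_algebra G\<^esub> ?y \<otimes>\<^bsub>path_algebra G\<^esub> ?z = ?x \<otimes>\<^bsub>path_algebra G\<^esub> (?y \<otimes>\<^bsub>path_algebra G\<^esub> ?z)"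
        unfolding path_algebra_mult_single comp_single_def
        by (auto simp: xyz path_algebra_mult_single comp_single_def mult.assoc)
    qed (simp_all add: path_algebra_r_distr)
  qed (simp_all add: path_algebra_r_distr path_algebra_l_distr)
qed (simp_all add: path_algebra_l_distr)

lemma keys_neg: "Poly_Mapping.keys (- f) = Poly_Mapping.keys (f :: 'i \<Rightarrow>\<^sub>0 'k::field)"
  by (auto simp: in_keys_iff)

lemma (in wf_digraph) qpath_comp_closed:
  assumes "x \<in> qpaths G" "y \<in> qpaths G" "qpath_comp x y = Some z"
  shows "z \<in> qpaths G"
proof -
  obtain u p v u' p' v' where xy: "x = (u, p, v)" "y = (u', p', v')"
    by (metis surj_pair)
  then show ?thesis
    using assms awalk_appendI[of u p v p' v'] by (auto simp: qpaths_def split: if_splits)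
qed

lemma (in wf_digraph) path_algebra_mult_closed:
  assumes "Poly_Mapping.keys f \<subseteq> qpaths G" "Poly_Mapping.keys g \<subseteq> qpaths G"
  shows "Poly_Mapping.keys (f \<otimes>\<^bsub>path_algebra G\<^esub> g) \<subseteq> qpaths G"
proof -
  have "Poly_Mapping.keys (comp_single x y c) \<subseteq> qpaths G"
    if "x \<in> Poly_Mapping.keys f" "y \<in> Poly_Mapping.keys g" for x y c
  proof (cases "qpath_comp x y")
    case (Some z)
    then have "z \<in> qpaths G"
      using qpath_comp_closed that assms by blast
    then show ?thesis
      using Some by (simp add: comp_single_def)
  qed (simp add: comp_single_def)
  then have inner: "Poly_Mapping.keys (\<Sum>y \<in> Poly_Mapping.keys g.
      comp_single x y (Poly_Mapping.lookup f x * Poly_Mapping.lookup g y)) \<subseteq> qpaths G"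
    if "x \<in> Poly_Mapping.keys f" for x
    using that by (intro order.trans[OF keys_sum] UN_least)
  show ?thesis
    unfolding path_algebra_mult by (rule order.trans[OF keys_sum UN_least], rule inner)
qed

lemma (in wf_digraph) path_algebra_l_one:
  assumes "finite (verts G)" "Poly_Mapping.keys f \<subseteq> qpaths G"
  shows "\<one>\<^bsub>path_algebra G\<^esub> \<otimes>\<^bsub>path_algebra G\<^esub> f = f"
proof (rule additive_eqI[where f = f])
  fix x c assume "x \<in> Poly_Mapping.keys f"
  then obtain u p v where x: "x = (u, p, v)" and u: "u \<in> verts G"
    using assms(2) by (auto simp: qpaths_def awalk_def)
  have *: "(\<Sum>w\<in>S. Poly_Mapping.single (w, [], w) 1) \<otimes>\<^bsub>path_algebra G\<^esub> Poly_Mapping.single x c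
    = (\<Sum>w\<in>S. if w = u then Poly_Mapping.single x c else 0)" if "finite S" for S
    using that by (induction S) (auto simp: path_algebra_l_distr path_algebra_mult_single comp_single_def x)
  show "\<one>\<^bsub>path_algebra G\<^esub> \<otimes>\<^bsub>path_algebra G\<^esub> Poly_Mapping.single x c = Poly_Mapping.single x c"
    using *[OF assms(1)] u assms(1) by simp
qed (simp_all add: path_algebra_r_distr)

lemma (in wf_digraph) path_algebra_r_one:
  assumes "finite (verts G)" "Poly_Mapping.keys f \<subseteq> qpaths G"
  shows "f \<otimes>\<^bsub>path_algebra G\<^esub> \<one>\<^bsub>path_algebra G\<^esub> = f"
proof (rule additive_eqI[where f = f])
  fix x c assume "x \<in> Poly_Mapping.keys f"
  then obtain u p v where x: "x = (u, p, v)" and v: "v \<in> verts G"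
    using assms(2) by (auto simp: qpaths_def dest!: subsetD)
  have *: "Poly_Mapping.single x c \<otimes>\<^bsub>path_algebra G\<^esub> (\<Sum>w\<in>S. Poly_Mapping.single (w, [], w) 1)
    = (\<Sum>w\<in>S. if w = v then Poly_Mapping.single x c else 0)" if "finite S" for S
    using that by (induction S) (auto simp: path_algebra_r_distr path_algebra_mult_single comp_single_def x)
  show "Poly_Mapping.single x c \<otimes>\<^bsub>path_algebra G\<^esub> \<one>\<^bsub>path_algebra G\<^esub> = Poly_Mapping.single x c"
    using *[OF assms(1)] v assms(1) by simp
qed (simp_all add: path_algebra_l_distr)

lemma (in wf_digraph) path_algebra_ring:
  assumes fin: "finite (verts G)"
  shows "ring (path_algebra G :: ('k::field, ('a, 'b) qpath \<Rightarrow>\<^sub>0 'k) module)"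
proof (rule ringI)
  show "abelian_group (path_algebra G :: ('k, ('a, 'b) qpath \<Rightarrow>\<^sub>0 'k) module)"
  proof (rule abelian_groupI)
    fix x :: "('a, 'b) qpath \<Rightarrow>\<^sub>0 'k" assume "x \<in> carrier (path_algebra G)"
    then show "\<exists>y\<in>carrier (path_algebra G). y \<oplus>\<^bsub>path_algebra G\<^esub> x = \<zero>\<^bsub>path_algebra G\<^esub>"
      by (intro bexI[of _ "- x"]) (auto simp: keys_neg)
  qed (use keys_add in \<open>fastforce simp: algebra_simps\<close>)+
  have "(\<Union>v\<in>verts G. Poly_Mapping.keys (Poly_Mapping.single (v, [], v) (1::'k))) \<subseteq> qpaths G"
    by (auto simp: qpaths_def awalk_Nil_iff)
  then have one: "Poly_Mapping.keys (\<Sum>v\<in>verts G. Poly_Mapping.single (v, [], v) (1::'k)) \<subseteq> qpaths G"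
    using keys_sum by (rule order.trans[rotated])
  show "monoid (path_algebra G :: ('k, ('a, 'b) qpath \<Rightarrow>\<^sub>0 'k) module)"
  proof (rule monoidI)
    show "\<one>\<^bsub>path_algebra G\<^esub> \<in> carrier (path_algebra G :: ('k, ('a, 'b) qpath \<Rightarrow>\<^sub>0 'k) module)"
      using one by simp
    fix x y z :: "('a, 'b) qpath \<Rightarrow>\<^sub>0 'k"
    assume x: "x \<in> carrier (path_algebra G)"
    then show "\<one>\<^bsub>path_algebra G\<^esub> \<otimes>\<^bsub>path_algebra G\<^esub> x = x" "x \<otimes>\<^bsub>path_algebra G\<^esub> \<one>\<^bsub>path_algebra G\<^esub> = x"
      using path_algebra_l_one[OF fin] path_algebra_r_one[OF fin] by (metis mem_Collect_eq path_algebra_simps(1))+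
    assume "y \<in> carrier (path_algebra G)"
    then show "x \<otimes>\<^bsub>path_algebra G\<^esub> y \<in> carrier (path_algebra G)"
      using x path_algebra_mult_closed by simp
    show "x \<otimes>\<^bsub>path_algebra G\<^esub> y \<otimes>\<^bsub>path_algebra G\<^esub> z = x \<otimes>\<^bsub>path_algebra G\<^esub> (y \<otimes>\<^bsub>path_algebra G\<^esub> z)"
      by (rule path_algebra_assoc)
  qed
qed (simp_all add: path_algebra_l_distr path_algebra_r_distr)

lemma ring_extend_ring:
  assumes "ring R"
  shows "ring (ring.extend R e)"
proof -
  interpret ring R
    by fact
  have simps: "carrier (ring.extend R e) = carrier R" "monoid.mult (ring.extend R e) = monoid.mult R"
    "one (ring.extend R e) = one R" "zero (ring.extend R e) = zero R" "add (ring.extend R e) = add R"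
    by (simp_all add: ring.extend_def)
  show ?thesis
  proof (rule ringI)
    show "abelian_group (ring.extend R e)"
      by (rule abelian_groupI) (auto simp: simps a_assoc intro: a_comm l_neg bexI[of _ "\<ominus>\<^bsub>R\<^esub> _"])
    show "monoid (ring.extend R e)"
      by (rule monoidI) (auto simp: simps m_assoc)
  qed (auto simp: simps l_distr r_distr)
qed


section \<open>The defining ideal of \<open>A\<close>\<close>

fun is_fwd :: "arrow \<Rightarrow> bool" where
  "is_fwd (Fwd i) = True"
| "is_fwd (Bwd i) = False"

definition alternating :: "arrow list \<Rightarrow> bool" where
  "alternating p \<longleftrightarrow> successively (\<lambda>e e'. is_fwd e \<noteq> is_fwd e') p"

text \<open>The basis word that a path becomes in \<open>A\<close>, with \<open>None\<close> for a
  path that becomes 0. The end vertex is dropped, since for a path of the quiver it is determined by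
  the rest.\<close>

definition path_class :: "nat \<Rightarrow> (int, arrow) qpath \<Rightarrow> (int \<times> bool \<times> nat) option" where
  "path_class N = (\<lambda>(u, p, v). if alternating p \<and> length p \<le> 2 * N
     then Some (zz_canon N (u, p = [] \<or> is_fwd (hd p), length p)) else None)"

text \<open>The quotient map to \<open>A\<close> in coordinates, defined on the path algebra before
  anything is known about the ideal.\<close>

definition class_coord :: "nat \<Rightarrow> 'k::field pathalg \<Rightarrow> int \<times> bool \<times> nat \<Rightarrow> 'k" where
  "class_coord N f b = (\<Sum>x \<in> Poly_Mapping.keys f.
     if path_class N x = Some b then Poly_Mapping.lookup f x else 0)"

lemma alternating_Nil [simp]: "alternating []"
  by (simp add: alternating_def)

lemma alternating_Cons:
  "alternating (e # p) \<longleftrightarrow> p = [] \<or> is_fwd e \<noteq> is_fwd (hd p) \<and> alternating p"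
  by (auto simp: alternating_def successively_Cons)

lemma alternating_append:
  "alternating (p @ q) \<longleftrightarrow>
     alternating p \<and> alternating q \<and> (p = [] \<or> q = [] \<or> is_fwd (last p) \<noteq> is_fwd (hd q))"
  by (auto simp: alternating_def successively_append_iff)

lemma is_fwd_last:
  "alternating p \<Longrightarrow> p \<noteq> [] \<Longrightarrow> is_fwd (last p) = (is_fwd (hd p) = odd (length p))"
  by (induction p) (auto simp: alternating_Cons)

lemma not_alternatingE:
  assumes "\<not> alternating p"
  obtains p1 e e' p2 where "p = p1 @ [e, e'] @ p2" "is_fwd e = is_fwd e'"
  using assms
proof (induction p arbitrary: thesis)
  case (Cons e p)
  show ?case
  proof (cases "alternating p")
    case True
    then obtain e' p2 where "p = e' # p2" "is_fwd e = is_fwd e'"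
      using Cons.prems(2) by (cases p) (auto simp: alternating_Cons)
    then show ?thesis
      using Cons.prems(1)[of "[]" e e' p2] by simp
  next
    case False
    then obtain p1 f f' p2 where "p = p1 @ [f, f'] @ p2" "is_fwd f = is_fwd f'"
      using Cons.IH by blast
    then show ?thesis
      using Cons.prems(1)[of "e # p1" f f' p2] by simp
  qed
qed simp

lemma class_coord_superset:
  assumes "finite S" "Poly_Mapping.keys f \<subseteq> S"
  shows "class_coord N f b = (\<Sum>x \<in> S. if path_class N x = Some b then Poly_Mapping.lookup f x else 0)"
  unfolding class_coord_def
  by (rule sum.mono_neutral_left[OF assms]) (auto simp: in_keys_iff)

lemma class_coord_add: "class_coord N (f + g) b = class_coord N f b + class_coord N g b"
proof -
  let ?S = "Poly_Mapping.keys f \<union> Poly_Mapping.keys g"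
  have "Poly_Mapping.keys (f + g) \<subseteq> ?S"
    by (rule keys_add)
  then show ?thesis
    by (subst (1 2 3) class_coord_superset[of ?S])
      (auto simp: lookup_add sum.distrib[symmetric] intro!: sum.cong)
qed

lemma class_coord_zero [simp]: "class_coord N 0 b = 0"
  by (simp add: class_coord_def)

lemma class_coord_single [simp]:
  "class_coord N (Poly_Mapping.single x c) b = (if path_class N x = Some b then c else 0)"
  by (subst class_coord_superset[of "{x}"]) auto

lemma class_coord_neg: "class_coord N (- f) b = - class_coord N f b"
  using class_coord_add[of N f "- f" b] by (simp add: eq_neg_iff_add_eq_0 add.commute)

lemma class_coord_sum: "class_coord N (\<Sum>i\<in>I. f i) b = (\<Sum>i\<in>I. class_coord N (f i) b)"
  by (induction I rule: infinite_finite_induct) (auto simp: class_coord_add)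

lemma lookup_map_mult: "Poly_Mapping.lookup (Poly_Mapping.map ((*) c) f) x = c * Poly_Mapping.lookup f x"
  for c :: "'k::field"
  by (simp add: Poly_Mapping.map.rep_eq when_def)

lemma class_coord_smult: "class_coord N (Poly_Mapping.map ((*) c) f) b = c * class_coord N f b"
proof -
  have "Poly_Mapping.keys (Poly_Mapping.map ((*) c) f) \<subseteq> Poly_Mapping.keys f"
    by (auto simp: in_keys_iff lookup_map_mult)
  then show ?thesis
    by (subst class_coord_superset[of "Poly_Mapping.keys f"])
      (auto simp: class_coord_def lookup_map_mult sum_distrib_left intro!: sum.cong)
qed

locale zigzag_quiver =
  fixes N m :: nat
  assumes N: "N \<ge> 1" and m: "m \<ge> 3"
begin

abbreviation Q where "Q \<equiv> cyc_quiver m"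

lemma cyc_quiver_simps [simp]:
  "verts Q = {0..<int m}"
  "Fwd i \<in> arcs Q \<longleftrightarrow> i \<in> {0..<int m}"
  "Bwd i \<in> arcs Q \<longleftrightarrow> i \<in> {0..<int m}"
  "tail Q (Fwd i) = i" "tail Q (Bwd i) = (i + 1) mod int m"
  "head Q (Fwd i) = (i + 1) mod int m" "head Q (Bwd i) = i"
  by (auto simp: cyc_quiver_def)

sublocale wf_digraph Q
proof
  fix e assume "e \<in> arcs Q"
  then show "tail Q e \<in> verts Q" "head Q e \<in> verts Q"
    using m by (cases e; auto)+
qed

lemma kQ_ring: "ring (kQ m :: ('k::field, 'k pathalg) module)"
  by (rule path_algebra_ring) simp

lemma qpaths_start: "(u, p, v) \<in> qpaths Q \<Longrightarrow> u \<in> {0..<int m}"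
  by (auto simp: qpaths_def awalk_def)

lemma qpaths_Nil: "(u, [], v) \<in> qpaths Q \<longleftrightarrow> u = v \<and> u \<in> {0..<int m}"
  by (auto simp: qpaths_def awalk_Nil_iff)

lemma qpaths_Cons:
  "(u, e # p, v) \<in> qpaths Q \<longleftrightarrow> e \<in> arcs Q \<and> u = tail Q e \<and> (head Q e, p, v) \<in> qpaths Q"
  by (auto simp: qpaths_def awalk_Cons_iff)

lemma qpaths_append:
  "(u, p @ q, v) \<in> qpaths Q \<longleftrightarrow> (\<exists>w. (u, p, w) \<in> qpaths Q \<and> (w, q, v) \<in> qpaths Q)"
proof (induction p arbitrary: u)
  case Nil
  then show ?case
    using qpaths_start by (auto simp: qpaths_Nil)
qed (auto simp: qpaths_Cons)

section \<open>Alternating paths in the quiver\<close>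

text \<open>The unique arrow leaving \<open>u\<close> in the given direction; the shift occurs
  because \<open>Bwd i\<close> starts at \<open>i + 1\<close>.\<close>

definition arrow_at :: "int \<Rightarrow> bool \<Rightarrow> arrow" where
  "arrow_at u d = (if d then Fwd u else Bwd ((u - 1) mod int m))"

lemma arrow_at:
  assumes "u \<in> {0..<int m}"
  shows "arrow_at u d \<in> arcs Q" "tail Q (arrow_at u d) = u" "is_fwd (arrow_at u d) = d"
    "head Q (arrow_at u d) = (if d then (u + 1) mod int m else (u - 1) mod int m)"
  using assms m by (auto simp: arrow_at_def mod_add_left_eq)

lemma arc_eq_arrow_at:
  assumes "e \<in> arcs Q"
  shows "e = arrow_at (tail Q e) (is_fwd e)"
  using assms by (cases e) (auto simp: arrow_at_def mod_diff_left_eq)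

lemma zz_end_Suc:
  assumes "u \<in> {0..<int m}"
  shows "zz_end m (u, d, Suc l) = zz_end m (if d then (u + 1) mod int m else (u - 1) mod int m, \<not> d, l)"
  using assms by (auto simp: zz_end_def mod_diff_left_eq mod_add_left_eq)

lemma zz_end_0: "zz_end m (u, d, 0) = u"
  by (simp add: zz_end_def)

lemma alternating_end:
  assumes "(u, p, v) \<in> qpaths Q" "alternating p" "p \<noteq> [] \<Longrightarrow> is_fwd (hd p) = d"
  shows "v = zz_end m (u, d, length p)"
  using assms
proof (induction p arbitrary: u d)
  case Nil
  then show ?case
    by (simp add: qpaths_Nil zz_end_0)
next
  case (Cons e p)
  have e: "e \<in> arcs Q" "u = tail Q e" "(head Q e, p, v) \<in> qpaths Q" "is_fwd e = d"
    using Cons.prems by (auto simp: qpaths_Cons)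
  have u: "u \<in> {0..<int m}"
    using Cons.prems(1) by (rule qpaths_start)
  have "head Q e = (if d then (u + 1) mod int m else (u - 1) mod int m)"
    using arrow_at(4)[OF u, of d] arc_eq_arrow_at[OF e(1)] e(2,4) by simp
  moreover have "v = zz_end m (head Q e, \<not> d, length p)"
    using Cons.prems e by (intro Cons.IH) (auto simp: alternating_Cons)
  ultimately show ?case
    unfolding length_Cons zz_end_Suc[OF u] by simp
qed

text \<open>Each vertex has exactly one outgoing arrow in each direction, so the first direction and
  the length determine every step.\<close>

lemma alternating_unique:
  assumes "(u, p, v) \<in> qpaths Q" "(u, p', v') \<in> qpaths Q" "alternating p" "alternating p'"
    "length p = length p'" "p \<noteq> [] \<Longrightarrow> is_fwd (hd p) = is_fwd (hd p')"
  shows "p = p'"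
  using assms
proof (induction p arbitrary: u p')
  case (Cons e p)
  then obtain f q where p': "p' = f # q"
    by (cases p') auto
  have e: "e \<in> arcs Q" "u = tail Q e" "(head Q e, p, v) \<in> qpaths Q"
    and f: "f \<in> arcs Q" "u = tail Q f" "(head Q f, q, v') \<in> qpaths Q"
    using Cons.prems(1,2) unfolding p' qpaths_Cons by auto
  have "is_fwd e = is_fwd f"
    using Cons.prems(6) p' by simp
  then have "e = f"
    using arc_eq_arrow_at[OF e(1)] arc_eq_arrow_at[OF f(1)] e(2) f(2) by simp
  moreover have "p = q"
  proof (rule Cons.IH[OF e(3)])
    show "(head Q e, q, v') \<in> qpaths Q"
      using f \<open>e = f\<close> by simp
  qed (use Cons.prems p' \<open>e = f\<close> in \<open>auto simp: alternating_Cons\<close>)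
  ultimately show ?case
    using p' by simp
qed simp

lemma alternating_exists:
  assumes "u \<in> {0..<int m}"
  shows "\<exists>p v. (u, p, v) \<in> qpaths Q \<and> alternating p \<and> length p = l \<and> (p \<noteq> [] \<longrightarrow> is_fwd (hd p) = d)"
  using assms
proof (induction l arbitrary: u d)
  case 0
  then show ?case
    by (intro exI[of _ "[]"] exI[of _ u]) (simp add: qpaths_Nil)
next
  case (Suc l)
  let ?w = "if d then (u + 1) mod int m else (u - 1) mod int m"
  have w: "?w \<in> {0..<int m}"
    using m by auto
  obtain p v where p: "(?w, p, v) \<in> qpaths Q" "alternating p" "length p = l" "p \<noteq> [] \<longrightarrow> is_fwd (hd p) = (\<not> d)"
    using Suc.IH[OF w, of "\<not> d"] by blast
  have "(u, arrow_at u d # p, v) \<in> qpaths Q"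
    using p(1) arrow_at[OF Suc.prems, of d] by (simp add: qpaths_Cons)
  then show ?case
    using p arrow_at(3)[OF Suc.prems, of d]
    by (intro exI[of _ "arrow_at u d # p"] exI[of _ v]) (auto simp: alternating_Cons)
qed

lemma path_class_basis:
  "x \<in> qpaths Q \<Longrightarrow> path_class N x = Some b \<Longrightarrow> b \<in> zz_basis N m"
  using qpaths_start by (cases x) (auto simp: path_class_def split: if_splits)

lemma path_class_surj:
  assumes "b \<in> zz_basis N m"
  shows "\<exists>x \<in> qpaths Q. path_class N x = Some b"
proof -
  obtain u d l where b: "b = (u, d, l)"
    by (cases b)
  then have u: "u \<in> {0..<int m}"
    using assms by simp
  obtain p v where "(u, p, v) \<in> qpaths Q" "alternating p" "length p = l" "p \<noteq> [] \<longrightarrow> is_fwd (hd p) = d"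
    using alternating_exists[OF u, of l d] by blast
  then show ?thesis
    using assms b by (intro bexI[of _ "(u, p, v)"]) (auto simp: path_class_def)
qed

text \<open>\<open>zz_mult\<close> really is the multiplication table of classes, with
  \<open>None\<close> absorbing: a path with a factor that is not alternating or too long has the
  same defect.\<close>

lemma path_class_comp:
  assumes x: "x \<in> qpaths Q" and y: "y \<in> qpaths Q"
  shows "Option.bind (qpath_comp x y) (path_class N)
    = Option.bind (path_class N x) (\<lambda>b. Option.bind (path_class N y) (zz_mult N m b))"
proof -
  obtain u p v v' q w where xy: "x = (u, p, v)" "y = (v', q, w)"
    by (metis surj_pair)
  define d e where "d = (p = [] \<or> is_fwd (hd p))" and "e = (q = [] \<or> is_fwd (hd q))"
  show ?thesis
  proof (cases "alternating p \<and> alternating q \<and> length p \<le> 2 * N \<and> length q \<le> 2 * N")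
    case False
    then show ?thesis
      by (auto simp: xy path_class_def alternating_append)
  next
    case True
    have v: "v = zz_end m (u, d, length p)"
      using x True unfolding xy by (intro alternating_end) (auto simp: d_def)
    \<comment> \<open>Canonicalisation alters the direction only at lengths 0 and
      \<open>2 * N\<close>; both are even, where the end vertex does not depend on it.\<close>
    have v2: "zz_end m (u, d', length p) = v" if "d' = (d \<or> length p = 0 \<or> length p = 2 * N)" for d'
      using that unfolding v by (auto simp: zz_end_def)
    have last: "p \<noteq> [] \<Longrightarrow> is_fwd (last p) = (d = odd (length p))"
      using True is_fwd_last[of p] by (auto simp: d_def)
    have alt: "alternating (p @ q) \<longleftrightarrow> length p = 0 \<or> length q = 0 \<or> e = (d = even (length p))"
      using True last by (cases "p = []"; cases "q = []") (auto simp: alternating_append e_def)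
    have "path_class N x = Some (zz_canon N (u, d, length p))" "path_class N y = Some (zz_canon N (v', e, length q))"
      using True by (auto simp: xy path_class_def d_def e_def)
    moreover have "Option.bind (qpath_comp x y) (path_class N) =
      (if v = v' \<and> alternating (p @ q) \<and> length p + length q \<le> 2 * N
       then Some (zz_canon N (u, if length p = 0 then e else d, length p + length q)) else None)"
      by (auto simp: xy path_class_def d_def e_def)
    moreover have "zz_mult N m (zz_canon N (u, d, length p)) (zz_canon N (v', e, length q)) =
      (if v = v' \<and> alternating (p @ q) \<and> length p + length q \<le> 2 * N
       then Some (zz_canon N (u, if length p = 0 then e else d, length p + length q)) else None)"
    proof -
      have "length p = 0 \<Longrightarrow> d" "length q = 0 \<Longrightarrow> e"
        by (auto simp: d_def e_def)
      then show ?thesis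
        unfolding alt using True v2[OF refl] N
        by (cases "length p = 0"; cases "length q = 0"; cases "length p = 2 * N"; cases "length q = 2 * N")
          (auto simp: zz_mult_def)
    qed
    ultimately show ?thesis
      by simp
  qed
qed

text \<open>The bilinear extension of \<open>path_class_comp\<close>, written with 0/1 indicators so
  that the sums over paths and over classes can be interchanged. It makes the kernel of
  \<open>class_coord\<close> a two-sided ideal.\<close>

lemma class_coord_mult:
  fixes f g :: "'k::field pathalg"
  assumes f: "Poly_Mapping.keys f \<subseteq> qpaths Q" and g: "Poly_Mapping.keys g \<subseteq> qpaths Q"
  shows "class_coord N (f \<otimes>\<^bsub>kQ m\<^esub> g) b = (\<Sum>c\<in>zz_basis N m. \<Sum>d\<in>zz_basis N m.
    if zz_mult N m c d = Some b then class_coord N f c * class_coord N g d else 0)"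
proof -
  let ?B = "zz_basis N m"
  let ?I = "\<lambda>P. if P then 1 else (0::'k)"
  have I_mult: "?I P * ?I R = ?I (P \<and> R)" for P R
    by simp
  have single: "class_coord N (comp_single x y c) b = (\<Sum>i\<in>?B. \<Sum>j\<in>?B.
      ?I (zz_mult N m i j = Some b) * ?I (path_class N x = Some i) * ?I (path_class N y = Some j) * c)"
    if x: "x \<in> qpaths Q" and y: "y \<in> qpaths Q" for x y c
  proof -
    have "class_coord N (comp_single x y c) b = (if Option.bind (qpath_comp x y) (path_class N) = Some b then c else 0)"
      by (auto simp: comp_single_def split: option.split)
    also have "\<dots> = (\<Sum>i\<in>?B. \<Sum>j\<in>?B.
      ?I (zz_mult N m i j = Some b) * ?I (path_class N x = Some i) * ?I (path_class N y = Some j) * c)"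
    proof (cases "path_class N x = None \<or> path_class N y = None")
      case True
      then show ?thesis
        unfolding path_class_comp[OF x y] by auto
    next
      case False
      then obtain i0 j0 where ij: "path_class N x = Some i0" "path_class N y = Some j0"
        by auto
      have B: "i0 \<in> ?B" "j0 \<in> ?B"
        using path_class_basis x y ij by auto
      have "(\<Sum>i\<in>?B. \<Sum>j\<in>?B. ?I (zz_mult N m i j = Some b) * ?I (path_class N x = Some i) * ?I (path_class N y = Some j) * c)
          = (\<Sum>i\<in>?B. if i = i0 then (\<Sum>j\<in>?B. if j = j0 then ?I (zz_mult N m i0 j0 = Some b) * c else 0) else 0)"
        by (rule sum.cong) (auto simp: ij intro!: sum.cong sum.neutral)
      also have "\<dots> = ?I (zz_mult N m i0 j0 = Some b) * c"
        using B finite_zz_basis by simp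
      finally show ?thesis
        unfolding path_class_comp[OF x y] by (simp add: ij)
    qed
    finally show ?thesis .
  qed
  have coord: "class_coord N h i = (\<Sum>x\<in>Poly_Mapping.keys h. ?I (path_class N x = Some i) * Poly_Mapping.lookup h x)"
    for h :: "'k pathalg" and i
    unfolding class_coord_def by (rule sum.cong) auto
  have "class_coord N (f \<otimes>\<^bsub>kQ m\<^esub> g) b = (\<Sum>x\<in>Poly_Mapping.keys f. \<Sum>y\<in>Poly_Mapping.keys g. \<Sum>i\<in>?B. \<Sum>j\<in>?B.
      ?I (zz_mult N m i j = Some b) * ?I (path_class N x = Some i) * ?I (path_class N y = Some j)
        * (Poly_Mapping.lookup f x * Poly_Mapping.lookup g y))"
    unfolding path_algebra_mult class_coord_sum
    by (intro sum.cong refl single) (use f g in auto)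
  also have "\<dots> = (\<Sum>i\<in>?B. \<Sum>j\<in>?B. \<Sum>x\<in>Poly_Mapping.keys f. \<Sum>y\<in>Poly_Mapping.keys g.
      ?I (zz_mult N m i j = Some b) * ?I (path_class N x = Some i) * ?I (path_class N y = Some j)
        * (Poly_Mapping.lookup f x * Poly_Mapping.lookup g y))"
    (is "?L = ?R")
  proof -
    let ?t = "\<lambda>x y i j. ?I (zz_mult N m i j = Some b) * ?I (path_class N x = Some i) * ?I (path_class N y = Some j)
        * (Poly_Mapping.lookup f x * Poly_Mapping.lookup g y)"
    let ?F = "Poly_Mapping.keys f" and ?G = "Poly_Mapping.keys g"
    have "?L = (\<Sum>x\<in>?F. \<Sum>i\<in>?B. \<Sum>y\<in>?G. \<Sum>j\<in>?B. ?t x y i j)"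
      by (rule sum.cong[OF refl], rule sum.swap)
    also have "\<dots> = (\<Sum>i\<in>?B. \<Sum>x\<in>?F. \<Sum>y\<in>?G. \<Sum>j\<in>?B. ?t x y i j)"
      by (rule sum.swap)
    also have "\<dots> = (\<Sum>i\<in>?B. \<Sum>x\<in>?F. \<Sum>j\<in>?B. \<Sum>y\<in>?G. ?t x y i j)"
      by (rule sum.cong[OF refl], rule sum.cong[OF refl], rule sum.swap)
    also have "\<dots> = ?R"
      by (rule sum.cong[OF refl], rule sum.swap)
    finally show ?thesis .
  qed
  also have "\<dots> = (\<Sum>c\<in>?B. \<Sum>d\<in>?B.
    if zz_mult N m c d = Some b then class_coord N f c * class_coord N g d else 0)"
    unfolding coord[of f] coord[of g] sum_product
    by (intro sum.cong refl) (auto simp: algebra_simps intro!: sum.cong)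
  finally show ?thesis .
qed

lemma class_coord_diff: "class_coord N (f - g) b = class_coord N f b - class_coord N g b"
  using class_coord_add[of N f "- g" b] by (simp add: class_coord_neg)

lemma path_algebra_r_diff:
  "g \<otimes>\<^bsub>path_algebra G\<^esub> (f - f') = g \<otimes>\<^bsub>path_algebra G\<^esub> f - g \<otimes>\<^bsub>path_algebra G\<^esub> f'"
  using path_algebra_r_distr[of G g "f - f'" f'] by (simp add: eq_diff_eq)

lemma path_algebra_l_diff:
  "(f - f') \<otimes>\<^bsub>path_algebra G\<^esub> g = f \<otimes>\<^bsub>path_algebra G\<^esub> g - f' \<otimes>\<^bsub>path_algebra G\<^esub> g"
  using path_algebra_l_distr[of G "f - f'" f' g] by (simp add: eq_diff_eq)

section \<open>The relations lie in the kernel of the coordinate map\<close>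

definition class_kernel :: "'k::field pathalg set" where
  "class_kernel = {f. Poly_Mapping.keys f \<subseteq> qpaths Q \<and> (\<forall>b. class_coord N f b = 0)}"

lemma kQ_neg:
  fixes f :: "'k::field pathalg"
  assumes "f \<in> carrier (kQ m)"
  shows "\<ominus>\<^bsub>kQ m\<^esub> f = - f"
proof -
  interpret R: ring "kQ m :: ('k, 'k pathalg) module"
    by (rule kQ_ring)
  show ?thesis
    by (rule R.minus_equality) (use assms in \<open>simp_all add: keys_neg\<close>)
qed

lemma kQ_minus:
  fixes f g :: "'k::field pathalg"
  assumes "g \<in> carrier (kQ m)"
  shows "f \<ominus>\<^bsub>kQ m\<^esub> g = f - g"
  by (simp add: a_minus_def kQ_neg[OF assms])

lemma class_kernel_ideal: "ideal (class_kernel :: 'k::field pathalg set) (kQ m)"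
proof -
  interpret R: ring "kQ m :: ('k, 'k pathalg) module"
    by (rule kQ_ring)
  show ?thesis
  proof (rule idealI[OF kQ_ring])
    show "subgroup (class_kernel :: 'k pathalg set) (add_monoid (kQ m))"
    proof (rule R.add.subgroupI)
      show "\<ominus>\<^bsub>kQ m\<^esub> f \<in> class_kernel" if "f \<in> class_kernel" for f :: "'k pathalg"
        using that kQ_neg[of f] by (simp add: class_kernel_def class_coord_neg keys_neg)
      show "f \<oplus>\<^bsub>kQ m\<^esub> g \<in> class_kernel"
        if "f \<in> class_kernel" "g \<in> class_kernel" for f g :: "'k pathalg"
        using that keys_add[of f g] by (auto simp: class_kernel_def class_coord_add)
      have "0 \<in> (class_kernel :: 'k pathalg set)"
        by (simp add: class_kernel_def)
      then show "(class_kernel :: 'k pathalg set) \<noteq> {}"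
        by blast
    qed (auto simp: class_kernel_def)
    fix a x :: "'k pathalg"
    assume "a \<in> class_kernel" "x \<in> carrier (kQ m)"
    then have a: "Poly_Mapping.keys a \<subseteq> qpaths Q" "\<And>b. class_coord N a b = 0"
      and x: "Poly_Mapping.keys x \<subseteq> qpaths Q"
      by (auto simp: class_kernel_def)
    show "x \<otimes>\<^bsub>kQ m\<^esub> a \<in> class_kernel"
      unfolding class_kernel_def using path_algebra_mult_closed[OF x a(1)]
      by (auto simp: class_coord_mult[OF x a(1)] a(2) intro!: sum.neutral)
    show "a \<otimes>\<^bsub>kQ m\<^esub> x \<in> class_kernel"
      unfolding class_kernel_def using path_algebra_mult_closed[OF a(1) x]
      by (auto simp: class_coord_mult[OF a(1) x] a(2) intro!: sum.neutral)
  qed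
qed

definition loop_word :: "arrow \<Rightarrow> arrow \<Rightarrow> nat \<Rightarrow> arrow list" where
  "loop_word e e' n = concat (replicate n [e, e'])"

lemma loop_word_0 [simp]: "loop_word e e' 0 = []"
  by (simp add: loop_word_def)

lemma length_loop_word: "length (loop_word e e' n) = 2 * n"
  by (induction n) (auto simp: loop_word_def)

lemma hd_loop_word: "n > 0 \<Longrightarrow> hd (loop_word e e' n) = e"
  by (cases n) (auto simp: loop_word_def)

lemma alternating_loop_word:
  assumes "is_fwd e \<noteq> is_fwd e'"
  shows "alternating (loop_word e e' n)"
proof (induction n)
  case (Suc n)
  have "loop_word e e' (Suc n) = e # e' # loop_word e e' n"
    by (simp add: loop_word_def)
  then show ?case
    using Suc assms hd_loop_word[of n e e'] by (cases n) (auto simp: alternating_Cons)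
qed (simp add: loop_word_def)

lemma loop_word_qpath:
  assumes "(u, [e, e'], u) \<in> qpaths Q"
  shows "(u, loop_word e e' n, u) \<in> qpaths Q"
proof (induction n)
  case 0
  then show ?case
    using qpaths_start[OF assms] by (simp add: loop_word_def qpaths_Nil)
next
  case (Suc n)
  have "loop_word e e' (Suc n) = [e, e'] @ loop_word e e' n"
    by (simp add: loop_word_def)
  then show ?case
    using Suc assms qpaths_append[of u "[e, e']" "loop_word e e' n" u] by auto
qed

text \<open>The case \<open>n = 0\<close> is excluded because the zeroth power is the unit of the
  whole algebra, not the trivial path at \<open>u\<close>.\<close>

lemma loop_pow:
  assumes "(u, [e], w) \<in> qpaths Q" "(w, [e'], u) \<in> qpaths Q" "n \<ge> 1"
  shows "(Poly_Mapping.single (u, [e], w) (1::'k::field) \<otimes>\<^bsub>kQ m\<^esub> Poly_Mapping.single (w, [e'], u) 1) [^]\<^bsub>kQ m\<^esub> n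
    = Poly_Mapping.single (u, loop_word e e' n, u) 1"
proof -
  interpret R: ring "kQ m :: ('k, 'k pathalg) module"
    by (rule kQ_ring)
  have p: "(u, [e, e'], u) \<in> qpaths Q"
    using assms qpaths_append[of u "[e]" "[e']" u] by auto
  have x: "Poly_Mapping.single (u, [e], w) (1::'k) \<otimes>\<^bsub>kQ m\<^esub> Poly_Mapping.single (w, [e'], u) 1
      = Poly_Mapping.single (u, [e, e'], u) 1"
    by (simp add: path_algebra_mult_single comp_single_def)
  have xc: "Poly_Mapping.single (u, [e, e'], u) (1::'k) \<in> carrier (kQ m)"
    using p by simp
  show ?thesis
    unfolding x using assms(3)
  proof (induction n rule: nat_induct_at_least)
    case base
    then show ?case
      using R.nat_pow_eone[OF xc] by (simp add: loop_word_def)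
  next
    case (Suc n)
    have "Poly_Mapping.single (u, [e, e'], u) (1::'k) [^]\<^bsub>kQ m\<^esub> Suc n
        = Poly_Mapping.single (u, [e, e'], u) 1 \<otimes>\<^bsub>kQ m\<^esub> Poly_Mapping.single (u, [e, e'], u) 1 [^]\<^bsub>kQ m\<^esub> n"
      by (rule R.nat_pow_Suc2[OF xc])
    then show ?case
      unfolding Suc.IH by (simp add: path_algebra_mult_single comp_single_def loop_word_def)
  qed
qed

lemma aQ_eq: "aQ m i = Poly_Mapping.single (i mod int m, [Fwd (i mod int m)], (i + 1) mod int m) 1"
  by (simp add: aQ_def arrow_elem_def mod_add_left_eq)

lemma abarQ_eq: "abarQ m i = Poly_Mapping.single ((i + 1) mod int m, [Bwd (i mod int m)], i mod int m) 1"
  by (simp add: abarQ_def arrow_elem_def mod_add_left_eq)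

lemma arrow_qpaths:
  "(i mod int m, [Fwd (i mod int m)], (i + 1) mod int m) \<in> qpaths Q"
  "((i + 1) mod int m, [Bwd (i mod int m)], i mod int m) \<in> qpaths Q"
  using m by (auto simp: qpaths_Cons qpaths_Nil mod_add_left_eq)

lemma aQ_mult_aQ: "aQ m i \<otimes>\<^bsub>kQ m\<^esub> aQ m (i + 1) = Poly_Mapping.single
    (i mod int m, [Fwd (i mod int m), Fwd ((i + 1) mod int m)], (i + 1 + 1) mod int m) (1::'k::field)"
  by (simp add: aQ_eq path_algebra_mult_single comp_single_def)

lemma abarQ_mult_abarQ: "abarQ m (i + 1) \<otimes>\<^bsub>kQ m\<^esub> abarQ m i = Poly_Mapping.single
    ((i + 1 + 1) mod int m, [Bwd ((i + 1) mod int m), Bwd (i mod int m)], i mod int m) (1::'k::field)"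
  by (simp add: abarQ_eq path_algebra_mult_single comp_single_def)

lemma aQ_abarQ_pow: "(aQ m i \<otimes>\<^bsub>kQ m\<^esub> abarQ m i) [^]\<^bsub>kQ m\<^esub> N = Poly_Mapping.single
    (i mod int m, loop_word (Fwd (i mod int m)) (Bwd (i mod int m)) N, i mod int m) (1::'k::field)"
  unfolding aQ_eq abarQ_eq by (rule loop_pow[OF arrow_qpaths N])

lemma abarQ_aQ_pow: "(abarQ m (i - 1) \<otimes>\<^bsub>kQ m\<^esub> aQ m (i - 1)) [^]\<^bsub>kQ m\<^esub> N = Poly_Mapping.single
    (i mod int m, loop_word (Bwd ((i - 1) mod int m)) (Fwd ((i - 1) mod int m)) N, i mod int m) (1::'k::field)"
  using loop_pow[OF arrow_qpaths(2)[of "i - 1"] arrow_qpaths(1)[of "i - 1"] N] unfolding aQ_eq abarQ_eq by simp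

lemma loop_qpaths:
  "(i mod int m, [Fwd (i mod int m), Bwd (i mod int m)], i mod int m) \<in> qpaths Q"
  "(i mod int m, [Bwd ((i - 1) mod int m), Fwd ((i - 1) mod int m)], i mod int m) \<in> qpaths Q"
  using m by (auto simp: qpaths_Cons qpaths_Nil mod_add_left_eq)

lemma relations_cases:
  assumes "f \<in> (relations N m :: 'k::field pathalg set)"
  obtains i where "f = aQ m i \<otimes>\<^bsub>kQ m\<^esub> aQ m (i + 1)"
    | i where "f = abarQ m (i + 1) \<otimes>\<^bsub>kQ m\<^esub> abarQ m i"
    | i where "f = Poly_Mapping.single
        (i mod int m, loop_word (Fwd (i mod int m)) (Bwd (i mod int m)) N, i mod int m) 1
      - Poly_Mapping.single
        (i mod int m, loop_word (Bwd ((i - 1) mod int m)) (Fwd ((i - 1) mod int m)) N, i mod int m) 1"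
proof -
  have "Poly_Mapping.single
      (i mod int m, loop_word (Bwd ((i - 1) mod int m)) (Fwd ((i - 1) mod int m)) N, i mod int m) (1::'k)
      \<in> carrier (kQ m)" for i
    using loop_word_qpath[OF loop_qpaths(2)] by simp
  then show ?thesis
    using assms that unfolding relations_def aQ_abarQ_pow abarQ_aQ_pow
    by (auto simp: kQ_minus simp del: path_algebra_simps(1))
qed

lemma loop_relation:
  "Poly_Mapping.single
      (i mod int m, loop_word (Fwd (i mod int m)) (Bwd (i mod int m)) N, i mod int m) 1
    - Poly_Mapping.single
      (i mod int m, loop_word (Bwd ((i - 1) mod int m)) (Fwd ((i - 1) mod int m)) N, i mod int m) 1
    \<in> (relations N m :: 'k::field pathalg set)"
proof -
  have "Poly_Mapping.single
      (i mod int m, loop_word (Bwd ((i - 1) mod int m)) (Fwd ((i - 1) mod int m)) N, i mod int m) (1::'k)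
      \<in> carrier (kQ m)"
    using loop_word_qpath[OF loop_qpaths(2)] by simp
  then show ?thesis
    unfolding relations_def aQ_abarQ_pow abarQ_aQ_pow kQ_minus[OF \<open>_ \<in> carrier (kQ m)\<close>, symmetric] by blast
qed

lemma keys_diff_subset: "Poly_Mapping.keys f \<subseteq> S \<Longrightarrow> Poly_Mapping.keys g \<subseteq> S \<Longrightarrow> Poly_Mapping.keys (f - g) \<subseteq> S"
  for f g :: "'k::field pathalg"
  using keys_add[of f "- g"] by (auto simp: keys_neg)

lemma relations_kernel: "(relations N m :: 'k::field pathalg set) \<subseteq> class_kernel"
proof
  fix f :: "'k pathalg" assume "f \<in> relations N m"
  then show "f \<in> class_kernel"
  proof (cases rule: relations_cases)
    case (1 i)
    have "(i mod int m, [Fwd (i mod int m), Fwd ((i + 1) mod int m)], (i + 1 + 1) mod int m) \<in> qpaths Q"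
      using m by (auto simp: qpaths_Cons qpaths_Nil mod_add_left_eq)
    then show ?thesis
      unfolding 1 aQ_mult_aQ by (simp add: class_kernel_def path_class_def alternating_Cons)
  next
    case (2 i)
    have "((i + 1 + 1) mod int m, [Bwd ((i + 1) mod int m), Bwd (i mod int m)], i mod int m) \<in> qpaths Q"
      using m by (auto simp: qpaths_Cons qpaths_Nil mod_add_left_eq)
    then show ?thesis
      unfolding 2 abarQ_mult_abarQ by (simp add: class_kernel_def path_class_def alternating_Cons)
  next
    case (3 i)
    let ?x = "(i mod int m, loop_word (Fwd (i mod int m)) (Bwd (i mod int m)) N, i mod int m)"
      and ?y = "(i mod int m, loop_word (Bwd ((i - 1) mod int m)) (Fwd ((i - 1) mod int m)) N, i mod int m)"
    have x: "?x \<in> qpaths Q" and y: "?y \<in> qpaths Q"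
      by (rule loop_word_qpath loop_qpaths)+
    \<comment> \<open>The two full loops at a vertex start in opposite directions;
      \<open>zz_canon\<close> identifies them because their length is \<open>2 * N\<close>.\<close>
    have "path_class N ?x = path_class N ?y"
      using N by (simp add: path_class_def length_loop_word alternating_loop_word)
    then have "class_coord N f b = 0" for b
      unfolding 3 by (simp add: class_coord_diff)
    moreover have "Poly_Mapping.keys f \<subseteq> qpaths Q"
      unfolding 3 using x y by (intro keys_diff_subset) auto
    ultimately show ?thesis
      by (simp add: class_kernel_def)
  qed
qed

lemma relations_carrier: "(relations N m :: 'k::field pathalg set) \<subseteq> carrier (kQ m)"
  using relations_kernel by (auto simp: class_kernel_def)

lemma rel_ideal_ideal: "ideal (rel_ideal N m :: 'k::field pathalg set) (kQ m)"
  unfolding rel_ideal_def by (rule ring.genideal_ideal[OF kQ_ring relations_carrier])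

lemma relations_in_ideal: "f \<in> relations N m \<Longrightarrow> f \<in> rel_ideal N m"
  unfolding rel_ideal_def using ring.genideal_self[OF kQ_ring relations_carrier] by blast

lemma rel_ideal_kernel: "(rel_ideal N m :: 'k::field pathalg set) \<subseteq> class_kernel"
  unfolding rel_ideal_def by (rule ring.genideal_minimal[OF kQ_ring class_kernel_ideal relations_kernel])

lemma rel_ideal_add: "f \<in> rel_ideal N m \<Longrightarrow> g \<in> rel_ideal N m \<Longrightarrow> f + g \<in> (rel_ideal N m :: 'k::field pathalg set)"
  using additive_subgroup.a_closed[OF ideal.axioms(1)[OF rel_ideal_ideal], of f g] by simp

lemma rel_ideal_zero: "0 \<in> (rel_ideal N m :: 'k::field pathalg set)"
  using additive_subgroup.zero_closed[OF ideal.axioms(1)[OF rel_ideal_ideal]] by simp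

lemma rel_ideal_mult_left:
  "Poly_Mapping.keys f \<subseteq> qpaths Q \<Longrightarrow> g \<in> rel_ideal N m \<Longrightarrow> f \<otimes>\<^bsub>kQ m\<^esub> g \<in> (rel_ideal N m :: 'k::field pathalg set)"
  using ideal.I_l_closed[OF rel_ideal_ideal, of g f] by simp

lemma rel_ideal_mult_right:
  "Poly_Mapping.keys f \<subseteq> qpaths Q \<Longrightarrow> g \<in> rel_ideal N m \<Longrightarrow> g \<otimes>\<^bsub>kQ m\<^esub> f \<in> (rel_ideal N m :: 'k::field pathalg set)"
  using ideal.I_r_closed[OF rel_ideal_ideal, of g f] by simp

section \<open>The kernel lies in the ideal\<close>

text \<open>Two consecutive arrows of the same direction form one of the quadratic monomial
  relations; multiply it by the rest of the path on both sides.\<close>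

lemma not_alternating_in_ideal:
  assumes "(u, p, v) \<in> qpaths Q" "\<not> alternating p"
  shows "Poly_Mapping.single (u, p, v) c \<in> (rel_ideal N m :: 'k::field pathalg set)"
proof -
  obtain p1 e e' p2 where p: "p = p1 @ [e, e'] @ p2" and same: "is_fwd e = is_fwd e'"
    using not_alternatingE[OF assms(2)] .
  obtain a b where ab: "(u, p1, a) \<in> qpaths Q" "(a, [e, e'], b) \<in> qpaths Q" "(b, p2, v) \<in> qpaths Q"
    using assms(1) unfolding p qpaths_append by blast
  have e: "e \<in> arcs Q" "a = tail Q e" "e' \<in> arcs Q" "head Q e = tail Q e'" "b = head Q e'"
    using ab(2) by (auto simp: qpaths_Cons qpaths_Nil)
  have "Poly_Mapping.single (a, [e, e'], b) (1::'k) \<in> relations N m"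
  proof (cases e)
    case (Fwd i)
    then obtain j where "e' = Fwd j"
      using same by (cases e') auto
    then have "Poly_Mapping.single (a, [e, e'], b) (1::'k) = aQ m i \<otimes>\<^bsub>kQ m\<^esub> aQ m (i + 1)"
      using Fwd e mod_add_left_eq[of "i + 1" "int m" 1] unfolding aQ_mult_aQ by auto
    then show ?thesis
      by (auto simp: relations_def)
  next
    case (Bwd i)
    then obtain j where "e' = Bwd j"
      using same by (cases e') auto
    then have "Poly_Mapping.single (a, [e, e'], b) (1::'k) = abarQ m (j + 1) \<otimes>\<^bsub>kQ m\<^esub> abarQ m j"
      using Bwd e mod_add_left_eq[of "j + 1" "int m" 1] unfolding abarQ_mult_abarQ by auto
    then show ?thesis
      by (auto simp: relations_def)
  qed
  then have "Poly_Mapping.single (u, p1, a) c \<otimes>\<^bsub>kQ m\<^esub> Poly_Mapping.single (a, [e, e'], b) 1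
      \<otimes>\<^bsub>kQ m\<^esub> Poly_Mapping.single (b, p2, v) 1 \<in> (rel_ideal N m :: 'k pathalg set)"
    using ab by (intro rel_ideal_mult_right rel_ideal_mult_left relations_in_ideal) auto
  then show ?thesis
    by (simp add: p path_algebra_mult_single comp_single_def)
qed

lemma full_loops_congruent:
  assumes p: "(u, p, v) \<in> qpaths Q" "alternating p" "length p = 2 * N"
    and p': "(u, p', v') \<in> qpaths Q" "alternating p'" "length p' = 2 * N"
  shows "Poly_Mapping.single (u, p, v) c - Poly_Mapping.single (u, p', v') c \<in> (rel_ideal N m :: 'k::field pathalg set)"
proof -
  have u: "u \<in> {0..<int m}" "u mod int m = u"
    using qpaths_start[OF p(1)] by auto
  have v: "v = u" "v' = u"
    using alternating_end[OF p(1,2) refl] alternating_end[OF p'(1,2) refl] p(3) p'(3) by (auto simp: zz_end_def)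
  have word: "q = loop_word (Fwd u) (Bwd u) N"
    if "(u, q, u) \<in> qpaths Q" "alternating q" "length q = 2 * N" "is_fwd (hd q)" for q
    by (rule alternating_unique[OF that(1) loop_word_qpath[OF loop_qpaths(1)[of u, unfolded u]]])
      (use that N in \<open>auto simp: alternating_loop_word length_loop_word hd_loop_word\<close>)
  have word': "q = loop_word (Bwd ((u - 1) mod int m)) (Fwd ((u - 1) mod int m)) N"
    if "(u, q, u) \<in> qpaths Q" "alternating q" "length q = 2 * N" "\<not> is_fwd (hd q)" for q
    by (rule alternating_unique[OF that(1) loop_word_qpath[OF loop_qpaths(2)[of u, unfolded u]]])
      (use that N in \<open>auto simp: alternating_loop_word length_loop_word hd_loop_word\<close>)
  let ?a = "(u, loop_word (Fwd u) (Bwd u) N, u)"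
    and ?b = "(u, loop_word (Bwd ((u - 1) mod int m)) (Fwd ((u - 1) mod int m)) N, u)"
  have rel: "Poly_Mapping.single ?a t - Poly_Mapping.single ?b t \<in> (rel_ideal N m :: 'k pathalg set)" for t :: 'k
  proof -
    \<comment> \<open>An ideal of the ring \<open>kQ m\<close> is closed under ring multiplication,
      so the scalar enters as a multiple of the trivial path.\<close>
    have "Poly_Mapping.single (u, [], u) t \<otimes>\<^bsub>kQ m\<^esub> (Poly_Mapping.single ?a 1 - Poly_Mapping.single ?b 1)
        \<in> (rel_ideal N m :: 'k pathalg set)"
      using relations_in_ideal[OF loop_relation[of u, where 'k = 'k]] u
      by (intro rel_ideal_mult_left) (auto simp: qpaths_Nil)
    then show ?thesis
      by (simp add: path_algebra_r_diff path_algebra_mult_single comp_single_def)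
  qed
  show ?thesis
    using word[of p] word[of p'] word'[of p] word'[of p'] p p' v rel[of c] rel[of "- c"] rel_ideal_zero
    by (cases "is_fwd (hd p)"; cases "is_fwd (hd p')") (auto simp: single_uminus)
qed

text \<open>Modulo the ideal the first \<open>2 * N\<close> arrows may be replaced by the other full
  loop at \<open>u\<close>. That loop ends in the direction of the following arrow \<open>e\<close>,
  so the new path is not alternating and lies in the ideal.\<close>

lemma long_alternating_in_ideal:
  assumes p: "(u, p, v) \<in> qpaths Q" "alternating p" "length p > 2 * N"
  shows "Poly_Mapping.single (u, p, v) c \<in> (rel_ideal N m :: 'k::field pathalg set)"
proof -
  let ?p1 = "take (2 * N) p"
  obtain e p2 where e: "drop (2 * N) p = e # p2"
    using p(3) by (cases "drop (2 * N) p") auto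
  have split: "p = ?p1 @ e # p2"
    using e append_take_drop_id[of "2 * N" p] by simp
  have l1: "length ?p1 = 2 * N"
    using p(3) by simp
  have alt: "alternating ?p1" "is_fwd (last ?p1) \<noteq> is_fwd e"
    using p(2) l1 N unfolding alternating_append[of ?p1 "e # p2", folded split] by auto
  obtain w where w: "(u, ?p1, w) \<in> qpaths Q" "(w, e # p2, v) \<in> qpaths Q"
    using p(1) qpaths_append[of u ?p1 "e # p2" v, folded split] by blast
  have u: "u \<in> {0..<int m}"
    by (rule qpaths_start[OF p(1)])
  obtain q w' where q: "(u, q, w') \<in> qpaths Q" "alternating q" "length q = 2 * N"
    "q \<noteq> [] \<longrightarrow> is_fwd (hd q) = (\<not> is_fwd (hd ?p1))"
    using alternating_exists[OF u] by blast
  have ww: "w = u" "w' = u"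
    using alternating_end[OF w(1) alt(1) refl] alternating_end[OF q(1,2) refl] l1 q(3) by (auto simp: zz_end_def)
  have ne: "q \<noteq> []" "?p1 \<noteq> []"
    using q(3) l1 N by auto
  then have "is_fwd (last q) = is_fwd e"
    using is_fwd_last[OF q(2)] is_fwd_last[OF alt(1)] q(3,4) l1 alt(2) by auto
  then have "\<not> alternating (q @ e # p2)"
    using ne by (simp add: alternating_append)
  moreover have "(u, q @ e # p2, v) \<in> qpaths Q"
    using q(1) w(2) ww qpaths_append by blast
  ultimately have 1: "Poly_Mapping.single (u, q @ e # p2, v) c \<in> (rel_ideal N m :: 'k pathalg set)"
    by (rule not_alternating_in_ideal[rotated])
  have "(Poly_Mapping.single (u, ?p1, w) c - Poly_Mapping.single (u, q, w') c)
      \<otimes>\<^bsub>kQ m\<^esub> Poly_Mapping.single (u, e # p2, v) 1 \<in> (rel_ideal N m :: 'k pathalg set)"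
    using w(2) ww by (intro rel_ideal_mult_right full_loops_congruent w(1) alt(1) l1 q(1-3)) auto
  then have "Poly_Mapping.single (u, p, v) c - Poly_Mapping.single (u, q @ e # p2, v) c
      \<in> (rel_ideal N m :: 'k pathalg set)"
    unfolding path_algebra_l_diff path_algebra_mult_single comp_single_def
    by (simp add: ww split[symmetric])
  from rel_ideal_add[OF this 1] show ?thesis
    by simp
qed

lemma path_class_None_in_ideal:
  assumes "x \<in> qpaths Q" "path_class N x = None"
  shows "Poly_Mapping.single x c \<in> (rel_ideal N m :: 'k::field pathalg set)"
proof -
  obtain u p v where x: "x = (u, p, v)"
    by (cases x)
  then show ?thesis
    using assms not_alternating_in_ideal[of u p v c] long_alternating_in_ideal[of u p v c]
    by (cases "alternating p") (auto simp: path_class_def not_le split: if_splits)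
qed

text \<open>Two paths of one class are equal unless they are full loops at the same vertex.\<close>

lemma path_class_eq_congruent:
  assumes "x \<in> qpaths Q" "y \<in> qpaths Q" "path_class N x = Some b" "path_class N y = Some b"
  shows "Poly_Mapping.single x c - Poly_Mapping.single y c \<in> (rel_ideal N m :: 'k::field pathalg set)"
proof -
  obtain u p v u' p' v' where xy: "x = (u, p, v)" "y = (u', p', v')"
    by (metis surj_pair)
  have cl: "alternating p" "alternating p'" "u' = u" "length p' = length p" "length p \<le> 2 * N"
    "length p = 2 * N \<or> (p = [] \<or> is_fwd (hd p)) = (p' = [] \<or> is_fwd (hd p'))"
    using assms(3,4) by (auto simp: xy path_class_def split: if_splits)
  show ?thesis
  proof (cases "length p = 2 * N")
    case True
    then show ?thesis
      unfolding xy using assms(1,2) cl by (auto simp: xy intro!: full_loops_congruent)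
  next
    case False
    have p: "(u, p, v) \<in> qpaths Q" and p': "(u, p', v') \<in> qpaths Q"
      using assms(1,2) cl(3) by (auto simp: xy)
    have "p = p'"
      by (rule alternating_unique[OF p p' cl(1,2)]) (use cl False in auto)
    moreover have "v = v'"
      using alternating_end[OF p cl(1) refl] alternating_end[OF p' cl(2) refl] \<open>p = p'\<close> by simp
    ultimately show ?thesis
      using cl rel_ideal_zero by (simp add: xy)
  qed
qed

definition class_rep :: "int \<times> bool \<times> nat \<Rightarrow> (int, arrow) qpath" where
  "class_rep b = (SOME x. x \<in> qpaths Q \<and> path_class N x = Some b)"

lemma class_rep:
  assumes "b \<in> zz_basis N m"
  shows "class_rep b \<in> qpaths Q" "path_class N (class_rep b) = Some b"
proof -
  have "\<exists>x. x \<in> qpaths Q \<and> path_class N x = Some b"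
    using path_class_surj[OF assms] by blast
  from someI_ex[OF this] show "class_rep b \<in> qpaths Q" "path_class N (class_rep b) = Some b"
    by (auto simp: class_rep_def)
qed

text \<open>Modulo the ideal each path in \<open>f\<close> becomes 0 or the representative of its
  class. The coefficient collected at a representative is the class coordinate of \<open>f\<close>,
  which vanishes on the kernel, so nothing is left.\<close>

lemma rel_ideal_eq_kernel: "rel_ideal N m = (class_kernel :: 'k::field pathalg set)"
proof
  show "class_kernel \<subseteq> (rel_ideal N m :: 'k pathalg set)"
  proof
    fix f :: "'k pathalg" assume "f \<in> class_kernel"
    then have f: "Poly_Mapping.keys f \<subseteq> qpaths Q" "\<And>b. class_coord N f b = 0"
      by (auto simp: class_kernel_def)
    let ?F = "Poly_Mapping.keys f" and ?l = "Poly_Mapping.lookup f"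
    define g where "g x = (case path_class N x of None \<Rightarrow> 0 | Some b \<Rightarrow> Poly_Mapping.single (class_rep b) (?l x))" for x
    have diff: "Poly_Mapping.single x (?l x) - g x \<in> rel_ideal N m" if x: "x \<in> ?F" for x
    proof (cases "path_class N x")
      case None
      then show ?thesis
        using path_class_None_in_ideal[OF subsetD[OF f(1) x] None] by (simp add: g_def)
    next
      case (Some b)
      have "b \<in> zz_basis N m"
        using path_class_basis f(1) x Some by blast
      from class_rep[OF this] show ?thesis
        using Some f(1) x by (auto simp: g_def intro: path_class_eq_congruent)
    qed
    have "(\<Sum>x\<in>S. Poly_Mapping.single x (?l x) - g x) \<in> rel_ideal N m" if "S \<subseteq> ?F" for S
      using finite_subset[OF that finite_keys] that
      by (induction S rule: finite_induct) (auto simp: rel_ideal_zero rel_ideal_add diff)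
    from this[OF order.refl] have "f - (\<Sum>x\<in>?F. g x) \<in> rel_ideal N m"
      unfolding sum_subtractf by (simp flip: poly_mapping_sum_single)
    moreover have "(\<Sum>x\<in>?F. g x) = 0"
    proof (rule poly_mapping_eqI)
      fix y
      have lg: "Poly_Mapping.lookup (g x) y = (if \<exists>b. path_class N x = Some b \<and> class_rep b = y then ?l x else 0)" for x
        by (auto simp: g_def lookup_single when_def split: option.split)
      have rep: "path_class N (class_rep b) = Some b" if "x \<in> ?F" "path_class N x = Some b" for x b
        using class_rep(2) path_class_basis f(1) that by blast
      show "Poly_Mapping.lookup (\<Sum>x\<in>?F. g x) y = Poly_Mapping.lookup 0 y"
      proof (cases "\<exists>b. path_class N y = Some b \<and> class_rep b = y")
        case True
        then obtain b where b: "path_class N y = Some b" "class_rep b = y"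
          by blast
        \<comment> \<open>A representative has its own class, so distinct classes have distinct
          representatives and their coefficients do not mix.\<close>
        have iff: "(\<exists>b'. path_class N x = Some b' \<and> class_rep b' = y) \<longleftrightarrow> path_class N x = Some b" if "x \<in> ?F" for x
        proof
          assume "\<exists>b'. path_class N x = Some b' \<and> class_rep b' = y"
          then obtain b' where b': "path_class N x = Some b'" "class_rep b' = y"
            by blast
          have "path_class N y = Some b'"
            using rep[OF that b'(1)] unfolding b'(2) .
          then show "path_class N x = Some b"
            using b(1) b'(1) by simp
        qed (use b(2) in blast)
        have "Poly_Mapping.lookup (\<Sum>x\<in>?F. g x) y = class_coord N f b"
          unfolding lookup_sum lg class_coord_def by (rule sum.cong[OF refl]) (simp only: iff)
        then show ?thesis
          using f(2) by simp
      next
        case False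
        have "Poly_Mapping.lookup (g x) y = 0" if x: "x \<in> ?F" for x
        proof -
          have "\<not> (\<exists>b. path_class N x = Some b \<and> class_rep b = y)"
            using False rep[OF x] by blast
          then show ?thesis
            unfolding lg by (simp only: if_False)
        qed
        then have "(\<Sum>x\<in>?F. Poly_Mapping.lookup (g x) y) = 0"
          by (intro sum.neutral ballI)
        then show ?thesis
          unfolding lookup_sum by simp
      qed
    qed
    ultimately show "f \<in> rel_ideal N m"
      by simp
  qed
qed (rule rel_ideal_kernel)


section \<open>Coordinates on \<open>A\<close>\<close>

text \<open>The choice of a representative is harmless: elements of one coset differ by the kernel
  of \<open>class_coord\<close>, see \<open>coord_coset\<close>.\<close>

definition coord :: "'k::field pathalg set \<Rightarrow> int \<times> bool \<times> nat \<Rightarrow> 'k" where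
  "coord S = class_coord N (SOME x. x \<in> S)"

abbreviation coset :: "'k::field pathalg \<Rightarrow> 'k pathalg set" where
  "coset x \<equiv> rel_ideal N m +>\<^bsub>kQ m\<^esub> x"

lemma algA_simps:
  fixes A :: "('k::field, 'k pathalg set) module"
  assumes "A = algA N m"
  shows "carrier A = a_rcosets\<^bsub>kQ m\<^esub> (rel_ideal N m)"
    "monoid.mult A = rcoset_mult (kQ m) (rel_ideal N m)"
    "one A = coset (one (kQ m))"
    "add A = set_add (kQ m)"
    "module.smult A = (\<lambda>c S. \<Union>x\<in>S. coset (c \<odot>\<^bsub>kQ m\<^esub> x))"
  by (simp_all add: assms algA_def quotient_algebra_def FactRing_def ring.extend_def module.fields_def)

lemma algA_carrier: "carrier (algA N m) = coset ` {x :: 'k::field pathalg. Poly_Mapping.keys x \<subseteq> qpaths Q}"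
  unfolding algA_simps(1)[OF refl] A_RCOSETS_def' by auto

lemma class_kernel_coord: "h \<in> class_kernel \<Longrightarrow> class_coord N h b = 0"
  unfolding class_kernel_def by blast

lemma coset_mem_iff: "y \<in> coset x \<longleftrightarrow> (\<exists>h \<in> class_kernel. y = h + x)"
  unfolding a_r_coset_def' rel_ideal_eq_kernel by auto

lemma coord_coset: "coord (coset x) = class_coord N x"
proof -
  have "0 \<in> (class_kernel :: 'a pathalg set)"
    by (simp add: class_kernel_def)
  then have "x \<in> coset x"
    unfolding coset_mem_iff by force
  then have "(SOME y. y \<in> coset x) \<in> coset x"
    by (rule someI)
  then obtain h where "h \<in> class_kernel" "(SOME y. y \<in> coset x) = h + x"
    unfolding coset_mem_iff by blast
  then show ?thesis
    unfolding coord_def by (intro ext) (simp add: class_coord_add class_kernel_coord)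
qed

lemma coset_add:
  fixes x y :: "'k::field pathalg"
  assumes "Poly_Mapping.keys x \<subseteq> qpaths Q" "Poly_Mapping.keys y \<subseteq> qpaths Q"
  shows "coset x \<oplus>\<^bsub>algA N m\<^esub> coset y = coset (x + y)"
proof -
  interpret ideal "rel_ideal N m :: 'k pathalg set" "kQ m"
    by (rule rel_ideal_ideal)
  show ?thesis
    using a_rcos_sum[of x y] assms unfolding algA_simps(4)[OF refl] by simp
qed

lemma coset_mult:
  fixes x y :: "'k::field pathalg"
  assumes "Poly_Mapping.keys x \<subseteq> qpaths Q" "Poly_Mapping.keys y \<subseteq> qpaths Q"
  shows "coset x \<otimes>\<^bsub>algA N m\<^esub> coset y = coset (x \<otimes>\<^bsub>kQ m\<^esub> y)"
proof -
  interpret ideal "rel_ideal N m :: 'k pathalg set" "kQ m"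
    by (rule rel_ideal_ideal)
  show ?thesis
    using rcoset_mult_add[of x y] assms unfolding algA_simps(2)[OF refl] by simp
qed

lemma coset_eqI:
  fixes x y :: "'k::field pathalg"
  assumes "Poly_Mapping.keys x \<subseteq> qpaths Q" "Poly_Mapping.keys y \<subseteq> qpaths Q"
    "\<And>b. class_coord N x b = class_coord N y b"
  shows "coset x = coset y"
proof -
  interpret ideal "rel_ideal N m :: 'k pathalg set" "kQ m"
    by (rule rel_ideal_ideal)
  have "x - y \<in> class_kernel"
    using assms keys_diff_subset[OF assms(1,2)] by (simp add: class_kernel_def class_coord_diff)
  then have "x \<in> coset y"
    unfolding coset_mem_iff by (metis diff_add_cancel)
  then show ?thesis
    using a_repr_independence[OF \<open>x \<in> coset y\<close> _ a_subgroup] assms(2) by simp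
qed

lemma smult_keys: "Poly_Mapping.keys x \<subseteq> qpaths Q \<Longrightarrow> Poly_Mapping.keys (Poly_Mapping.map ((*) c) x) \<subseteq> qpaths Q"
  for x :: "'k::field pathalg"
  by (auto simp: in_keys_iff lookup_map_mult)

text \<open>The union in \<open>quotient_algebra\<close> runs over all elements of the coset, but
  each contributes the same coset.\<close>

lemma coset_smult:
  fixes x :: "'k::field pathalg"
  assumes x: "Poly_Mapping.keys x \<subseteq> qpaths Q"
  shows "c \<odot>\<^bsub>algA N m\<^esub> coset x = coset (Poly_Mapping.map ((*) c) x)"
proof -
  have "coset (Poly_Mapping.map ((*) c) y) = coset (Poly_Mapping.map ((*) c) x)" if y: "y \<in> coset x" for y
  proof -
    obtain h where h: "h \<in> class_kernel" "y = h + x"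
      using y unfolding coset_mem_iff by blast
    then have y: "Poly_Mapping.keys y \<subseteq> qpaths Q" "\<And>b. class_coord N y b = class_coord N x b"
      using x keys_add[of h x] class_kernel_coord[OF h(1)] by (auto simp: class_kernel_def class_coord_add)
    show ?thesis
      by (rule coset_eqI) (simp_all add: smult_keys x y class_coord_smult)
  qed
  moreover have "x \<in> coset x"
    unfolding coset_mem_iff by (rule bexI[of _ 0]) (simp_all add: class_kernel_def)
  ultimately show ?thesis
    unfolding algA_simps(5)[OF refl] path_algebra_simps by blast
qed

lemma algA_ring: "ring (algA N m :: ('k::field, 'k pathalg set) module)"
  unfolding algA_def quotient_algebra_def
  by (rule ring_extend_ring[OF ideal.quotient_is_ring[OF rel_ideal_ideal]])

lemma algA_zigzag:
  assumes "even m" "(2::'k::field) \<noteq> 0"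
  shows "zigzag (algA N m :: ('k, 'k pathalg set) module) N m coord"
proof -
  let ?A = "algA N m :: ('k, 'k pathalg set) module"
  interpret A: ring ?A
    by (rule algA_ring)
  have rep: "\<exists>x. Poly_Mapping.keys x \<subseteq> qpaths Q \<and> S = coset x" if "S \<in> carrier ?A" for S
    using that unfolding algA_carrier by blast
  show ?thesis
  proof unfold_locales
    show "finite (zz_basis N m)"
      by (rule finite_zz_basis)
    \<comment> \<open>Closure of the table is inherited from composition of paths that represent the
      two classes.\<close>
    fix b c d assume bc: "b \<in> zz_basis N m" "c \<in> zz_basis N m" "zz_mult N m b c = Some d"
    obtain x y where xy: "x \<in> qpaths Q" "path_class N x = Some b" "y \<in> qpaths Q" "path_class N y = Some c"
      using path_class_surj bc(1,2) by blast
    then have "Option.bind (qpath_comp x y) (path_class N) = Some d"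
      using path_class_comp[OF xy(1,3)] bc(3) by simp
    then obtain z where z: "qpath_comp x y = Some z" "path_class N z = Some d"
      unfolding bind_eq_Some_conv by blast
    show "d \<in> zz_basis N m"
      by (rule path_class_basis[OF qpath_comp_closed[OF xy(1,3) z(1)] z(2)])
  next
    show "inj_on coord (carrier ?A)"
    proof (rule inj_onI)
      fix S T assume "S \<in> carrier ?A" "T \<in> carrier ?A" and eq: "coord S = coord T"
      then obtain x y where x: "Poly_Mapping.keys x \<subseteq> qpaths Q" "S = coset x"
        and y: "Poly_Mapping.keys y \<subseteq> qpaths Q" "T = coset y"
        using rep by blast
      show "S = T"
        unfolding x(2) y(2)
        by (rule coset_eqI[OF x(1) y(1)]) (use eq in \<open>simp add: x(2) y(2) coord_coset\<close>)
    qed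
    show "coord ` carrier ?A = {F. \<forall>b. b \<notin> zz_basis N m \<longrightarrow> F b = 0}"
    proof (intro equalityI subsetI)
      fix F assume "F \<in> coord ` carrier ?A"
      then obtain x where x: "Poly_Mapping.keys x \<subseteq> qpaths Q" "F = class_coord N x"
        unfolding algA_carrier by (auto simp: coord_coset)
      have "class_coord N x b = 0" if "b \<notin> zz_basis N m" for b
      proof -
        have "path_class N y \<noteq> Some b" if "y \<in> Poly_Mapping.keys x" for y
          using path_class_basis x(1) that \<open>b \<notin> zz_basis N m\<close> by blast
        then show ?thesis
          unfolding class_coord_def by (intro sum.neutral ballI) simp
      qed
      then show "F \<in> {F. \<forall>b. b \<notin> zz_basis N m \<longrightarrow> F b = 0}"
        using x(2) by simp
    next
      fix F :: "int \<times> bool \<times> nat \<Rightarrow> 'k" assume F: "F \<in> {F. \<forall>b. b \<notin> zz_basis N m \<longrightarrow> F b = 0}"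
      \<comment> \<open>The preimage of \<open>F\<close>: one representative per class with the
        prescribed coefficient.\<close>
      define x where "x = (\<Sum>b\<in>zz_basis N m. Poly_Mapping.single (class_rep b) (F b))"
      have "Poly_Mapping.keys x \<subseteq> qpaths Q"
        unfolding x_def using class_rep(1) by (intro order.trans[OF keys_sum UN_least]) auto
      moreover have "class_coord N x = F"
      proof
        fix b
        have "class_coord N x b = (\<Sum>c\<in>zz_basis N m. if c = b then F b else 0)"
          unfolding x_def class_coord_sum by (intro sum.cong) (auto simp: class_rep(2))
        also have "\<dots> = (if b \<in> zz_basis N m then F b else 0)"
          by (rule sum.delta[OF finite_zz_basis])
        finally show "class_coord N x b = F b"
          using F by (metis (mono_tags, lifting) mem_Collect_eq)
      qed
      ultimately show "F \<in> coord ` carrier ?A"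
        unfolding algA_carrier image_image coord_coset by blast
    qed
  next
    fix S T and b :: "int \<times> bool \<times> nat" and t :: 'k
    assume S: "S \<in> carrier ?A"
    then obtain x where x: "Poly_Mapping.keys x \<subseteq> qpaths Q" "S = coset x"
      using rep by blast
    show "t \<odot>\<^bsub>?A\<^esub> S \<in> carrier ?A"
      unfolding x(2) coset_smult[OF x(1)] algA_carrier using smult_keys[OF x(1)] by blast
    show "coord (t \<odot>\<^bsub>?A\<^esub> S) b = t * coord S b"
      unfolding x(2) coset_smult[OF x(1)] coord_coset by (rule class_coord_smult)
    assume T: "T \<in> carrier ?A"
    then obtain y where y: "Poly_Mapping.keys y \<subseteq> qpaths Q" "T = coset y"
      using rep by blast
    show "coord (S \<oplus>\<^bsub>?A\<^esub> T) b = coord S b + coord T b"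
      unfolding x(2) y(2) coset_add[OF x(1) y(1)] coord_coset by (rule class_coord_add)
    show "coord (S \<otimes>\<^bsub>?A\<^esub> T) b = (\<Sum>c\<in>zz_basis N m. \<Sum>d\<in>zz_basis N m.
        if zz_mult N m c d = Some b then coord S c * coord T d else 0)"
      unfolding x(2) y(2) coset_mult[OF x(1) y(1)] coord_coset by (rule class_coord_mult[OF x(1) y(1)])
  next
    fix u :: int and d and l :: nat
    have "coord \<one>\<^bsub>?A\<^esub> (u, d, l) = (\<Sum>v\<in>{0..<int m}. if v = u then if d \<and> l = 0 then 1 else 0 else 0)"
      unfolding algA_simps(3)[OF refl] coord_coset path_algebra_simps(4) class_coord_sum
      by (auto simp: path_class_def intro!: sum.cong)
    then show "coord \<one>\<^bsub>?A\<^esub> (u, d, l) = (if 0 \<le> u \<and> u < int m \<and> d \<and> l = 0 then 1 else 0)"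
      by auto
  qed (use N m assms in auto)
qed

end

theorem theorem9p3p1:
  fixes N m :: nat
    and A :: "('k::field, 'k pathalg set) module"
    and U\<^sub>1 U\<^sub>2 U\<^sub>3 :: "'k pathalg set set"
  assumes "N \<ge> 1" and "m \<ge> 3" and "even m"
    and "\<not> CHAR('k) dvd 2" and "\<not> CHAR('k) dvd N" and "\<not> CHAR('k) dvd m"
    and "A = algA N m"
    and "U\<^sub>1 = linear_span A {\<one>\<^bsub>A\<^esub>}"
    and "U\<^sub>2 = linear_span A {eps N m 0}"
    and "U\<^sub>3 = linear_span A
           ({ff N m i [^]\<^bsub>A\<^esub> s | (i::int) (s::nat). 1 \<le> s \<and> s \<le> N - 1} \<union>
            {eps N m i \<oplus>\<^bsub>A\<^esub> eps N m (i + 1) | i::int. True})"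
  shows "is_direct_sum A (HH0 A) [U\<^sub>1, U\<^sub>2, U\<^sub>3] \<and>
         HH1_indecomposable A U\<^sub>1 \<and>
         HH1_indecomposable A U\<^sub>2 \<and>
         HH1_submodule A U\<^sub>3 \<and>
         (N \<ge> 2 \<longrightarrow> HH1_indecomposable A U\<^sub>3)"
proof -
  interpret Q: zigzag_quiver N m
    by unfold_locales (fact assms)+
  have "of_nat 2 \<noteq> (0::'k)"
    using assms(4) unfolding of_nat_eq_0_iff_char_dvd .
  then have "(2::'k) \<noteq> 0"
    by simp
  then interpret zigzag A N m Q.coord
    unfolding assms(7) by (rule Q.algA_zigzag[OF assms(3)])
  have mod: "i mod int m \<in> {0..<int m}" for i
    using m by simp
  have keys: "Poly_Mapping.keys (aQ m i :: 'k pathalg) \<subseteq> qpaths Q.Q"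
    "Poly_Mapping.keys (abarQ m i :: 'k pathalg) \<subseteq> qpaths Q.Q" for i
    using Q.arrow_qpaths[of i] by (auto simp: Q.aQ_eq Q.abarQ_eq)
  have arrow_basis: "(i mod int m, True, 1) \<in> B" "(nx (i mod int m), False, 1) \<in> B" for i
    using mod[of i] N by auto
  have aA: "aA N m i = bas (i mod int m, True, 1)" for i
  proof (rule coord_eqI)
    show "aA N m i \<in> carrier A"
      unfolding aA_def assms(7) Q.algA_carrier using keys by blast
    show "Q.coord (aA N m i) b = Q.coord (bas (i mod int m, True, 1)) b" for b :: "int \<times> bool \<times> nat"
      unfolding aA_def Q.coord_coset coord_bas[OF arrow_basis(1)]
      using N by (auto simp: Q.aQ_eq path_class_def alternating_Cons)
  qed (rule bas_closed[OF arrow_basis(1)])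
  have abarA: "abarA N m i = bas (nx (i mod int m), False, 1)" for i
  proof (rule coord_eqI)
    show "abarA N m i \<in> carrier A"
      unfolding abarA_def assms(7) Q.algA_carrier using keys by blast
    show "Q.coord (abarA N m i) b = Q.coord (bas (nx (i mod int m), False, 1)) b" for b :: "int \<times> bool \<times> nat"
      unfolding abarA_def Q.coord_coset coord_bas[OF arrow_basis(2)]
      using N by (auto simp: Q.abarQ_eq path_class_def alternating_Cons nx_def mod_add_left_eq)
  qed (rule bas_closed[OF arrow_basis(2)])
  have loops: "aA N m i \<otimes>\<^bsub>A\<^esub> abarA N m i = bas (zz_canon N (i mod int m, True, 2))"
    "abarA N m i \<otimes>\<^bsub>A\<^esub> aA N m i = bas (zz_canon N (nx (i mod int m), False, 2))" for i
    unfolding aA abarA using N mod[of i]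
    by (intro bas_mult_Some arrow_basis; auto simp: zz_mult_def zz_end_simp numeral_2_eq_2)+
  have ff: "ff N m i = fel (i mod int m)" for i
    unfolding ff_def assms(7)[symmetric] loops fel_def ..
  have eps: "eps N m i = epsel (i mod int m)" for i
    unfolding eps_def assms(7)[symmetric] loops
    using bas_loop_pow[OF mod N order.refl, of i] by (simp add: epsel_def)
  have eps_sum: "eps N m i \<oplus>\<^bsub>A\<^esub> eps N m (i + 1) = fel (i mod int m) [^]\<^bsub>A\<^esub> N" for i
    unfolding eps fel_pow_N[OF mod] by (simp add: nx_def mod_add_left_eq)
  \<comment> \<open>The sums \<open>eps_i + eps_(i+1)\<close> are the missing powers
    \<open>s = N\<close>, so the stated generators are exactly those of \<open>fspan 1\<close>;
    integer indices are reduced modulo \<open>m\<close>.\<close>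
  have "{ff N m i [^]\<^bsub>A\<^esub> s | (i::int) (s::nat). 1 \<le> s \<and> s \<le> N - 1} \<union>
      {eps N m i \<oplus>\<^bsub>A\<^esub> eps N m (i + 1) | i::int. True}
    = {fel i [^]\<^bsub>A\<^esub> s | i s. i \<in> {0..<int m} \<and> 1 \<le> s \<and> s \<le> N}" (is "?L = ?R")
  proof
    show "?L \<subseteq> ?R"
      unfolding ff eps_sum using mod N by fastforce
    show "?R \<subseteq> ?L"
    proof
      fix x assume "x \<in> ?R"
      then obtain i s where x: "x = fel i [^]\<^bsub>A\<^esub> s" "i \<in> {0..<int m}" "1 \<le> s" "s \<le> N"
        by blast
      then have i: "i mod int m = i"
        by simp
      show "x \<in> ?L"
      proof (cases "s = N")
        case True
        then have "x = eps N m i \<oplus>\<^bsub>A\<^esub> eps N m (i + 1)"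
          unfolding eps_sum i x(1) by simp
        then show ?thesis
          by blast
      next
        case False
        then have "x = ff N m i [^]\<^bsub>A\<^esub> s" "1 \<le> s \<and> s \<le> N - 1"
          unfolding ff i using x by auto
        then show ?thesis
          by blast
      qed
    qed
  qed
  then have U3: "U\<^sub>3 = fspan 1"
    unfolding assms(10) fspan_def by (rule arg_cong)
  have 0: "0 \<in> {0..<int m}"
    using m by simp
  have U2: "U\<^sub>2 = linear_span A {epsel 0}"
    unfolding assms(9) eps by simp
  have one: "\<one>\<^bsub>A\<^esub> \<noteq> \<zero>\<^bsub>A\<^esub>"
    using coord_one[of 0 True 0] m by auto
  have eps0: "epsel 0 \<noteq> \<zero>\<^bsub>A\<^esub>"
    using coord_epsel[OF 0, of "(0, True, 2 * N)"] by auto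
  show ?thesis
    unfolding U3 U2 assms(8)
    using HH0_direct_sum HH1_indecomposable_singleton[OF one_closed one HH1_submodule_one]
      HH1_indecomposable_singleton[OF epsel_closed[OF 0] eps0 HH1_submodule_epsel[OF 0]]
      HH1_submodule_fspan_one HH1_indecomposable_fspan_one
    by blast
qed

end
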